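(* Let $D\subset\mathbb{C}^n$ be an open invariant set, $f\in\mathcal{SR}(\Omega_D)$, and let $a=(a_1,\dots,a_n)\in\Omega_D$ and $r_1,\dots,r_n\ge0$ be such that $\overline{B_{r_1}(a_1)}\times\dots\times\overline{B_{r_n}(a_n)}\subset\Omega_D$. Then for any $m=1,\dots,n$ $$\begin{aligned}f(a)=&\sum_{j=0}^{m-1}r_{\{1,\dots,j\}}\int_{(\mathbb{S}^3)^{j+1}}\overline{\lambda}_{\{1,\dots,j\}}\,\mathcal{S}^{\llbracket j\rrbracket}_\emptyset(f)\Big(a+\sum_{i=1}^{j+1}r_i\lambda_i\Big)\,d\sigma^{j+1}(\lambda)\\&+r_{\{1,\dots,m\}}\int_{(\mathbb{S}^3)^m}\overline{\lambda}_{\{1,\dots,m\}}\,\mathcal{S}^{\llbracket m\rrbracket}_\emptyset(f)\Big(a+\sum_{i=1}^{m}r_i\lambda_i\Big)\,d\sigma^m(\lambda),\end{aligned}$$ where $r_\emptyset=\overline\lambda_\emptyset=1$.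
   Context: Sets and products. $\mathbb{H}\cong\mathbb{R}^4$ denotes the quaternions, $\mathbb{S}_\mathbb{H}=\{J\in\mathbb{H}: J^2=-1\}$, $\mathcal{P}(m)$ is the power set of $\llbracket m\rrbracket:=\{1,\dots,m\}$, $\llbracket0\rrbracket=\emptyset$. For $K=\{k_1<\dots<k_p\}$ and quaternions $q_k$, $q_K:=q_{k_1}\cdots q_{k_p}$ (increasing order), $q_\emptyset:=1$; thus $r_{\{1,\dots,j\}}=r_1\cdots r_j$ and $\overline\lambda_{\{1,\dots,j\}}=\overline{\lambda_1}\cdots\overline{\lambda_j}$. For $z\in\mathbb{C}^n$ write $z_h=\alpha_h+i\beta_h$ with $\alpha_h,\beta_h\in\mathbb{R}$, and let $\overline z^h$ be $z$ with $z_h$ replaced by $\overline{z_h}$. Stem and slice functions. $D\subset\mathbb{C}^n$ is invariant if $z\in D\iff\overline z^h\in D$ for all $h$. Let $\{e_K\}_{K\in\mathcal{P}(n)}$ be a basis of $\mathbb{R}^{2^n}$. A stem function on $D$ is a continuous $F=\sum_{K\in\mathcal{P}(n)}e_KF_K:D\to\mathbb{H}\otimes\mathbb{R}^{2^n}$ ($F_K$ $\mathbb{H}$-valued) with $F_K(\overline z^h)=(-1)^{|K\cap\{h\}|}F_K(z)$ for all $K,h$. The circularization of $D$ is $\Omega_D=\{(\alpha_1+J_1\beta_1,\dots,\alpha_n+J_n\beta_n): (\alpha_1+i\beta_1,\dots,\alpha_n+i\beta_n)\in D,\ J_1,\dots,J_n\in\mathbb{S}_\mathbb{H}\}$. $F$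 induces the slice function $f=\mathcal{I}(F):\Omega_D\to\mathbb{H}$, $f(x)=\sum_{K}J_KF_K(z)$ for $x=(\alpha_h+J_h\beta_h)_h$, $z=(\alpha_h+i\beta_h)_h$; the stem function $F$ is determined by $f$. $\mathcal{S}(\Omega_D)$ is the set of slice functions on $\Omega_D$. Regularity. $\mathcal{J}_h(q\otimes e_K)=(-1)^{|K\cap\{h\}|}q\otimes e_{K\Delta\{h\}}$ ($\Delta$ = symmetric difference) and $\overline\partial_h=\frac12(\partial/\partial\alpha_h+\mathcal{J}_h\,\partial/\partial\beta_h)$. A $C^1$ stem function $F$ is holomorphic if $\overline\partial_hF=0$ for every $h=1,\dots,n$; $f=\mathcal{I}(F)$ is slice regular if $F$ is holomorphic. $\mathcal{SR}(\Omega_D)$ is the set of slice regular functions. Components. For $H\in\mathcal{P}(n)$ let $H^c=\{1,\dots,n\}\setminus H$, $D_H=\{z\in D:\beta_h\ne0\ \forall h\in H\}$, $\Omega_{D_H}$ its circularization, and for $f=\mathcal{I}(F)\in\mathcal{S}(\Omega_D)$ let $f'_{s,H}=\mathcal{I}(F'_H)\in\mathcal{S}(\Omega_{D_H})$, where $F'_H(z)=\big(\prod_{h\in H}\beta_h\big)^{-1}\sum_{K\subset H^c}e_KF_{K\cup H}(z)$. Set $\mathcal{S}^{\llbracket j\rrbracket}_\emptyset(f):=f'_{s,\llbracket j\rrbracket}$ on $\Omega_{D_{\llbracket j\rrbracket}}$; in particular $\mathcal{S}^{\llbracket0\rrbracket}_\emptyset(f)=f$. When $f$ is slice regular, $\mathcal{S}^{\llbracket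 j\rrbracket}_\emptyset(f)$ extends continuously (in a unique way) to $\Omega_D$ and the extension is denoted by the same symbol. Conventions. $\overline{B_r(q)}=\{x\in\mathbb{H}:|x-q|\le r\}$. $\mathbb{S}^3$ is the unit sphere of $\mathbb{H}\cong\mathbb{R}^4$, $\sigma$ its surface measure normalized by $\sigma(\mathbb{S}^3)=1$, $\sigma^l$ the $l$-fold product measure, in the variables $\lambda=(\lambda_1,\dots,\lambda_l)$. For $a\in\mathbb{H}^n$ and quaternions $q_i$ ($i\in I\subset\{1,\dots,n\}$), $a+\sum_{i\in I}q_i$ denotes the point of $\mathbb{H}^n$ obtained from $a$ by replacing $a_i$ with $a_i+q_i$ for each $i\in I$. *)

theory Defs
  imports "HOL-Analysis.Analysis"
begin

section \<open>Quaternions\<close>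

datatype quat = Quat (Qre: real) (Qi: real) (Qj: real) (Qk: real)

lemma quat_eq_iff: "x = y \<longleftrightarrow> Qre x = Qre y \<and> Qi x = Qi y \<and> Qj x = Qj y \<and> Qk x = Qk y"
  by (cases x; cases y) simp

lemma quat_eqI:
  "Qre x = Qre y \<Longrightarrow> Qi x = Qi y \<Longrightarrow> Qj x = Qj y \<Longrightarrow> Qk x = Qk y \<Longrightarrow> x = y"
  by (simp add: quat_eq_iff)

instantiation quat :: ab_group_add
begin

definition "0 = Quat 0 0 0 0"
definition "x + y = Quat (Qre x + Qre y) (Qi x + Qi y) (Qj x + Qj y) (Qk x + Qk y)"
definition "- x = Quat (- Qre x) (- Qi x) (- Qj x) (- Qk x)"
definition "x - y = Quat (Qre x - Qre y) (Qi x - Qi y) (Qj x - Qj y) (Qk x - Qk y)"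

instance
  by standard
    (simp_all add: zero_quat_def plus_quat_def uminus_quat_def minus_quat_def quat_eq_iff)

end

lemma quat_zero_simps [simp]: "Qre 0 = 0" "Qi 0 = 0" "Qj 0 = 0" "Qk 0 = 0"
  by (simp_all add: zero_quat_def)

lemma quat_plus_simps [simp]:
  "Qre (x + y) = Qre x + Qre y" "Qi (x + y) = Qi x + Qi y"
  "Qj (x + y) = Qj x + Qj y" "Qk (x + y) = Qk x + Qk y"
  by (simp_all add: plus_quat_def)

lemma quat_uminus_simps [simp]:
  "Qre (- x) = - Qre x" "Qi (- x) = - Qi x" "Qj (- x) = - Qj x" "Qk (- x) = - Qk x"
  by (simp_all add: uminus_quat_def)

lemma quat_minus_simps [simp]:
  "Qre (x - y) = Qre x - Qre y" "Qi (x - y) = Qi x - Qi y"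
  "Qj (x - y) = Qj x - Qj y" "Qk (x - y) = Qk x - Qk y"
  by (simp_all add: minus_quat_def)

instantiation quat :: ring_1
begin

definition "1 = Quat 1 0 0 0"
definition "x * y = Quat
  (Qre x * Qre y - Qi x * Qi y - Qj x * Qj y - Qk x * Qk y)
  (Qre x * Qi y + Qi x * Qre y + Qj x * Qk y - Qk x * Qj y)
  (Qre x * Qj y - Qi x * Qk y + Qj x * Qre y + Qk x * Qi y)
  (Qre x * Qk y + Qi x * Qj y - Qj x * Qi y + Qk x * Qre y)"

instance
  by standard (simp_all add: one_quat_def times_quat_def quat_eq_iff algebra_simps)

end

lemma quat_one_simps [simp]: "Qre 1 = 1" "Qi 1 = 0" "Qj 1 = 0" "Qk 1 = 0"
  by (simp_all add: one_quat_def)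

lemma quat_times_simps [simp]:
  "Qre (x * y) = Qre x * Qre y - Qi x * Qi y - Qj x * Qj y - Qk x * Qk y"
  "Qi (x * y) = Qre x * Qi y + Qi x * Qre y + Qj x * Qk y - Qk x * Qj y"
  "Qj (x * y) = Qre x * Qj y - Qi x * Qk y + Qj x * Qre y + Qk x * Qi y"
  "Qk (x * y) = Qre x * Qk y + Qi x * Qj y - Qj x * Qi y + Qk x * Qre y"
  by (simp_all add: times_quat_def)

instantiation quat :: real_algebra_1
begin

definition "c *\<^sub>R x = Quat (c * Qre x) (c * Qi x) (c * Qj x) (c * Qk x)"

instance
  by standard (simp_all add: scaleR_quat_def quat_eq_iff algebra_simps)

end

lemma quat_scaleR_simps [simp]:
  "Qre (c *\<^sub>R x) = c * Qre x" "Qi (c *\<^sub>R x) = c * Qi x"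
  "Qj (c *\<^sub>R x) = c * Qj x" "Qk (c *\<^sub>R x) = c * Qk x"
  by (simp_all add: scaleR_quat_def)

instantiation quat :: real_inner
begin

definition "x \<bullet> y = Qre x * Qre y + Qi x * Qi y + Qj x * Qj y + Qk x * Qk y"
definition "norm x = sqrt ((Qre x)\<^sup>2 + (Qi x)\<^sup>2 + (Qj x)\<^sup>2 + (Qk x)\<^sup>2)"
definition "sgn x = x /\<^sub>R norm x" for x :: quat
definition "dist x y = norm (x - y)" for x y :: quat
definition [code del]:
  "(uniformity :: (quat \<times> quat) filter) = (INF e\<in>{0 <..}. principal {(x, y). dist x y < e})"
definition [code del]:
  "open (U :: quat set) \<longleftrightarrow> (\<forall>x\<in>U. eventually (\<lambda>(x', y). x' = x \<longrightarrow> y \<in> U) uniformity)"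

instance
proof
  fix x y z :: quat and c :: real
  show "x \<bullet> y = y \<bullet> x" "(x + y) \<bullet> z = x \<bullet> z + y \<bullet> z" "(c *\<^sub>R x) \<bullet> y = c * (x \<bullet> y)"
    "0 \<le> x \<bullet> x" "norm x = sqrt (x \<bullet> x)"
    by (simp_all add: inner_quat_def norm_quat_def power2_eq_square algebra_simps)
  show "x \<bullet> x = 0 \<longleftrightarrow> x = 0"
    by (simp add: inner_quat_def quat_eq_iff add_nonneg_eq_0_iff)
qed (rule sgn_quat_def dist_quat_def uniformity_quat_def open_quat_def)+

end

declare uniformity_Abort [where 'a = quat, code]

definition quat_cnj :: "quat \<Rightarrow> quat" where
  "quat_cnj x = Quat (Qre x) (- Qi x) (- Qj x) (- Qk x)"

lemma quat_cnj_simps [simp]: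
  "Qre (quat_cnj x) = Qre x" "Qi (quat_cnj x) = - Qi x"
  "Qj (quat_cnj x) = - Qj x" "Qk (quat_cnj x) = - Qk x"
  by (simp_all add: quat_cnj_def)

lemma quat_norm_squared: "(norm (x::quat))\<^sup>2 = (Qre x)\<^sup>2 + (Qi x)\<^sup>2 + (Qj x)\<^sup>2 + (Qk x)\<^sup>2"
  unfolding norm_quat_def by (rule real_sqrt_pow2) simp

lemma quat_mult_cnj: "x * quat_cnj x = of_real ((norm x)\<^sup>2)" "quat_cnj x * x = of_real ((norm x)\<^sup>2)"
  by (simp_all add: quat_norm_squared quat_eq_iff of_real_def)
    (simp_all add: power2_eq_square)

instantiation quat :: real_normed_div_algebra
begin

definition "inverse x = quat_cnj x /\<^sub>R (norm x)\<^sup>2"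
definition "x div y = x * inverse y" for x y :: quat

instance
proof
  fix x y :: quat
  show "x \<noteq> 0 \<Longrightarrow> inverse x * x = 1" "x \<noteq> 0 \<Longrightarrow> x * inverse x = 1"
    by (simp_all add: inverse_quat_def quat_mult_cnj of_real_def)
  show "x div y = x * inverse y"
    by (rule divide_quat_def)
  show "inverse (0::quat) = 0"
    by (simp add: inverse_quat_def)
  have "(norm (x * y))\<^sup>2 = (norm x)\<^sup>2 * (norm y)\<^sup>2"
    by (simp only: quat_norm_squared quat_times_simps) (simp add: power2_eq_square algebra_simps)
  then have "(norm (x * y))\<^sup>2 = (norm x * norm y)\<^sup>2"
    by (simp only: power_mult_distrib)
  moreover have "0 \<le> norm z" for z :: quat
    by (simp add: norm_quat_def)
  ultimately show "norm (x * y) = norm x * norm y"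
    by (metis power2_eq_imp_eq mult_nonneg_nonneg)
qed

end

instantiation quat :: euclidean_space
begin

definition "Basis = {Quat 1 0 0 0, Quat 0 1 0 0, Quat 0 0 1 0, Quat 0 0 0 1}"

instance
proof
  fix u v x :: quat
  show "(Basis :: quat set) \<noteq> {}" "finite (Basis :: quat set)"
    by (simp_all add: Basis_quat_def)
  show "u \<in> Basis \<Longrightarrow> v \<in> Basis \<Longrightarrow> u \<bullet> v = (if u = v then 1 else 0)"
    unfolding Basis_quat_def by (elim insertE emptyE) (simp_all add: inner_quat_def)
  show "(\<forall>u\<in>Basis. x \<bullet> u = 0) \<longleftrightarrow> x = 0"
    by (cases x) (simp add: Basis_quat_def inner_quat_def zero_quat_def)
qed

end

lemma DIM_quat [simp]: "DIM(quat) = 4"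
  by (simp add: Basis_quat_def)

definition imag_units :: "quat set" where
  "imag_units = {J. J\<^sup>2 = -1}"


section \<open>Index sets and ordered products\<close>

text \<open>
  The coordinates of the n-dimensional spaces over the complex numbers and the quaternions are
  indexed by a finite linearly ordered type \<open>'n\<close>, which stands for \<open>{1 < 2 < ... < n}\<close> with
  \<open>n = CARD('n)\<close>.  In particular \<open>seg j\<close>, the set of the \<open>j\<close> smallest indices, is \<open>{1, ..., j}\<close>.
\<close>

definition seg :: "nat \<Rightarrow> 'n::{finite,linorder} set" where
  "seg j = {h. card {k. k < h} < j}"

definition ordered_prod :: "('n::{finite,linorder} \<Rightarrow> 'a::monoid_mult) \<Rightarrow> 'n set \<Rightarrow> 'a" where
  "ordered_prod q K = prod_list (map q (sorted_list_of_set K))"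

lemma seg_0 [simp]: "seg 0 = {}"
  by (simp add: seg_def)

lemma seg_card: "seg CARD('n) = (UNIV :: 'n::{finite,linorder} set)"
proof -
  have "card {k. k < h} < CARD('n)" for h :: 'n
    by (rule psubset_card_mono) auto
  then show ?thesis
    by (simp add: seg_def)
qed

lemma card_seg:
  assumes "j \<le> CARD('n)"
  shows "card (seg j :: 'n::{finite,linorder} set) = j"
proof -
  define c where "c h = card {k. k < h}" for h :: 'n
  have mono: "c h < c h'" if "h < h'" for h h'
    unfolding c_def using that by (intro psubset_card_mono) auto
  then have inj: "inj c"
    by (metis injI linorder_neq_iff)
  have "c h < CARD('n)" for h
    unfolding c_def by (rule psubset_card_mono) auto
  then have "range c \<subseteq> {..<CARD('n)}"
    by auto
  moreover have "card (range c) = CARD('n)"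
    using inj by (simp add: card_image)
  ultimately have "range c = {..<CARD('n)}"
    by (intro card_subset_eq) auto
  have "c ` seg j = {..<j}"
  proof -
    have "c ` seg j = range c \<inter> {..<j}"
      by (auto simp: seg_def c_def)
    then show ?thesis
      using assms \<open>range c = _\<close> by auto
  qed
  then show ?thesis
    using inj by (metis card_image card_lessThan inj_on_subset subset_UNIV)
qed


section \<open>Stem functions and slice functions\<close>

type_synonym 'n cvec = "(complex, 'n) vec"
type_synonym 'n qvec = "(quat, 'n) vec"

text \<open>
  The tensor product of the quaternions with the real space of dimension \<open>2 ^ n\<close> is identified with
  \<open>quat ^ ('n set)\<close> through the basis \<open>e\<^sub>K\<close>: the component of \<open>v\<close> with index \<open>K\<close> is \<open>v $ K\<close>, and
  \<open>q \<otimes> e\<^sub>K\<close> is \<open>axis K q\<close>.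
\<close>

type_synonym 'n stem = "(quat, 'n set) vec"

definition conj_at :: "'n::finite \<Rightarrow> 'n cvec \<Rightarrow> 'n cvec" where
  "conj_at h z = (\<chi> k. if k = h then cnj (z $ k) else z $ k)"

definition invariant_set :: "('n::finite) cvec set \<Rightarrow> bool" where
  "invariant_set D \<longleftrightarrow> (\<forall>z h. z \<in> D \<longleftrightarrow> conj_at h z \<in> D)"

definition stem_function :: "('n::finite) cvec set \<Rightarrow> ('n cvec \<Rightarrow> 'n stem) \<Rightarrow> bool" where
  "stem_function D F \<longleftrightarrow> continuous_on D F \<and>
     (\<forall>z\<in>D. \<forall>K h. F (conj_at h z) $ K = (-1) ^ card (K \<inter> {h}) * F z $ K)"

definition slice_point :: "('n::finite) qvec \<Rightarrow> 'n cvec \<Rightarrow> 'n qvec" where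
  "slice_point J z = (\<chi> h. of_real (Re (z $ h)) + J $ h * of_real (Im (z $ h)))"

definition circularization :: "('n::finite) cvec set \<Rightarrow> 'n qvec set" where
  "circularization D = {slice_point J z | J z. z \<in> D \<and> (\<forall>h. J $ h \<in> imag_units)}"

text \<open>
  \<open>induces D F f\<close> says that \<open>f = \<I>(F)\<close> on the circularization of \<open>D\<close>; the values of \<open>f\<close> outside
  the circularization are irrelevant.
\<close>

definition induces ::
  "('n::{finite,linorder}) cvec set \<Rightarrow> ('n cvec \<Rightarrow> 'n stem) \<Rightarrow> ('n qvec \<Rightarrow> quat) \<Rightarrow> bool"
where
  "induces D F f \<longleftrightarrow> (\<forall>z\<in>D. \<forall>J. (\<forall>h. J $ h \<in> imag_units) \<longrightarrow>
     f (slice_point J z) = (\<Sum>K\<in>UNIV. ordered_prod (\<lambda>h. J $ h) K * F z $ K))"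


section \<open>Slice regularity\<close>

definition C1_on :: "'a::real_normed_vector set \<Rightarrow> ('a \<Rightarrow> 'b::real_normed_vector) \<Rightarrow> bool" where
  "C1_on D F \<longleftrightarrow> (\<exists>F' :: 'a \<Rightarrow> 'a \<Rightarrow>\<^sub>L 'b.
     (\<forall>z\<in>D. (F has_derivative blinfun_apply (F' z)) (at z)) \<and> continuous_on D F')"

definition partial_deriv ::
  "('a::real_normed_vector \<Rightarrow> 'b::real_normed_vector) \<Rightarrow> 'a \<Rightarrow> 'a \<Rightarrow> 'b" where
  "partial_deriv F v z = vector_derivative (\<lambda>t. F (z + t *\<^sub>R v)) (at 0)"

definition stem_J :: "'n::finite \<Rightarrow> 'n stem \<Rightarrow> 'n stem" where
  "stem_J h v = (\<Sum>K\<in>UNIV. axis (sym_diff K {h}) ((-1) ^ card (K \<inter> {h}) * v $ K))"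

text \<open>The directions \<open>axis h 1\<close> and \<open>axis h \<i>\<close> belong to the real variables \<open>\<alpha>\<^sub>h\<close> and \<open>\<beta>\<^sub>h\<close>.\<close>

definition dbar ::
  "'n::finite \<Rightarrow> ('n cvec \<Rightarrow> 'n stem) \<Rightarrow> 'n cvec \<Rightarrow> 'n stem" where
  "dbar h F z =
     (1/2) *\<^sub>R (partial_deriv F (axis h 1) z + stem_J h (partial_deriv F (axis h \<i>) z))"

definition holomorphic_stem ::
  "('n::finite) cvec set \<Rightarrow> ('n cvec \<Rightarrow> 'n stem) \<Rightarrow> bool" where
  "holomorphic_stem D F \<longleftrightarrow> stem_function D F \<and> C1_on D F \<and> (\<forall>z\<in>D. \<forall>h. dbar h F z = 0)"

definition slice_regular ::
  "('n::{finite,linorder}) cvec set \<Rightarrow> ('n qvec \<Rightarrow> quat) \<Rightarrow> bool" where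
  "slice_regular D f \<longleftrightarrow> (\<exists>F. holomorphic_stem D F \<and> induces D F f)"


section \<open>Components\<close>

text \<open>The stem function of a slice function; its restriction to \<open>D\<close> is unique.\<close>

definition stem_of ::
  "('n::{finite,linorder}) cvec set \<Rightarrow> ('n qvec \<Rightarrow> quat) \<Rightarrow> 'n cvec \<Rightarrow> 'n stem" where
  "stem_of D f = (SOME F. stem_function D F \<and> induces D F f)"

definition nonreal_part :: "'n::finite set \<Rightarrow> 'n cvec set \<Rightarrow> 'n cvec set" where
  "nonreal_part H D = {z \<in> D. \<forall>h\<in>H. Im (z $ h) \<noteq> 0}"

definition stem_component ::
  "'n::finite set \<Rightarrow> ('n cvec \<Rightarrow> 'n stem) \<Rightarrow> 'n cvec \<Rightarrow> 'n stem" where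
  "stem_component H F z =
     inverse (\<Prod>h\<in>H. Im (z $ h)) *\<^sub>R (\<Sum>K\<in>Pow (- H). axis K (F z $ (K \<union> H)))"

text \<open>\<open>f'\<^sub>s\<^sub>,\<^sub>H\<close>, determined by its defining property on the circularization of \<open>nonreal_part H D\<close>.\<close>

definition spherical_component ::
  "('n::{finite,linorder}) cvec set \<Rightarrow> 'n set \<Rightarrow> ('n qvec \<Rightarrow> quat) \<Rightarrow> 'n qvec \<Rightarrow> quat" where
  "spherical_component D H f =
     (SOME g. induces (nonreal_part H D) (stem_component H (stem_of D f)) g)"

text \<open>
  The continuous extension of \<open>f'\<^sub>s\<^sub>,\<^sub>H\<close> with \<open>H = {1, ..., j}\<close>; for slice regular \<open>f\<close> it exists, and
  its values on the circularization of \<open>D\<close> are unique when \<open>D\<close> is open.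
\<close>

definition S_empty ::
  "('n::{finite,linorder}) cvec set \<Rightarrow> nat \<Rightarrow> ('n qvec \<Rightarrow> quat) \<Rightarrow> 'n qvec \<Rightarrow> quat" where
  "S_empty D j f = (SOME g. continuous_on (circularization D) g \<and>
     (\<forall>x\<in>circularization (nonreal_part (seg j) D). g x = spherical_component D (seg j) f x))"


section \<open>Normalized surface measure of the unit sphere\<close>

text \<open>
  The surface measure of a Borel subset \<open>A\<close> of the unit sphere in dimension 4 is 4 times the volume
  of the cone over \<open>A\<close> with apex 0 (polar coordinates); normalizing the total mass to 1 gives the image of
  the uniform distribution on the ball under radial projection, cf. \<open>emeasure_quat_sphere\<close> below.
  The underlying space of this measure is the sphere itself.
\<close>

definition quat_sphere :: "quat measure" where
  "quat_sphere = distr (uniform_measure lborel (ball 0 1)) (restrict_space borel (sphere 0 1))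
     (\<lambda>x. if x = 0 then 1 else sgn x)"

lemma space_quat_sphere [simp]: "space quat_sphere = sphere 0 1"
  by (simp add: quat_sphere_def space_restrict_space)

lemma sets_quat_sphere [simp, measurable_cong]:
  "sets quat_sphere = sets (restrict_space borel (sphere 0 1))"
  by (simp add: quat_sphere_def)

lemma emeasure_quat_sphere:
  assumes "A \<in> sets quat_sphere"
  shows "emeasure quat_sphere A =
    emeasure lborel {t *\<^sub>R x | t x. 0 < t \<and> t < 1 \<and> x \<in> A} / emeasure lborel (ball (0::quat) 1)"
proof -
  let ?p = "\<lambda>x::quat. if x = 0 then 1 else sgn x"
  let ?C = "{t *\<^sub>R x | t x. 0 < t \<and> t < 1 \<and> x \<in> A}"
  let ?M = "uniform_measure lborel (ball (0::quat) 1)"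
  have A: "A \<subseteq> sphere 0 1"
    using sets.sets_into_space[OF assms] by simp
  have "?p \<in> borel_measurable borel"
    unfolding sgn_div_norm by measurable
  then have p: "?p \<in> measurable ?M (restrict_space borel (sphere 0 1))"
    by (intro measurable_restrict_space2) (auto simp: norm_sgn)
  have meas: "?p -` A \<in> sets borel"
    using measurable_sets[OF p, of A] assms by simp
  have C: "?C = (ball 0 1 \<inter> ?p -` A) - {0}"
  proof (intro set_eqI iffI)
    fix y assume "y \<in> ?C"
    then obtain t x where y: "y = t *\<^sub>R x" "0 < t" "t < 1" "x \<in> A"
      by auto
    then show "y \<in> (ball 0 1 \<inter> ?p -` A) - {0}"
      using A by (auto simp: sgn_div_norm)
  next
    fix y assume "y \<in> (ball 0 1 \<inter> ?p -` A) - {0}"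
    then have "y = norm y *\<^sub>R sgn y \<and> 0 < norm y \<and> norm y < 1 \<and> sgn y \<in> A"
      by (auto simp: sgn_div_norm)
    then show "y \<in> ?C"
      by blast
  qed
  have "emeasure quat_sphere A = emeasure ?M (?p -` A)"
    unfolding quat_sphere_def using assms p by (simp add: emeasure_distr)
  also have "\<dots> = emeasure lborel (ball 0 1 \<inter> ?p -` A) / emeasure lborel (ball (0::quat) 1)"
    using meas by (intro emeasure_uniform_measure) auto
  also have "emeasure lborel (ball 0 1 \<inter> ?p -` A) = emeasure lborel ?C"
    unfolding C using meas by (intro emeasure_Diff_null_set[symmetric]) auto
  finally show ?thesis .
qed

lemma emeasure_space_quat_sphere: "emeasure quat_sphere (sphere 0 1) = 1"
proof -
  have "(\<lambda>x::quat. if x = 0 then 1 else sgn x) \<in> borel_measurable borel"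
    unfolding sgn_div_norm by measurable
  then have "(\<lambda>x::quat. if x = 0 then 1 else sgn x) \<in>
      measurable (uniform_measure lborel (ball 0 1)) (restrict_space borel (sphere 0 1))"
    by (intro measurable_restrict_space2) (auto simp: norm_sgn)
  then have "emeasure quat_sphere (sphere 0 1) =
      emeasure (uniform_measure lborel (ball 0 1)) ((\<lambda>x::quat. if x = 0 then 1 else sgn x) -` sphere 0 1)"
    unfolding quat_sphere_def
    by (subst emeasure_distr) (auto simp: sets_restrict_space intro!: image_eqI[where x = "sphere 0 1"])
  also have "(\<lambda>x::quat. if x = 0 then 1 else sgn x) -` sphere 0 1 = UNIV"
    by (auto simp: norm_sgn)
  also have "emeasure (uniform_measure lborel (ball (0::quat) 1)) UNIV = 1"
  proof -
    have "emeasure lborel (ball (0::quat) 1) \<noteq> 0"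
      using content_ball_pos[of 1 "0::quat"] by (auto simp: measure_def)
    moreover have "emeasure lborel (ball (0::quat) 1) \<noteq> \<infinity>"
      using emeasure_lborel_ball_finite[of "0::quat" 1] by auto
    ultimately show ?thesis
      by (subst emeasure_uniform_measure) (auto simp: ennreal_divide_self less_top)
  qed
  finally show ?thesis .
qed

text \<open>\<open>shift a I q\<close> is the point \<open>a + \<Sum>\<^bsub>i\<in>I\<^esub> q\<^sub>i\<close>, where \<open>q\<^sub>i\<close> is added to the coordinate \<open>a\<^sub>i\<close>.\<close>

definition shift :: "('n::finite) qvec \<Rightarrow> 'n set \<Rightarrow> ('n \<Rightarrow> quat) \<Rightarrow> 'n qvec" where
  "shift a I q = (\<chi> i. if i \<in> I then a $ i + q i else a $ i)"

end

theory Submission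
  imports Defs "HOL-Complex_Analysis.Cauchy_Integral_Formula"
begin

text \<open>
  The formula is obtained by applying a formula in one quaternionic variable to
  \<open>x\<^sub>1, x\<^sub>2, ...\<close> in turn.  In one variable a slice regular function has the form
  \<open>f(\<alpha> + J \<beta>) = A(\<alpha>, \<beta>) + J B(\<alpha>, \<beta>)\<close>, where \<open>A + i B\<close> is holomorphic with \<open>A\<close> even and \<open>B\<close> odd
  in \<open>\<beta>\<close>, and its spherical derivative is \<open>V = B / \<beta>\<close>.  If \<open>x = a + r \<lambda>\<close>, then
  \<open>r \<lambda>\<^sup>* = x\<^sup>* - a\<^sup>*\<close> (the star denoting conjugation), and therefore
  \<open>f(x) + r \<lambda>\<^sup>* V(x) = A + (\<alpha> - a\<^sup>*) V\<close>: the imaginary unit \<open>J\<close> cancels.  What remains is a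
  combination of two functions of \<open>(\<alpha>, \<beta>)\<close>, namely \<open>V\<close> and \<open>A + (\<alpha> - \<alpha>\<^sub>0) V\<close> with \<open>\<alpha>\<^sub>0 = Re a\<close>, and each
  of them is \<open>Im G / \<beta>\<close> for a holomorphic \<open>G\<close>: take \<open>G = A + i B\<close> and \<open>G = (z - \<alpha>\<^sub>0) (A + i B)\<close>.

  Such functions \<open>v = Im G / \<beta>\<close> have the mean value property on spheres of dimension three
  (\<open>sphere_mean\<close>): regarded as functions on four-space that are symmetric about the real axis, they are
  harmonic.  The proof is a direct computation.  For \<open>\<lambda>\<close>
  uniformly distributed on the sphere, the pair \<open>(s, t) = (Re \<lambda>, \<lambda> \<bullet> J)\<close> is uniformly distributed on the
  unit disc (\<open>distr_quat_sphere_disc\<close>, the analogue of the theorem of Archimedes on the sphere in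
  three-space).  For \<open>a = \<alpha>\<^sub>0 + J b\<close> the point \<open>a + r \<lambda>\<close> satisfies
  \<open>\<beta>\<^sup>2 = b\<^sup>2 + 2 r b t + r\<^sup>2 (1 - s\<^sup>2)\<close>, so that \<open>\<beta> d\<beta> = r b dt\<close> along the lines on which \<open>s\<close> is constant;
  this turns the mean of \<open>v\<close> over the sphere into \<open>1 / b\<close> times the mean of \<open>Im G\<close> over a disc in the
  complex plane, which is \<open>Im G\<close> at its centre.

  In several variables the functions to which the one-variable formula is applied are the continuous
  extensions of the spherical components.  These exist because an odd holomorphic function can be divided by
  the imaginary part of its variable: Cauchy's formula expresses the quotient as an integral with a kernel that is
  smooth across the real axis (\<open>division_by_imaginary_part_local\<close>), and it depends continuously on all variables.
  After the division the function is still holomorphic in each of the other variables, so that the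
  argument can be repeated.  Since the variables are treated in increasing order, the imaginary unit of the
  current variable stands at the left of every ordered product, and the one-variable formula applies
  directly (\<open>slice_of_mean_in_variable\<close>).  Its two terms are the integral that is kept in the sum and the integral that is
  expanded further in the next step.
\<close>

section \<open>Lebesgue measure under linear isometries\<close>

text \<open>
  A linear map that carries one standard basis to another maps boxes to boxes of the same volume.  This is used to
  identify the quaternions with pairs of complex numbers and with real four-space.
\<close>
lemma lborel_distr_basis_iso:
  fixes T :: "'a::euclidean_space \<Rightarrow> 'b::euclidean_space"
  assumes lin: "linear T" and bij: "bij_betw T Basis Basis"
  shows "distr lborel borel T = lborel"
proof (rule lborel_eqI[symmetric])
  have inner_T: "T x \<bullet> T b = x \<bullet> b" if "b \<in> Basis" for x b
  proof -
    have "T x \<bullet> T b = (\<Sum>c\<in>Basis. (x \<bullet> c) * (T c \<bullet> T b))"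
      by (subst euclidean_representation[of x, symmetric])
        (simp add: linear_sum[OF lin] linear_scale[OF lin] inner_sum_left del: euclidean_representation)
    also have "\<dots> = (\<Sum>c\<in>Basis. (if c = b then x \<bullet> c else 0))"
    proof (rule sum.cong[OF refl])
      fix c :: 'a assume c: "c \<in> Basis"
      have "T c \<in> Basis" "T b \<in> Basis" using bij c that by (auto dest: bij_betwE)
      moreover have "T c = T b \<longleftrightarrow> c = b"
        using bij c that by (auto simp: bij_betw_def inj_on_def)
      ultimately show "(x \<bullet> c) * (T c \<bullet> T b) = (if c = b then x \<bullet> c else 0)"
        by (simp add: inner_Basis)
    qed
    also have "\<dots> = x \<bullet> b" using that by simp
    finally show ?thesis .
  qed
  have meas: "T \<in> borel_measurable borel"
    using lin by (intro borel_measurable_continuous_onI linear_continuous_on linear_conv_bounded_linear[THEN iffD1])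
  fix l u :: 'b assume le: "\<And>b. b \<in> Basis \<Longrightarrow> l \<bullet> b \<le> u \<bullet> b"
  \<comment> \<open>the box whose image under \<open>T\<close> is \<open>box l u\<close>\<close>
  define l' u' where "l' = (\<Sum>b\<in>Basis. (l \<bullet> T b) *\<^sub>R b)" and "u' = (\<Sum>b\<in>Basis. (u \<bullet> T b) *\<^sub>R b)"
  have img: "T ` Basis = Basis" using bij by (simp add: bij_betw_def)
  have "T -` box l u = box l' u'"
    unfolding box_def img[symmetric] by (auto simp: inner_T l'_def u'_def)
  then have "emeasure (distr lborel borel T) (box l u) = emeasure lborel (box l' u')"
    using meas by (simp add: emeasure_distr)
  also have "\<dots> = (\<Prod>b\<in>Basis. (u' - l') \<bullet> b)"
    using le img by (subst emeasure_lborel_box) (auto simp: l'_def u'_def)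
  also have "(\<Prod>b\<in>Basis. (u' - l') \<bullet> b) = (\<Prod>b\<in>Basis. (u - l) \<bullet> T b)"
    by (intro prod.cong refl) (simp add: l'_def u'_def inner_diff_left)
  also have "\<dots> = (\<Prod>b\<in>Basis. (u - l) \<bullet> b)"
    by (rule prod.reindex_bij_betw[OF bij])
  finally show "emeasure (distr lborel borel T) (box l u) = (\<Prod>b\<in>Basis. (u - l) \<bullet> b)" .
qed simp

lemma lborel_distr_orthogonal_vec:
  fixes T :: "real^'n::{finite,wellorder} \<Rightarrow> real^'n::_"
  assumes T: "orthogonal_transformation T"
  shows "distr lborel borel T = lborel"
proof (rule lborel_eqI[symmetric])
  fix l u :: "real^'n::_" assume le: "\<And>b. b \<in> Basis \<Longrightarrow> l \<bullet> b \<le> u \<bullet> b"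
  have lin: "linear T" by (rule orthogonal_transformation_linear[OF T])
  have meas: "T \<in> borel_measurable borel"
    using lin by (intro borel_measurable_continuous_onI linear_continuous_on linear_conv_bounded_linear[THEN iffD1])
  have T': "orthogonal_transformation (inv T)"
    by (rule orthogonal_transformation_inv[OF T])
  have vim: "T -` box l u = inv T ` box l u"
    using orthogonal_transformation_bij[OF T] by (simp add: bij_vimage_eq_inv_image)
  have lm: "inv T ` box l u \<in> lmeasurable"
    by (rule measurable_orthogonal_image[OF T']) simp
  have b: "inv T ` box l u \<in> sets borel"
    unfolding vim[symmetric] using measurable_sets[OF meas, of "box l u"] by simp
  have "emeasure (distr lborel borel T) (box l u) = emeasure lborel (inv T ` box l u)"
    using meas by (simp add: emeasure_distr vim)
  also have "\<dots> = emeasure lebesgue (inv T ` box l u)" using b by simp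
  also have "\<dots> = measure lebesgue (inv T ` box l u)"
    using lm by (simp add: emeasure_eq_measure2)
  also have "measure lebesgue (inv T ` box l u) = measure lebesgue (box l u)"
    by (rule measure_orthogonal_image[OF T']) simp
  also have "\<dots> = (\<Prod>b\<in>Basis. (u - l) \<bullet> b)"
    using le by (simp add: measure_lborel_box_eq)
  finally show "emeasure (distr lborel borel T) (box l u) = (\<Prod>b\<in>Basis. (u - l) \<bullet> b)" .
qed simp

lemma basis_isometry_exists:
  assumes "DIM('a::euclidean_space) = DIM('b::euclidean_space)"
  obtains T :: "'a::euclidean_space \<Rightarrow> 'b::euclidean_space" where "linear T" "bij_betw T Basis Basis" "\<And>x. norm (T x) = norm x" "bij T"
proof -
  obtain g where g: "bij_betw g (Basis::'a set) (Basis::'b set)"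
    using assms finite_same_card_bij[of "Basis::'a set" "Basis::'b set"] by auto
  define T where "T x = (\<Sum>b\<in>Basis. (x \<bullet> b) *\<^sub>R g b)" for x
  have lin: "linear T"
    unfolding T_def by (auto intro!: linearI simp: inner_add_left scaleR_add_left sum.distrib scaleR_sum_right)
  have Tg: "T b = g b" if "b \<in> Basis" for b
    using that by (simp add: T_def inner_Basis if_distrib[of "\<lambda>c. c *\<^sub>R _"] sum.delta cong: if_cong)
  have gB: "g b \<in> Basis" if "b \<in> Basis" for b using g that by (auto dest: bij_betwE)
  have inn: "T x \<bullet> g b = x \<bullet> b" if "b \<in> Basis" for x b
  proof -
    have "T x \<bullet> g b = (\<Sum>c\<in>Basis. (if c = b then x \<bullet> c else 0))"
      unfolding T_def inner_sum_left
    proof (intro sum.cong refl)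
      fix c :: 'a assume "c \<in> Basis"
      then show "(x \<bullet> c) *\<^sub>R g c \<bullet> g b = (if c = b then x \<bullet> c else 0)"
        using gB that g by (auto simp: inner_Basis bij_betw_def inj_on_def)
    qed
    then show ?thesis using that by simp
  qed
  have nrm: "norm (T x) = norm x" for x
  proof -
    have "T x \<bullet> T x = (\<Sum>b\<in>Basis. (T x \<bullet> b) * (T x \<bullet> b))" by (rule euclidean_inner)
    also have "\<dots> = (\<Sum>b\<in>Basis. (T x \<bullet> g b) * (T x \<bullet> g b))"
      by (rule sum.reindex_bij_betw[OF g, symmetric])
    also have "\<dots> = x \<bullet> x" by (simp add: inn euclidean_inner[of x x])
    finally show ?thesis by (simp add: norm_eq_sqrt_inner)
  qed
  have "inj T"
  proof (rule injI)
    fix x y assume "T x = T y"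
    then have "norm (T (x - y)) = 0" by (simp add: linear_diff[OF lin])
    then show "x = y" by (simp add: nrm)
  qed
  moreover have "surj T"
  proof (rule surjI)
    fix y
    have "T (\<Sum>b\<in>Basis. (y \<bullet> g b) *\<^sub>R b) = (\<Sum>b\<in>Basis. (y \<bullet> g b) *\<^sub>R g b)"
      by (simp add: linear_sum[OF lin] linear_scale[OF lin] Tg)
    also have "\<dots> = (\<Sum>b\<in>Basis. (y \<bullet> b) *\<^sub>R b)"
      by (rule sum.reindex_bij_betw[OF g])
    finally show "T (\<Sum>b\<in>Basis. (y \<bullet> g b) *\<^sub>R b) = y" by (simp add: euclidean_representation)
  qed
  ultimately have "bij T" by (simp add: bij_def)
  moreover have "bij_betw T Basis Basis" using g Tg by (simp cong: bij_betw_cong)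
  ultimately show ?thesis using that lin nrm by blast
qed

text \<open>
  The case of coordinate vectors is transported along an isometry that carries the standard basis to the
  standard basis, under which Lebesgue measures correspond.
\<close>
lemma lborel_distr_orthogonal:
  fixes T :: "'a::euclidean_space \<Rightarrow> 'a"
  assumes T: "orthogonal_transformation T"
    and dim: "DIM('a) = CARD('n::{finite,wellorder})"
  shows "distr lborel borel T = lborel"
proof -
  have "DIM(real^'n::{finite,wellorder}) = DIM('a)" using dim by simp
  then obtain U :: "real^'n::{finite,wellorder} \<Rightarrow> 'a" where U: "linear U" "bij_betw U Basis Basis" "\<And>x. norm (U x) = norm x" "bij U"
    using basis_isometry_exists by metis
  have UiU: "U (inv U x) = x" for x using U(4) by (simp add: bij_is_surj surj_f_inv_f)
  have iU: "linear (inv U)"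
    by (rule linearI; rule injD[OF bij_is_inj[OF U(4)]])
      (simp_all add: UiU linear_add[OF U(1)] linear_scale[OF U(1)])
  define S where "S x = inv U (T (U x))" for x
  have S: "orthogonal_transformation S"
    unfolding orthogonal_transformation S_def
  proof safe
    show "linear (\<lambda>x. inv U (T (U x)))"
      using linear_compose[OF linear_compose[OF U(1) orthogonal_transformation_linear[OF T]] iU]
      by (simp add: o_def)
    show "norm (inv U (T (U x))) = norm x" for x
      using U(3)[of "inv U (T (U x))"] by (simp add: UiU orthogonal_transformation_norm[OF T] U(3))
  qed
  have meas: "f \<in> borel_measurable borel" if "linear f" for f :: "'x::euclidean_space \<Rightarrow> 'y::euclidean_space"
    using that by (intro borel_measurable_continuous_onI linear_continuous_on linear_conv_bounded_linear[THEN iffD1])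
  have mU: "U \<in> borel_measurable borel" by (rule meas[OF U(1)])
  have mT: "T \<in> borel_measurable borel" by (rule meas[OF orthogonal_transformation_linear[OF T]])
  have mS: "S \<in> borel_measurable borel" by (rule meas[OF orthogonal_transformation_linear[OF S]])
  have "distr lborel borel T = distr (distr lborel borel U) borel T"
    by (simp add: lborel_distr_basis_iso[OF U(1,2)])
  also have "\<dots> = distr lborel borel (T \<circ> U)" using mU mT by (subst distr_distr) auto
  also have "T \<circ> U = U \<circ> S" by (auto simp: S_def UiU)
  also have "distr lborel borel (U \<circ> S) = distr (distr lborel borel S) borel U"
    using mU mS by (subst distr_distr) auto
  also have "\<dots> = lborel"
    by (simp add: lborel_distr_orthogonal_vec[OF S] lborel_distr_basis_iso[OF U(1,2)])
  finally show ?thesis .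
qed

section \<open>The projection of the unit sphere of the quaternions to a plane\<close>

text \<open>
  The disc of radius \<open>sqrt a\<close> has area \<open>pi * a\<close>, so that the squared norm of a point of the plane is
  distributed with constant density.
\<close>
lemma distr_norm_squared_complex:
  "distr lborel borel (\<lambda>v::complex. (norm v)\<^sup>2) = density lborel (\<lambda>\<rho>. ennreal pi * indicator {0..} \<rho>)"
  (is "?M = ?N")
proof (rule measure_eqI_generator_eq[where E = "range (\<lambda>a::real. {..a})" and \<Omega> = UNIV and A = "\<lambda>i. {..real i}"])
  have vim: "(\<lambda>v::complex. (norm v)\<^sup>2) -` {..a} = (if a < 0 then {} else cball 0 (sqrt a))" for a
  proof (cases "a < 0")
    case True
    then have "\<not> (norm v)\<^sup>2 \<le> a" for v :: complex
      using zero_le_power2[of "norm v"] by linarith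
    then show ?thesis using True by auto
  next
    case False
    then show ?thesis by (auto simp: norm_le_square power2_norm_eq_inner)
  qed
  have M: "emeasure ?M {..a} = ennreal (pi * max 0 a)" for a
    by (simp add: emeasure_distr vim emeasure_cball unit_ball_vol_2 max_def)
  have N: "emeasure ?N {..a} = ennreal (pi * max 0 a)" for a
  proof -
    have "emeasure ?N {..a} = (\<integral>\<^sup>+x. ennreal pi * indicator {0..a} x \<partial>lborel)"
      by (subst emeasure_density) (auto intro!: nn_integral_cong simp: indicator_def)
    also have "\<dots> = ennreal (pi * max 0 a)"
      by (cases "0 \<le> a") (auto simp: nn_integral_cmult ennreal_mult max_def)
    finally show ?thesis .
  qed
  show "emeasure ?M X = emeasure ?N X" if "X \<in> range (\<lambda>a::real. {..a})" for X
    using that M N by auto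
  show "emeasure ?M {..real i} \<noteq> \<infinity>" for i by (simp add: M)
  show "Int_stable (range (\<lambda>a::real. {..a}))"
    by (auto simp: Int_stable_def)
  show "(\<Union>i. {..real i}) = UNIV" by (auto simp: real_arch_simple)
  show "sets ?M = sigma_sets UNIV (range atMost)" "sets ?N = sigma_sets UNIV (range atMost)"
    by (simp_all add: borel_eq_atMost)
qed auto

lemma nn_integral_complex_scale:
  fixes f :: "complex \<Rightarrow> ennreal"
  assumes [measurable]: "f \<in> borel_measurable borel" and c: "0 < c"
  shows "(\<integral>\<^sup>+u. f (u /\<^sub>R c) \<partial>lborel) = ennreal (c\<^sup>2) * (\<integral>\<^sup>+w. f w \<partial>lborel)"
proof -
  have "(\<integral>\<^sup>+u. f (u /\<^sub>R c) \<partial>lborel) = (\<integral>\<^sup>+u. f (u /\<^sub>R c) \<partial>density (distr lborel borel (\<lambda>x. 0 + c *\<^sub>R x)) (\<lambda>_. \<bar>c\<bar>^DIM(complex)))"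
    using c by (subst lborel_affine[of c 0]) auto
  also have "\<dots> = ennreal (c\<^sup>2) * (\<integral>\<^sup>+w. f w \<partial>lborel)"
    using c by (simp add: nn_integral_density nn_integral_distr nn_integral_cmult)
  finally show ?thesis .
qed

lemma norm_Quat_pair: "norm (Quat a b c d) = sqrt ((norm (Complex a b))\<^sup>2 + (norm (Complex c d))\<^sup>2)"
  by (simp add: norm_quat_def cmod_power2)

text \<open>
  Write a quaternion as a pair \<open>(u, v)\<close> of complex numbers.  Only the norm of \<open>v\<close> enters the integrand, and
  \<open>\<bar>v\<bar>\<^sup>2\<close> has constant density, so that \<open>\<tau> = \<bar>u\<bar>\<^sup>2 + \<bar>v\<bar>\<^sup>2\<close> can serve as the second variable.  For fixed \<open>\<tau>\<close> the
  integrand depends on \<open>u / sqrt \<tau>\<close>, which runs over the unit disc; the scaling produces a factor that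
  does not depend on \<open>\<phi>\<close>.  The value of that factor follows later from the total mass.
\<close>
lemma nn_integral_ball_radial_projection:
  "\<exists>C. \<forall>\<phi> \<in> borel_measurable borel.
     (\<integral>\<^sup>+x. \<phi> (Complex (Qre x) (Qi x) /\<^sub>R norm x) * indicator (ball 0 1) x \<partial>lborel) =
       C * (\<integral>\<^sup>+w. \<phi> w * indicator (cball (0::complex) 1) w \<partial>lborel)"
proof (intro exI ballI)
  fix \<phi> :: "complex \<Rightarrow> ennreal" assume [measurable]: "\<phi> \<in> borel_measurable borel"
  define \<iota> where "\<iota> = (\<lambda>(u, v). Quat (Re u) (Im u) (Re v) (Im v))"
  let ?\<Phi> = "\<integral>\<^sup>+w. \<phi> w * indicator (cball (0::complex) 1) w \<partial>lborel"
  have m\<phi>: "(\<lambda>w. \<phi> w * indicator (cball 0 1) w) \<in> borel_measurable lborel"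
    by (auto intro!: borel_measurable_times_ennreal borel_measurable_indicator)
  have lin: "linear \<iota>"
    by (rule linearI) (auto simp: \<iota>_def quat_eq_iff)
  have "bij_betw \<iota> Basis Basis"
    by (rule bij_betw_imageI)
      (auto simp: \<iota>_def Basis_prod_def Basis_complex_def Basis_quat_def inj_on_def complex_eq_iff)
  note d = lborel_distr_basis_iso[OF lin this]
  have m\<iota> [measurable]: "\<iota> \<in> borel_measurable borel"
    using lin by (intro borel_measurable_continuous_onI linear_continuous_on linear_conv_bounded_linear[THEN iffD1])
  have [measurable]: "(\<lambda>x. Complex (Qre x) (Qi x)) \<in> borel_measurable borel"
    by (intro borel_measurable_continuous_onI linear_continuous_on linear_conv_bounded_linear[THEN iffD1] linearI)
       (auto simp: complex_eq_iff)
  have "(\<integral>\<^sup>+x. \<phi> (Complex (Qre x) (Qi x) /\<^sub>R norm x) * indicator (ball 0 1) x \<partial>lborel) =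
    (\<integral>\<^sup>+z. \<phi> (fst z /\<^sub>R norm (\<iota> z)) * indicator (ball 0 1) (\<iota> z) \<partial>lborel)"
    by (subst d[symmetric], subst nn_integral_distr) (measurable, auto simp: \<iota>_def case_prod_beta)
  also have "\<dots> = (\<integral>\<^sup>+z. (\<lambda>(u, v::complex). \<phi> (u /\<^sub>R sqrt ((norm u)\<^sup>2 + (norm v)\<^sup>2)) * indicator {..<1} ((norm u)\<^sup>2 + (norm v)\<^sup>2)) z \<partial>(lborel \<Otimes>\<^sub>M lborel))"
    unfolding lborel_prod
    by (intro nn_integral_cong) (auto simp: \<iota>_def norm_Quat_pair indicator_def case_prod_beta)
  also have "\<dots> = (\<integral>\<^sup>+u. (\<integral>\<^sup>+v. \<phi> (u /\<^sub>R sqrt ((norm u)\<^sup>2 + (norm v)\<^sup>2)) * indicator {..<1} ((norm u)\<^sup>2 + (norm v)\<^sup>2) \<partial>(lborel::complex measure)) \<partial>lborel)"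
    by (subst lborel.nn_integral_fst[symmetric]) simp_all
  also have "\<dots> = (\<integral>\<^sup>+u. (\<integral>\<^sup>+\<tau>. ennreal pi * (\<phi> (u /\<^sub>R sqrt \<tau>) * indicator {(norm u)\<^sup>2..<1} \<tau>) \<partial>lborel) \<partial>lborel)"
  proof (intro nn_integral_cong)
    fix u :: complex
    have "(\<integral>\<^sup>+v. \<phi> (u /\<^sub>R sqrt ((norm u)\<^sup>2 + (norm v)\<^sup>2)) * indicator {..<1} ((norm u)\<^sup>2 + (norm v)\<^sup>2) \<partial>(lborel::complex measure))
       = (\<integral>\<^sup>+\<rho>. \<phi> (u /\<^sub>R sqrt ((norm u)\<^sup>2 + \<rho>)) * indicator {..<1} ((norm u)\<^sup>2 + \<rho>) \<partial>distr lborel borel (\<lambda>v::complex. (norm v)\<^sup>2))"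
      by (subst nn_integral_distr) auto
    also have "\<dots> = (\<integral>\<^sup>+\<rho>. (ennreal pi * indicator {0..} \<rho>) * (\<phi> (u /\<^sub>R sqrt ((norm u)\<^sup>2 + \<rho>)) * indicator {..<1} ((norm u)\<^sup>2 + \<rho>)) \<partial>lborel)"
      unfolding distr_norm_squared_complex by (subst nn_integral_density) auto
    also have "\<dots> = (\<integral>\<^sup>+\<rho>. ennreal pi * (\<phi> (u /\<^sub>R sqrt ((norm u)\<^sup>2 + 1 * \<rho>)) * indicator {(norm u)\<^sup>2..<1} ((norm u)\<^sup>2 + 1 * \<rho>)) \<partial>lborel)"
      by (intro nn_integral_cong) (auto simp: indicator_def)
    also have "\<dots> = (\<integral>\<^sup>+\<tau>. ennreal pi * (\<phi> (u /\<^sub>R sqrt \<tau>) * indicator {(norm u)\<^sup>2..<1} \<tau>) \<partial>lborel)"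
      by (subst nn_integral_real_affine[where c = 1 and t = "(norm u)\<^sup>2"]) auto
    finally show "(\<integral>\<^sup>+v. \<phi> (u /\<^sub>R sqrt ((norm u)\<^sup>2 + (norm v)\<^sup>2)) * indicator {..<1} ((norm u)\<^sup>2 + (norm v)\<^sup>2) \<partial>(lborel::complex measure))
       = (\<integral>\<^sup>+\<tau>. ennreal pi * (\<phi> (u /\<^sub>R sqrt \<tau>) * indicator {(norm u)\<^sup>2..<1} \<tau>) \<partial>lborel)" .
  qed
  also have "\<dots> = (\<integral>\<^sup>+\<tau>. (\<integral>\<^sup>+u. ennreal pi * (\<phi> (u /\<^sub>R sqrt \<tau>) * indicator {(norm u)\<^sup>2..<1} \<tau>) \<partial>lborel) \<partial>lborel)"
  proof (rule lborel_pair.Fubini')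
    have "closed {z::real \<times> complex. (norm (snd z))\<^sup>2 \<le> fst z}"
      by (intro closed_Collect_le continuous_intros)
    moreover have "open {z::real \<times> complex. fst z < 1}"
      by (intro open_Collect_less continuous_intros)
    ultimately have S: "{z::real \<times> complex. (norm (snd z))\<^sup>2 \<le> fst z} \<inter> {z. fst z < 1} \<in> sets borel" (is "?S \<in> _")
      by (intro sets.Int) (auto intro: borel_closed borel_open)
    have [measurable]: "fst \<in> borel_measurable (borel :: (real \<times> complex) measure)"
      "snd \<in> borel_measurable (borel :: (real \<times> complex) measure)"
      by (auto intro!: borel_measurable_continuous_onI continuous_intros)
    have "(\<lambda>z. ennreal pi * (\<phi> (snd z /\<^sub>R sqrt (fst z)) * indicator ?S z)) \<in> borel_measurable borel"
      using S by measurable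
    also have "(\<lambda>z. ennreal pi * (\<phi> (snd z /\<^sub>R sqrt (fst z)) * indicator ?S z)) =
      (\<lambda>(\<tau>, u). ennreal pi * (\<phi> (u /\<^sub>R sqrt \<tau>) * indicator {(norm u)\<^sup>2..<1} \<tau>))"
      by (auto simp: fun_eq_iff indicator_def)
    finally show "(\<lambda>(\<tau>, u::complex). ennreal pi * (\<phi> (u /\<^sub>R sqrt \<tau>) * indicator {(norm u)\<^sup>2..<1} \<tau>)) \<in> borel_measurable (lborel \<Otimes>\<^sub>M lborel)"
      unfolding lborel_prod by simp
  qed
  also have "\<dots> = (\<integral>\<^sup>+\<tau>. (ennreal pi * (ennreal \<tau> * indicator {0<..<1} \<tau>)) * ?\<Phi> \<partial>lborel)"
  proof (rule nn_integral_cong_AE)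
    have "AE \<tau> in lborel. \<tau> \<noteq> (0::real)" by (rule AE_lborel_singleton)
    then show "AE \<tau> in lborel. (\<integral>\<^sup>+u. ennreal pi * (\<phi> (u /\<^sub>R sqrt \<tau>) * indicator {(norm u)\<^sup>2..<1} \<tau>) \<partial>lborel) =
      (ennreal pi * (ennreal \<tau> * indicator {0<..<1} \<tau>)) * ?\<Phi>"
    proof eventually_elim
      case (elim \<tau>)
      show ?case
      proof (cases "0 < \<tau> \<and> \<tau> < 1")
        case True
        have "(\<integral>\<^sup>+u. ennreal pi * (\<phi> (u /\<^sub>R sqrt \<tau>) * indicator {(norm u)\<^sup>2..<1} \<tau>) \<partial>lborel)
          = (\<integral>\<^sup>+u. ennreal pi * (\<phi> (u /\<^sub>R sqrt \<tau>) * indicator (cball 0 1) (u /\<^sub>R sqrt \<tau>)) \<partial>lborel)"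
        proof (intro nn_integral_cong)
          fix u :: complex
          have "norm (u /\<^sub>R sqrt \<tau>) \<le> 1 \<longleftrightarrow> (norm u)\<^sup>2 \<le> \<tau>"
            using True real_sqrt_le_iff[of "(norm u)\<^sup>2" \<tau>] by (simp add: divide_simps)
          then show "ennreal pi * (\<phi> (u /\<^sub>R sqrt \<tau>) * indicator {(norm u)\<^sup>2..<1} \<tau>) =
            ennreal pi * (\<phi> (u /\<^sub>R sqrt \<tau>) * indicator (cball 0 1) (u /\<^sub>R sqrt \<tau>))"
            using True by (auto simp: indicator_def)
        qed
        also have "\<dots> = ennreal ((sqrt \<tau>)\<^sup>2) * (\<integral>\<^sup>+w. ennreal pi * (\<phi> w * indicator (cball 0 1) w) \<partial>lborel)"
          by (rule nn_integral_complex_scale[where f = "\<lambda>w. ennreal pi * (\<phi> w * indicator (cball 0 1) w)"])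
            (use True in \<open>auto intro!: borel_measurable_times_ennreal borel_measurable_indicator\<close>)
        also have "\<dots> = (ennreal pi * (ennreal \<tau> * indicator {0<..<1} \<tau>)) * ?\<Phi>"
          using True by (simp add: nn_integral_cmult[OF m\<phi>] ac_simps)
        finally show ?thesis .
      next
        case False
        then have "\<tau> < 0 \<or> 1 \<le> \<tau>" using elim by auto
        then have "indicator {(norm u)\<^sup>2..<1} \<tau> = (0::ennreal)" for u :: complex
          by (auto simp: indicator_def dest: order_less_le_trans[OF _ zero_le_power2] order_trans[OF zero_le_power2])
        moreover have "indicator {0<..<1} \<tau> = (0::ennreal)" using False by auto
        ultimately show ?thesis by (simp only: mult_zero_right mult_zero_left nn_integral_const)
      qed
    qed
  qed
  also have "\<dots> = (\<integral>\<^sup>+\<tau>. ennreal pi * (ennreal \<tau> * indicator {0<..<1} \<tau>) \<partial>lborel) * ?\<Phi>"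
    by (rule nn_integral_multc) auto
  finally show "(\<integral>\<^sup>+x. \<phi> (Complex (Qre x) (Qi x) /\<^sub>R norm x) * indicator (ball 0 1) x \<partial>lborel) =
     (\<integral>\<^sup>+\<tau>. ennreal pi * (ennreal \<tau> * indicator {0<..<1} \<tau>) \<partial>lborel) * ?\<Phi>" .
qed


lemma borel_measurable_sphere_projection [measurable]:
  "(\<lambda>x::quat. if x = 0 then 1 else sgn x) \<in> measurable (uniform_measure lborel (ball 0 1)) (restrict_space borel (sphere 0 1))"
proof -
  have "(\<lambda>x::quat. if x = 0 then 1 else sgn x) \<in> borel_measurable borel"
    unfolding sgn_div_norm by measurable
  then show ?thesis
    by (intro measurable_restrict_space2) (auto simp: norm_sgn)
qed

lemma measurable_quat_sphere: "f \<in> borel_measurable borel \<Longrightarrow> f \<in> borel_measurable quat_sphere"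
  unfolding measurable_cong_sets[OF sets_quat_sphere refl] by (rule measurable_restrict_space1)

lemma nn_integral_quat_sphere:
  fixes \<phi> :: "quat \<Rightarrow> ennreal"
  assumes [measurable]: "\<phi> \<in> borel_measurable borel"
  shows "(\<integral>\<^sup>+l. \<phi> l \<partial>quat_sphere) =
    (\<integral>\<^sup>+x. \<phi> (x /\<^sub>R norm x) * indicator (ball 0 1) x \<partial>lborel) / emeasure lborel (ball (0::quat) 1)"
proof -
  have "(\<integral>\<^sup>+l. \<phi> l \<partial>quat_sphere) = (\<integral>\<^sup>+x. \<phi> (if x = 0 then 1 else sgn x) \<partial>uniform_measure lborel (ball 0 1))"
    unfolding quat_sphere_def
    by (subst nn_integral_distr) (auto intro!: measurable_restrict_space1)
  also have "\<dots> = (\<integral>\<^sup>+x. \<phi> (if x = 0 then 1 else sgn x) * indicator (ball 0 1) x \<partial>lborel) / emeasure lborel (ball (0::quat) 1)"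
    unfolding sgn_div_norm by (subst nn_integral_uniform_measure) auto
  also have "(\<integral>\<^sup>+x. \<phi> (if x = 0 then 1 else sgn x) * indicator (ball 0 1) x \<partial>lborel) =
    (\<integral>\<^sup>+x. \<phi> (x /\<^sub>R norm x) * indicator (ball 0 1) x \<partial>lborel)"
  proof (rule nn_integral_cong_AE)
    have "AE x in lborel. x \<noteq> (0::quat)" by (rule AE_lborel_singleton)
    then show "AE x in lborel. \<phi> (if x = 0 then 1 else sgn x) * indicator (ball 0 1) x = \<phi> (x /\<^sub>R norm x) * indicator (ball 0 1) x"
      by eventually_elim (simp add: sgn_div_norm)
  qed
  finally show ?thesis .
qed

lemma nn_integral_quat_sphere_orthogonal:
  fixes \<phi> :: "quat \<Rightarrow> ennreal"
  assumes [measurable]: "\<phi> \<in> borel_measurable borel" and T: "orthogonal_transformation T"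
  shows "(\<integral>\<^sup>+l. \<phi> (T l) \<partial>quat_sphere) = (\<integral>\<^sup>+l. \<phi> l \<partial>quat_sphere)"
proof -
  have lin: "linear T" by (rule orthogonal_transformation_linear[OF T])
  have [measurable]: "T \<in> borel_measurable borel"
    using lin by (intro borel_measurable_continuous_onI linear_continuous_on linear_conv_bounded_linear[THEN iffD1])
  have "(\<lambda>x::quat. x /\<^sub>R norm x) \<in> borel_measurable borel" by measurable
  from measurable_compose[OF this assms(1)]
  have [measurable]: "(\<lambda>x. \<phi> (x /\<^sub>R norm x) * indicator (ball 0 1) x) \<in> borel_measurable borel"
    by (intro borel_measurable_times_ennreal borel_measurable_indicator) auto
  have "(\<integral>\<^sup>+x. \<phi> (x /\<^sub>R norm x) * indicator (ball 0 1) x \<partial>lborel) =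
     (\<integral>\<^sup>+x. \<phi> (T x /\<^sub>R norm (T x)) * indicator (ball 0 1) (T x) \<partial>lborel)"
    by (subst lborel_distr_orthogonal[OF T, where 'n = 4, symmetric]; (subst nn_integral_distr)?) simp_all
  also have "\<dots> = (\<integral>\<^sup>+x. \<phi> (T (x /\<^sub>R norm x)) * indicator (ball 0 1) x \<partial>lborel)"
    by (simp add: orthogonal_transformation_norm[OF T] linear_scale[OF lin] indicator_def)
  finally show ?thesis
    by (simp add: nn_integral_quat_sphere)
qed

lemma norm_imag_unit: "J \<in> imag_units \<Longrightarrow> norm J = 1" and Re_imag_unit: "J \<in> imag_units \<Longrightarrow> Qre J = 0"
proof -
  assume "J \<in> imag_units"
  then have *: "Qre J * Qre J - Qi J * Qi J - Qj J * Qj J - Qk J * Qk J = -1"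
     "Qre J * Qi J = 0" "Qre J * Qj J = 0" "Qre J * Qk J = 0"
    by (auto simp: imag_units_def power2_eq_square quat_eq_iff)
  show "Qre J = 0"
  proof (rule ccontr)
    assume "Qre J \<noteq> 0"
    then have "Qre J * Qre J = -1" using * by simp
    then show False by (metis zero_le_square not_one_le_zero neg_0_le_iff_le)
  qed
  then show "norm J = 1" using *(1) by (simp add: norm_quat_def power2_eq_square)
qed

text \<open>
  For \<open>J = i\<close> this follows from \<open>nn_integral_ball_radial_projection\<close>; the unknown constant is determined
  because both sides have total mass 1.  The general case is reduced to this one by the reflection that
  exchanges \<open>i\<close> and \<open>J\<close>, which fixes the real axis.
\<close>
lemma distr_quat_sphere_disc:
  assumes J: "J \<in> imag_units"
  shows "distr quat_sphere borel (\<lambda>l. Complex (Qre l) (l \<bullet> J)) = uniform_measure lborel (cball 0 1)"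
proof -
  define i where "i = Quat 0 1 0 0"
  define n where "n = i - J"
  \<comment> \<open>the reflection in the hyperplane orthogonal to \<open>i - J\<close>; if \<open>i = J\<close> the quotient is 0 and \<open>T\<close> is the identity\<close>
  define T where "T x = x - (2 * (x \<bullet> n) / (n \<bullet> n)) *\<^sub>R n" for x
  note J1 = norm_imag_unit[OF J] Re_imag_unit[OF J]
  have T: "orthogonal_transformation T"
    unfolding orthogonal_transformation
  proof safe
    show "linear T"
      by (rule linearI) (simp_all add: T_def inner_add_left algebra_simps add_divide_distrib)
    show "norm (T x) = norm x" for x
    proof (cases "n = 0")
      case False
      then have "T x \<bullet> T x = x \<bullet> x"
        by (simp add: T_def inner_diff_left inner_diff_right inner_commute field_simps)
      then show ?thesis by (simp add: norm_eq_sqrt_inner)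
    qed (simp add: T_def)
  qed
  have T1: "Qre (T x) = Qre x" for x using J1 by (simp add: T_def n_def i_def)
  have Ti: "Qi (T x) = x \<bullet> J" for x
  proof (cases "n = 0")
    case True
    then have "J = i" by (simp add: n_def)
    then show ?thesis by (simp add: T_def True i_def inner_quat_def)
  next
    case False
    have ii: "i \<bullet> i = 1" "J \<bullet> J = 1" using J1 by (simp_all add: i_def norm_eq_1) (simp add: inner_quat_def)
    have nn: "n \<bullet> n = 2 * (n \<bullet> i)"
      by (simp add: n_def inner_diff_left inner_diff_right ii inner_commute)
    have "Qi (T x) = T x \<bullet> i" by (simp add: i_def inner_quat_def)
    also have "\<dots> = x \<bullet> i - x \<bullet> n * (2 * (n \<bullet> i) / (n \<bullet> n))"
      by (simp add: T_def inner_diff_left)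
    also have "2 * (n \<bullet> i) / (n \<bullet> n) = 1" using False nn by (metis divide_self_if inner_eq_zero_iff)
    finally show ?thesis by (simp add: n_def inner_diff_right)
  qed
  have [measurable]: "(\<lambda>l. Complex (Qre l) (l \<bullet> K)) \<in> borel_measurable borel" for K
    by (intro borel_measurable_continuous_onI linear_continuous_on linear_conv_bounded_linear[THEN iffD1] linearI)
       (auto simp: complex_eq_iff inner_add_left)
  have [measurable]: "(\<lambda>l. Complex (Qre l) (Qi l)) \<in> borel_measurable borel"
    by (intro borel_measurable_continuous_onI linear_continuous_on linear_conv_bounded_linear[THEN iffD1] linearI)
       (auto simp: complex_eq_iff)
  obtain C0 where C0: "\<And>\<phi>. \<phi> \<in> borel_measurable borel \<Longrightarrow>
     (\<integral>\<^sup>+x. \<phi> (Complex (Qre x) (Qi x) /\<^sub>R norm x) * indicator (ball 0 1) x \<partial>lborel) =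
       C0 * (\<integral>\<^sup>+w. \<phi> w * indicator (cball (0::complex) 1) w \<partial>lborel)"
    using nn_integral_ball_radial_projection by auto
  define C where "C = C0 / emeasure lborel (ball (0::quat) 1)"
  have main: "(\<integral>\<^sup>+l. \<phi> (Complex (Qre l) (l \<bullet> J)) \<partial>quat_sphere) = C * (\<integral>\<^sup>+w. \<phi> w * indicator (cball (0::complex) 1) w \<partial>lborel)"
    if [measurable]: "\<phi> \<in> borel_measurable borel" for \<phi>
  proof -
    have "(\<integral>\<^sup>+l. \<phi> (Complex (Qre l) (l \<bullet> J)) \<partial>quat_sphere) = (\<integral>\<^sup>+l. \<phi> (Complex (Qre (T l)) (Qi (T l))) \<partial>quat_sphere)"
      by (simp add: T1 Ti)
    also have "\<dots> = (\<integral>\<^sup>+l. \<phi> (Complex (Qre l) (Qi l)) \<partial>quat_sphere)"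
      by (rule nn_integral_quat_sphere_orthogonal[OF _ T, where \<phi> = "\<lambda>l. \<phi> (Complex (Qre l) (Qi l))"]) simp
    also have "\<dots> = (\<integral>\<^sup>+x. \<phi> (Complex (Qre x) (Qi x) /\<^sub>R norm x) * indicator (ball 0 1) x \<partial>lborel) / emeasure lborel (ball (0::quat) 1)"
      by (subst nn_integral_quat_sphere) (auto intro!: arg_cong2[where f = "(/)"] nn_integral_cong arg_cong2[where f = "(*)"] arg_cong[where f = \<phi>] simp: complex_eq_iff)
    finally show ?thesis unfolding C0[OF that] by (simp add: C_def divide_ennreal_def ac_simps)
  qed
  have fin: "emeasure lborel (cball (0::complex) 1) \<noteq> 0" "emeasure lborel (cball (0::complex) 1) \<noteq> \<infinity>"
    by (simp_all add: emeasure_cball unit_ball_vol_2)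
  have "1 = C * emeasure lborel (cball (0::complex) 1)"
    using main[of "\<lambda>_. 1"] emeasure_space_quat_sphere by simp
  then have C: "C = 1 / emeasure lborel (cball (0::complex) 1)"
    using fin by (metis ennreal_divide_times ennreal_divide_self mult.commute mult.right_neutral ennreal_times_divide top.not_eq_extremum infinity_ennreal_def)
  show ?thesis
  proof (rule measure_eqI)
    fix A assume "A \<in> sets (distr quat_sphere borel (\<lambda>l. Complex (Qre l) (l \<bullet> J)))"
    then have [measurable]: "A \<in> sets borel" by simp
    have "emeasure (distr quat_sphere borel (\<lambda>l. Complex (Qre l) (l \<bullet> J))) A = (\<integral>\<^sup>+w. indicator A w \<partial>distr quat_sphere borel (\<lambda>l. Complex (Qre l) (l \<bullet> J)))"
      by simp
    also have "\<dots> = (\<integral>\<^sup>+l. indicator A (Complex (Qre l) (l \<bullet> J)) \<partial>quat_sphere)"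
      by (subst nn_integral_distr) (auto intro: measurable_quat_sphere)
    also have "\<dots> = C * (\<integral>\<^sup>+w. indicator (cball (0::complex) 1 \<inter> A) w \<partial>lborel)"
      by (subst main) (simp, rule arg_cong[where f = "(*) C"], rule nn_integral_cong, simp only: indicator_inter_arith mult.commute)
    also have "\<dots> = emeasure (uniform_measure lborel (cball 0 1)) A"
      by (simp add: C ennreal_times_divide ennreal_divide_times emeasure_uniform_measure)
    finally show "emeasure (distr quat_sphere borel (\<lambda>l. Complex (Qre l) (l \<bullet> J))) A = emeasure (uniform_measure lborel (cball 0 1)) A" .
  qed simp
qed

section \<open>Means over the unit disc\<close>

definition disc_measure :: "complex measure" where
  "disc_measure = uniform_measure lborel (cball 0 1)"

lemma sets_disc_measure [simp, measurable_cong]: "sets disc_measure = sets borel"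
  by (simp add: disc_measure_def)

lemma emeasure_disc_measure_UNIV: "emeasure disc_measure UNIV = 1"
  by (simp add: disc_measure_def emeasure_uniform_measure emeasure_cball unit_ball_vol_2)

lemma space_disc_measure [simp]: "space disc_measure = UNIV"
  by (simp add: disc_measure_def)

lemma finite_measure_disc_measure: "finite_measure disc_measure"
  by (rule finite_measureI) (simp add: emeasure_disc_measure_UNIV)

lemma measure_disc_measure_UNIV [simp]: "measure disc_measure UNIV = 1"
  by (simp add: measure_def emeasure_disc_measure_UNIV)

lemma AE_disc_measure: "AE w in disc_measure. w \<in> cball 0 1"
  unfolding disc_measure_def by (rule AE_uniform_measureI) auto

lemma integral_disc_measure:
  fixes f :: "complex \<Rightarrow> 'a::{banach, second_countable_topology}"
  assumes "f \<in> borel_measurable borel"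
  shows "(\<integral>w. f w \<partial>disc_measure) = (1 / pi) *\<^sub>R (\<integral>w. indicator (cball 0 1) w *\<^sub>R f w \<partial>lborel)"
proof -
  have dm: "disc_measure = density lborel (\<lambda>w. ennreal (indicator (cball 0 1) w / pi))"
    unfolding disc_measure_def uniform_measure_def
    by (intro density_cong AE_I2) (auto simp: emeasure_cball unit_ball_vol_2 indicator_def divide_ennreal[of 1 pi, simplified])
  have "(\<integral>w. f w \<partial>disc_measure) = (\<integral>w. (indicator (cball 0 1) w / pi) *\<^sub>R f w \<partial>lborel)"
    unfolding dm using assms
    by (subst integral_density) (auto intro!: borel_measurable_divide borel_measurable_indicator)
  also have "(\<lambda>w. (indicator (cball 0 1) w / pi) *\<^sub>R f w) = (\<lambda>w. (1 / pi) *\<^sub>R (indicator (cball 0 1) w *\<^sub>R f w))"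
    by (simp add: fun_eq_iff)
  also have "(\<integral>w. (1 / pi) *\<^sub>R (indicator (cball 0 1) w *\<^sub>R f w) \<partial>lborel) = (1 / pi) *\<^sub>R (\<integral>w. indicator (cball 0 1) w *\<^sub>R f w \<partial>lborel)"
    by (rule Bochner_Integration.integral_scaleR_right)
  finally show ?thesis .
qed

lemma distr_disc_measure_rotation:
  assumes c: "norm c = 1"
  shows "distr disc_measure borel ((*) c) = disc_measure"
proof (rule measure_eqI)
  have [measurable]: "(*) c \<in> borel_measurable borel" by simp
  have T: "orthogonal_transformation ((*) c)"
    unfolding orthogonal_transformation using c
    by (auto simp: norm_mult intro!: linearI simp: algebra_simps)
  fix A assume "A \<in> sets (distr disc_measure borel ((*) c))"
  then have A [measurable]: "A \<in> sets borel" by simp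
  have "emeasure lborel (cball 0 1 \<inter> A) = emeasure (distr lborel borel ((*) c)) (cball 0 1 \<inter> A)"
    by (simp add: lborel_distr_orthogonal[OF T, where 'n = 2])
  also have "\<dots> = emeasure lborel ((*) c -` (cball 0 1 \<inter> A))"
    by (subst emeasure_distr) auto
  also have "(*) c -` (cball 0 1 \<inter> A) = cball 0 1 \<inter> ((*) c -` A)"
    using c by (auto simp: norm_mult)
  finally have "emeasure lborel (cball 0 1 \<inter> A) = emeasure lborel (cball 0 1 \<inter> (*) c -` A)" .
  moreover have "(*) c -` A \<in> sets borel"
    using measurable_sets[of "(*) c" borel borel A] by simp
  ultimately show "emeasure (distr disc_measure borel ((*) c)) A = emeasure disc_measure A"
    by (subst emeasure_distr) (simp_all add: disc_measure_def emeasure_uniform_measure)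
qed simp

lemma integrable_disc_measure_power: "integrable disc_measure (\<lambda>w. w ^ n)"
proof -
  interpret finite_measure disc_measure by (rule finite_measure_disc_measure)
  show ?thesis
    by (rule integrable_const_bound[where B = 1])
      (use AE_disc_measure in \<open>auto simp: norm_power power_le_one elim!: eventually_mono\<close>)
qed

text \<open>
  The rotation by an angle of \<open>pi / n\<close> preserves the measure and multiplies the integrand by \<open>-1\<close>.
\<close>
lemma integral_disc_measure_power:
  assumes "0 < n"
  shows "(\<integral>w. w ^ n \<partial>disc_measure) = 0"
proof -
  define c where "c = cis (pi / n)"
  have "c ^ n = cis (real n * (pi / n))" unfolding c_def by (rule Complex.DeMoivre)
  then have c: "norm c = 1" "c ^ n = -1"
    using assms by (simp_all add: c_def)
  have "(\<integral>w. w ^ n \<partial>disc_measure) = (\<integral>w. w ^ n \<partial>distr disc_measure borel ((*) c))"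
    by (simp add: distr_disc_measure_rotation[OF c(1)])
  also have "\<dots> = (\<integral>w. (c * w) ^ n \<partial>disc_measure)"
    by (subst integral_distr) auto
  also have "\<dots> = - (\<integral>w. w ^ n \<partial>disc_measure)"
    by (simp add: power_mult_distrib c)
  finally show ?thesis by (simp add: complex_eq_iff)
qed

text \<open>
  In the power series expansion about the centre every term except the constant one has mean 0.  The function
  \<open>g'\<close> is a Borel measurable version of \<open>g\<close>, which is controlled only on the ball.
\<close>
lemma holomorphic_disc_mean:
  assumes holo: "g holomorphic_on ball 0 R" and R: "1 < R" and [measurable]: "g' \<in> borel_measurable borel"
    and g': "\<And>w. w \<in> cball 0 1 \<Longrightarrow> g' w = g w"
  shows "(\<integral>w. g' w \<partial>disc_measure) = g 0"
proof -
  interpret finite_measure disc_measure by (rule finite_measure_disc_measure)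
  define a where "a n = (deriv ^^ n) g 0 / fact n" for n
  have sums: "(\<lambda>n. a n * w ^ n) sums g w" if "w \<in> ball 0 R" for w
    using holomorphic_power_series[OF holo that] by (simp add: a_def)
  obtain s where s: "1 < s" "s < R" using R dense by blast
  have "summable (\<lambda>n. a n * of_real s ^ n)"
    using sums[of "of_real s"] s by (auto simp: sums_iff)
  from powser_insidea[OF this, of 1] s
  have abs: "summable (\<lambda>n. norm (a n))" by simp
  have "(\<lambda>n. \<integral>w. a n * w ^ n \<partial>disc_measure) sums (\<integral>w. (\<Sum>n. a n * w ^ n) \<partial>disc_measure)"
  proof (rule sums_integral)
    show "integrable disc_measure (\<lambda>w. a n * w ^ n)" for n
      by (intro integrable_mult_right integrable_disc_measure_power)
    have le: "norm (a n * w ^ n) \<le> norm (a n)" if "w \<in> cball 0 1" for w n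
      using that by (simp add: norm_mult norm_power mult_left_le power_le_one)
    show "AE w in disc_measure. summable (\<lambda>n. norm (a n * w ^ n))"
      using AE_disc_measure
      by eventually_elim (rule summable_comparison_test'[OF abs, of 0], use le in auto)
    show "summable (\<lambda>n. \<integral>w. norm (a n * w ^ n) \<partial>disc_measure)"
    proof (rule summable_comparison_test'[OF abs, of 0])
      fix n
      have "(\<integral>w. norm (a n * w ^ n) \<partial>disc_measure) \<le> (\<integral>w. norm (a n) \<partial>disc_measure)"
        by (rule integral_mono_AE)
          (use AE_disc_measure le in \<open>auto intro!: integrable_norm integrable_mult_right integrable_disc_measure_power elim!: eventually_mono\<close>)
      then show "norm (\<integral>w. norm (a n * w ^ n) \<partial>disc_measure) \<le> norm (a n)"
        by simp
    qed
  qed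
  moreover have "(\<integral>w. (\<Sum>n. a n * w ^ n) \<partial>disc_measure) = (\<integral>w. g' w \<partial>disc_measure)"
  proof (rule integral_cong_AE)
    show "AE w in disc_measure. (\<Sum>n. a n * w ^ n) = g' w"
      using AE_disc_measure
    proof eventually_elim
      case (elim w)
      then show ?case using sums[of w] R g'[of w] by (simp add: sums_iff)
    qed
  qed measurable
  moreover have "(\<lambda>n. \<integral>w. a n * w ^ n \<partial>disc_measure) = (\<lambda>n. if n = 0 then a 0 else 0)"
    by (auto simp: fun_eq_iff integral_disc_measure_power)
  moreover have "(\<lambda>n. if n = 0 then a 0 else 0) sums a 0" by (rule sums_single)
  ultimately have "(\<integral>w. g' w \<partial>disc_measure) = a 0" by (metis sums_unique2)
  then show ?thesis by (simp add: a_def)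
qed

text \<open>
  The substitution \<open>y = sqrt (b\<^sup>2 + 2 r b t + r\<^sup>2 c\<^sup>2)\<close>, for which \<open>y dy = r b dt\<close>.  As \<open>t\<close> runs from \<open>-c\<close> to \<open>c\<close>,
  \<open>y\<close> runs from \<open>\<bar>b - r c\<bar>\<close> to \<open>b + r c\<close>.  The absolute value can be removed because \<open>y * h y\<close> is odd, so
  that its integral from \<open>b - r c\<close> to \<open>r c - b\<close> vanishes.
\<close>
lemma radial_substitution:
  fixes h :: "real \<Rightarrow> real"
  assumes "0 < b" "0 < r" "0 \<le> c"
    and cont: "continuous_on {b - r * c..b + r * c} h"
    and even: "\<And>y. \<bar>y\<bar> \<le> r * c - b \<Longrightarrow> h (- y) = h y"
  shows "integral {-c..c} (\<lambda>t. h (sqrt (b\<^sup>2 + 2 * r * b * t + r\<^sup>2 * c\<^sup>2))) =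
    integral {-c..c} (\<lambda>y. (b + r * y) * h (b + r * y)) / b"
proof -
  define g where "g t = sqrt (b\<^sup>2 + 2 * r * b * t + r\<^sup>2 * c\<^sup>2)" for t
  define u where "u y = y * h y" for y
  have u: "continuous_on {b - r * c..b + r * c} u"
    unfolding u_def by (intro continuous_intros cont)
  \<comment> \<open>the radicand, written so that its positivity for \<open>t > - c\<close> and its values at both ends can be read off\<close>
  have sq: "(b - r * c)\<^sup>2 + 2 * r * b * (t + c) = b\<^sup>2 + 2 * r * b * t + r\<^sup>2 * c\<^sup>2"
           "(b + r * c)\<^sup>2 - 2 * r * b * (c - t) = b\<^sup>2 + 2 * r * b * t + r\<^sup>2 * c\<^sup>2" for t
    by (simp_all add: power2_eq_square algebra_simps)
  have ga: "g (-c) = \<bar>b - r * c\<bar>" and gb: "g c = b + r * c"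
  proof -
    have "g (-c) = sqrt ((b - r * c)\<^sup>2)" unfolding g_def sq(1)[symmetric] by simp
    then show "g (-c) = \<bar>b - r * c\<bar>" by (simp only: real_sqrt_abs)
    have "g c = sqrt ((b + r * c)\<^sup>2)" unfolding g_def sq(2)[symmetric] by simp
    then show "g c = b + r * c" using assms by (simp only: real_sqrt_abs) simp
  qed
  have mono: "g s \<le> g t" if "s \<le> t" for s t
    unfolding g_def using that assms by (intro real_sqrt_le_mono) simp
  have sub: "g ` {-c..c} \<subseteq> {b - r * c..b + r * c}"
    using mono[of "-c"] mono[of _ c] ga gb by force
  have gpos: "0 < b\<^sup>2 + 2 * r * b * t + r\<^sup>2 * c\<^sup>2" if "t \<in> {-c..c} - {-c}" for t
    unfolding sq(1)[symmetric] using that assms by (intro add_nonneg_pos) auto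
  \<comment> \<open>the derivative of \<open>g\<close> can be infinite at \<open>- c\<close>, which happens if \<open>b = r * c\<close>\<close>
  have int: "((\<lambda>t. (r * b / g t) *\<^sub>R u (g t)) has_integral integral {g (-c)..g c} u) {-c..c}"
  proof (rule has_integral_substitution_strong[where s = "{-c}", OF _ _ _ sub u])
    show "continuous_on {-c..c} g"
      unfolding g_def by (intro continuous_intros)
    show "(g has_real_derivative r * b / g t) (at t within {-c..c})" if "t \<in> {-c..c} - {-c}" for t
      unfolding g_def using gpos[OF that]
      by (auto intro!: derivative_eq_intros simp: field_simps)
  qed (use assms mono[of "-c" c] in auto)
  have "((\<lambda>t. r * b * h (g t)) has_integral integral {g (-c)..g c} u) {-c..c}"
  proof (rule has_integral_spike_finite[OF _ _ int])
    show "finite {-c}" by simp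
    show "r * b * h (g t) = (r * b / g t) *\<^sub>R u (g t)" if "t \<in> {-c..c} - {-c}" for t
      using gpos[OF that] by (simp add: u_def g_def)
  qed
  then have 1: "r * b * integral {-c..c} (\<lambda>t. h (g t)) = integral {g (-c)..g c} u"
    by (metis integral_unique integral_mult_right)
  have 2: "integral {g (-c)..g c} u = integral {b - r * c..b + r * c} u"
  proof (cases "0 \<le> b - r * c")
    case True then show ?thesis by (simp add: ga gb)
  next
    case False
    define d where "d = r * c - b"
    have d: "0 < d" "d \<le> b + r * c" using False assms by (auto simp: d_def)
    have uc: "continuous_on {-d..d} u" by (rule continuous_on_subset[OF u]) (use d in \<open>auto simp: d_def\<close>)
    have uc': "continuous_on {-d..b + r * c} u" by (rule continuous_on_subset[OF u]) (simp add: d_def)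
    have "integral {-d..d} u = integral {-d..d} (\<lambda>y. u (-y))"
      using Henstock_Kurzweil_Integration.integral_reflect_real[of d "-d" u] by simp
    also have "\<dots> = integral {-d..d} (\<lambda>y. - u y)"
      by (rule integral_cong) (use even d in \<open>auto simp: u_def d_def\<close>)
    finally have "integral {-d..d} u = 0" by simp
    moreover have "integral {-d..d} u + integral {d..b + r * c} u = integral {-d..b + r * c} u"
      using d uc' by (intro Henstock_Kurzweil_Integration.integral_combine integrable_continuous_real) auto
    ultimately show ?thesis using False by (simp add: ga gb d_def)
  qed
  have "((\<lambda>y. r *\<^sub>R u (b + r * y)) has_integral integral {b + r * (-c)..b + r * c} u) {-c..c}"
  proof (rule has_integral_substitution[OF _ _ _ u])
    show "((\<lambda>y. b + r * y) has_real_derivative r) (at y within {-c..c})" for y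
      by (auto intro!: derivative_eq_intros)
    show "(\<lambda>y. b + r * y) ` {-c..c} \<subseteq> {b - r * c..b + r * c}"
    proof safe
      fix y assume "y \<in> {-c..c}"
      then have "r * (-c) \<le> r * y" "r * y \<le> r * c"
        using \<open>0 < r\<close> by (simp_all only: mult_le_cancel_left_pos atLeastAtMost_iff)
      then show "b + r * y \<in> {b - r * c..b + r * c}" by simp
    qed
  qed (use assms in auto)
  then have "((\<lambda>y. r * u (b + r * y)) has_integral integral {b - r * c..b + r * c} u) {-c..c}"
    by simp
  then have 3: "integral {b - r * c..b + r * c} u = r * integral {-c..c} (\<lambda>y. u (b + r * y))"
    by (metis integral_unique integral_mult_right)
  from 1 2 3 have "b * integral {-c..c} (\<lambda>t. h (g t)) = integral {-c..c} (\<lambda>y. u (b + r * y))"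
    using assms by simp
  then show ?thesis using assms by (simp add: g_def u_def field_simps)
qed

section \<open>The mean value formula in one quaternionic variable\<close>

definition quat_im :: "quat \<Rightarrow> quat" where
  "quat_im x = x - of_real (Qre x)"

text \<open>
  The point \<open>\<alpha> + i \<beta>\<close> of the closed upper half plane that belongs to the quaternion \<open>\<alpha> + J \<beta>\<close>.
\<close>
definition cpoint :: "quat \<Rightarrow> complex" where
  "cpoint x = Complex (Qre x) (norm (quat_im x))"

lemma Qre_of_real [simp]: "Qre (of_real c) = c" and Q_of_real [simp]: "Qi (of_real c) = 0" "Qj (of_real c) = 0" "Qk (of_real c) = 0"
  by (simp_all add: of_real_def)

lemma norm_quat_im_squared: "(norm (quat_im x))\<^sup>2 = (norm x)\<^sup>2 - (Qre x)\<^sup>2"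
  by (simp add: quat_im_def quat_norm_squared)

lemma Re_cpoint [simp]: "Re (cpoint x) = Qre x" and Im_cpoint [simp]: "Im (cpoint x) = norm (quat_im x)"
  by (simp_all add: cpoint_def)

lemma continuous_on_Qre [continuous_intros]:
  "continuous_on S f \<Longrightarrow> continuous_on S (\<lambda>x. Qre (f x))"
proof -
  have "continuous_on UNIV Qre"
    by (intro linear_continuous_on linear_conv_bounded_linear[THEN iffD1] linearI) auto
  then show "continuous_on S f \<Longrightarrow> continuous_on S (\<lambda>x. Qre (f x))"
    by (rule continuous_on_compose2) auto
qed

lemma continuous_on_quat_im [continuous_intros]:
  "continuous_on S f \<Longrightarrow> continuous_on S (\<lambda>x. quat_im (f x))"
  unfolding quat_im_def by (intro continuous_intros)

lemma continuous_on_cpoint [continuous_intros]: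
  "continuous_on S f \<Longrightarrow> continuous_on S (\<lambda>x. cpoint (f x))"
  unfolding cpoint_def Complex_eq by (intro continuous_intros)

lemma AE_quat_sphere: "AE l in quat_sphere. l \<in> sphere 0 1"
  by (metis AE_I2 space_quat_sphere)

lemma finite_measure_quat_sphere: "finite_measure quat_sphere"
  by (rule finite_measureI) (simp add: emeasure_space_quat_sphere)

lemma measure_quat_sphere [simp]: "measure quat_sphere (sphere 0 1) = 1"
  by (simp add: measure_def emeasure_space_quat_sphere)

lemma borel_measurable_continuous_on_quat_sphere:
  fixes f :: "quat \<Rightarrow> 'a::{banach, second_countable_topology}"
  assumes "continuous_on (sphere 0 1) f"
  shows "f \<in> borel_measurable quat_sphere"
  unfolding measurable_cong_sets[OF sets_quat_sphere refl]
  by (rule borel_measurable_continuous_on_restrict[OF assms])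

lemma integrable_continuous_on_quat_sphere:
  fixes f :: "quat \<Rightarrow> 'a::{banach, second_countable_topology}"
  assumes "continuous_on (sphere 0 1) f"
  shows "integrable quat_sphere f"
proof -
  interpret finite_measure quat_sphere by (rule finite_measure_quat_sphere)
  have "bounded (f ` sphere 0 1)"
    by (intro compact_imp_bounded compact_continuous_image assms compact_sphere)
  then obtain B where "\<forall>l\<in>sphere 0 1. norm (f l) \<le> B"
    unfolding bounded_iff by blast
  then show ?thesis
    by (intro integrable_const_bound[where B = B] borel_measurable_continuous_on_quat_sphere assms)
      (use AE_quat_sphere in \<open>auto elim!: eventually_mono\<close>)
qed

lemma cpoint_sphere_shift:
  assumes J: "J \<in> imag_units" and l: "l \<in> sphere 0 1"
  shows "cpoint (of_real a + b *\<^sub>R J + r *\<^sub>R l) =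
    Complex (a + r * Qre l) (sqrt (b\<^sup>2 + 2 * r * b * (l \<bullet> J) + r\<^sup>2 * (1 - (Qre l)\<^sup>2)))"
proof -
  let ?x = "of_real a + b *\<^sub>R J + r *\<^sub>R l"
  have Q: "Qre ?x = a + r * Qre l" using Re_imag_unit[OF J] by simp
  have JJ: "(Qi J)\<^sup>2 + (Qj J)\<^sup>2 + (Qk J)\<^sup>2 = 1"
    using quat_norm_squared[of J] norm_imag_unit[OF J] Re_imag_unit[OF J] by simp
  have ll: "(Qi l)\<^sup>2 + (Qj l)\<^sup>2 + (Qk l)\<^sup>2 = 1 - (Qre l)\<^sup>2"
    using quat_norm_squared[of l] l by simp
  have "(norm (quat_im ?x))\<^sup>2 = b\<^sup>2 * ((Qi J)\<^sup>2 + (Qj J)\<^sup>2 + (Qk J)\<^sup>2) + 2 * r * b * (l \<bullet> J)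
      + r\<^sup>2 * ((Qi l)\<^sup>2 + (Qj l)\<^sup>2 + (Qk l)\<^sup>2)"
    using Re_imag_unit[OF J]
    by (simp only: norm_quat_im_squared quat_norm_squared) (simp add: quat_im_def inner_quat_def power2_eq_square algebra_simps)
  then have "norm (quat_im ?x) = sqrt (b\<^sup>2 + 2 * r * b * (l \<bullet> J) + r\<^sup>2 * (1 - (Qre l)\<^sup>2))"
    unfolding JJ ll by (metis mult.right_neutral norm_ge_zero real_sqrt_unique)
  then show ?thesis using Q by (simp only: cpoint_def)
qed

lemma cpoint_plane: "J \<in> imag_units \<Longrightarrow> cpoint (of_real a + b *\<^sub>R J) = Complex a \<bar>b\<bar>"
  using norm_imag_unit[of J] by (simp add: cpoint_def quat_im_def Re_imag_unit)

lemma lborel_distr_Complex: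
  "distr (lborel \<Otimes>\<^sub>M lborel) borel (\<lambda>(x, y). Complex x y) = lborel"
proof -
  have lin: "linear (\<lambda>(x, y). Complex x y)" by (rule linearI) (auto simp: complex_eq_iff)
  have "bij_betw (\<lambda>(x, y). Complex x y) Basis Basis"
    by (rule bij_betw_imageI)
      (auto simp: Basis_prod_def Basis_complex_def inj_on_def complex_eq_iff)
  from lborel_distr_basis_iso[OF lin this] show ?thesis by (simp add: lborel_prod)
qed

text \<open>
  Fubini's theorem on the unit disc.  The inner integral is taken in the sense of Henstock and Kurzweil, for
  which the substitution rule allows an exceptional end point.
\<close>
lemma integral_disc_iterated:
  fixes k :: "complex \<Rightarrow> real"
  assumes k: "continuous_on (cball 0 1) k"
  shows "(\<integral>w. indicator (cball 0 1) w * k w \<partial>lborel) =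
    (\<integral>s. indicator {-1..1} s * integral {- sqrt (1 - s\<^sup>2)..sqrt (1 - s\<^sup>2)} (\<lambda>t. k (Complex s t)) \<partial>lborel)"
proof -
  let ?k = "\<lambda>w. indicator (cball 0 1) w * k w"
  have km: "?k \<in> borel_measurable borel"
    using borel_measurable_continuous_on_indicator[OF _ k] by simp
  have ki: "integrable lborel ?k"
    using borel_integrable_compact[OF compact_cball k] by simp
  have Cm: "(\<lambda>(x, y). Complex x y) \<in> measurable (lborel \<Otimes>\<^sub>M lborel) borel"
    unfolding lborel_prod case_prod_beta Complex_eq
    by (auto intro!: borel_measurable_continuous_onI continuous_intros)
  have int: "integrable (lborel \<Otimes>\<^sub>M lborel) (\<lambda>z. ?k (Complex (fst z) (snd z)))"
    using ki km Cm
    by (subst (asm) lborel_distr_Complex[symmetric]) (simp add: integrable_distr_eq case_prod_beta)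
  have "(\<integral>w. ?k w \<partial>lborel) = (\<integral>z. ?k (Complex (fst z) (snd z)) \<partial>(lborel \<Otimes>\<^sub>M lborel))"
    using km Cm
    by (subst lborel_distr_Complex[symmetric]) (simp add: integral_distr case_prod_beta)
  also have "\<dots> = (\<integral>s. (\<integral>t. ?k (Complex s t) \<partial>lborel) \<partial>lborel)"
    using lborel_pair.integral_fst'[OF int] by simp
  also have "\<dots> = (\<integral>s. indicator {-1..1} s * integral {- sqrt (1 - s\<^sup>2)..sqrt (1 - s\<^sup>2)} (\<lambda>t. k (Complex s t)) \<partial>lborel)"
  proof (intro Bochner_Integration.integral_cong refl)
    fix s :: real
    show "(\<integral>t. ?k (Complex s t) \<partial>lborel) = indicator {-1..1} s * integral {- sqrt (1 - s\<^sup>2)..sqrt (1 - s\<^sup>2)} (\<lambda>t. k (Complex s t))"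
    proof (cases "s \<in> {-1..1}")
      case True
      then have s: "s\<^sup>2 \<le> 1" by (auto simp: abs_square_le_1 abs_le_iff)
      have mem: "Complex s t \<in> cball 0 1 \<longleftrightarrow> t \<in> {- sqrt (1 - s\<^sup>2)..sqrt (1 - s\<^sup>2)}" for t
      proof -
        have "Complex s t \<in> cball 0 1 \<longleftrightarrow> t\<^sup>2 \<le> 1 - s\<^sup>2"
          by (auto simp: cmod_def algebra_simps)
        also have "\<dots> \<longleftrightarrow> \<bar>t\<bar> \<le> sqrt (1 - s\<^sup>2)"
          using real_sqrt_le_iff[of "t\<^sup>2" "1 - s\<^sup>2"] by simp
        finally show ?thesis by (auto simp: abs_le_iff)
      qed
      have cont: "continuous_on {- sqrt (1 - s\<^sup>2)..sqrt (1 - s\<^sup>2)} (\<lambda>t. k (Complex s t))"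
        by (rule continuous_on_compose2[OF k]) (use mem in \<open>auto simp: Complex_eq intro!: continuous_intros\<close>)
      have "(\<integral>t. ?k (Complex s t) \<partial>lborel) = (LINT t:{- sqrt (1 - s\<^sup>2)..sqrt (1 - s\<^sup>2)}|lborel. k (Complex s t))"
        unfolding set_lebesgue_integral_def
        by (intro Bochner_Integration.integral_cong refl) (use mem in \<open>auto simp: indicator_def\<close>)
      also have "\<dots> = integral {- sqrt (1 - s\<^sup>2)..sqrt (1 - s\<^sup>2)} (\<lambda>t. k (Complex s t))"
        by (intro set_borel_integral_eq_integral borel_integrable_atLeastAtMost' cont)
      finally show ?thesis using True by simp
    next
      case False
      have "Complex s t \<notin> cball 0 1" for t
      proof
        assume "Complex s t \<in> cball 0 1"
        then have "\<bar>s\<bar> \<le> 1" using abs_Re_le_cmod[of "Complex s t"] by simp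
        then show False using False by auto
      qed
      then have "?k (Complex s t) = 0" for t by simp
      moreover have "indicator {-1..1} s = (0::real)" using False by simp
      ultimately show ?thesis by (simp only: mult_zero_left Bochner_Integration.integral_zero)
    qed
  qed
  finally show ?thesis .
qed

text \<open>
  The mean value property of \<open>v = Im G / \<beta>\<close> at a centre \<open>a + J b\<close> off the real axis.  By
  \<open>distr_quat_sphere_disc\<close> the mean is an integral over the unit disc in the variables \<open>s\<close> and \<open>t\<close>.  On each
  segment with constant \<open>s\<close> the lemma \<open>radial_substitution\<close> replaces the integral of \<open>v\<close> by an integral of
  \<open>\<beta> v = Im G\<close>, and the result is the mean of \<open>Im G / b\<close> over the disc with centre \<open>a + i b\<close> and radius \<open>r\<close>.
\<close>
lemma sphere_mean_nonreal:
  fixes v :: "complex \<Rightarrow> real"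
  assumes E: "open E" and v: "continuous_on E v" and inv: "\<And>w. w \<in> E \<Longrightarrow> cnj w \<in> E \<and> v (cnj w) = v w"
    and G: "G holomorphic_on E" and Im: "\<And>w. w \<in> E \<Longrightarrow> Im (G w) = Im w * v w"
    and J: "J \<in> imag_units" and r: "0 < r" and b: "0 < b"
    and sub: "cpoint ` cball (of_real a + b *\<^sub>R J) r \<subseteq> E"
  shows "(\<integral>l. v (cpoint (of_real a + b *\<^sub>R J + r *\<^sub>R l)) \<partial>quat_sphere) = v (Complex a b)"
proof -
  define Z where "Z w = Complex (a + r * Re w) (sqrt (b\<^sup>2 + 2 * r * b * Im w + r\<^sup>2 * (1 - (Re w)\<^sup>2)))" for w
  \<comment> \<open>the disc is the slice of the ball by the complex plane of \<open>J\<close>; its points in the lower half plane are reached by conjugation\<close>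
  have EI: "Complex x y \<in> E" if "(x - a)\<^sup>2 + (y - b)\<^sup>2 \<le> r\<^sup>2" for x y
  proof -
    have "dist (of_real a + b *\<^sub>R J) (of_real x + y *\<^sub>R J) = norm (of_real (a - x) + (b - y) *\<^sub>R J)"
      by (simp add: dist_norm algebra_simps)
    moreover have "(norm (of_real (a - x) + (b - y) *\<^sub>R J))\<^sup>2 = (x - a)\<^sup>2 + (y - b)\<^sup>2 * ((Qi J)\<^sup>2 + (Qj J)\<^sup>2 + (Qk J)\<^sup>2)"
      using Re_imag_unit[OF J] by (simp only: quat_norm_squared) (simp add: power2_eq_square algebra_simps)
    moreover have "(Qi J)\<^sup>2 + (Qj J)\<^sup>2 + (Qk J)\<^sup>2 = 1"
      using quat_norm_squared[of J] norm_imag_unit[OF J] Re_imag_unit[OF J] by simp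
    ultimately have "(dist (of_real a + b *\<^sub>R J) (of_real x + y *\<^sub>R J))\<^sup>2 \<le> r\<^sup>2"
      using that by simp
    then have "of_real x + y *\<^sub>R J \<in> cball (of_real a + b *\<^sub>R J) r"
      using r by (simp add: power2_le_iff_abs_le)
    then have "Complex x \<bar>y\<bar> \<in> E" using sub cpoint_plane[OF J] by (metis image_subset_iff)
    then show ?thesis using inv[of "Complex x \<bar>y\<bar>"] by (cases "0 \<le> y") (auto simp: complex_cnj)
  qed
  have rad: "(b - r * c)\<^sup>2 \<le> b\<^sup>2 + 2 * r * b * t + r\<^sup>2 * c\<^sup>2" "b\<^sup>2 + 2 * r * b * t + r\<^sup>2 * c\<^sup>2 \<le> (b + r * c)\<^sup>2"
    if "\<bar>t\<bar> \<le> c" for t c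
  proof -
    have "0 \<le> r * b * (c + t)" "0 \<le> r * b * (c - t)" using r b that by (auto intro!: mult_nonneg_nonneg)
    then show "(b - r * c)\<^sup>2 \<le> b\<^sup>2 + 2 * r * b * t + r\<^sup>2 * c\<^sup>2" "b\<^sup>2 + 2 * r * b * t + r\<^sup>2 * c\<^sup>2 \<le> (b + r * c)\<^sup>2"
      by (simp_all add: power2_eq_square algebra_simps)
  qed
  have disc: "(Re w)\<^sup>2 \<le> 1" "\<bar>Im w\<bar> \<le> sqrt (1 - (Re w)\<^sup>2)" if "w \<in> cball 0 1" for w
  proof -
    have *: "(Re w)\<^sup>2 + (Im w)\<^sup>2 \<le> 1" using that by (simp add: cmod_def)
    then show "(Re w)\<^sup>2 \<le> 1" by (smt (verit) zero_le_power2)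
    show "\<bar>Im w\<bar> \<le> sqrt (1 - (Re w)\<^sup>2)" using * by (intro real_le_rsqrt) simp
  qed
  \<comment> \<open>the point \<open>Z w\<close> lies in the disc of radius \<open>r\<close> about \<open>Complex a b\<close>, because \<open>\<bar>y - b\<bar> \<le> r * c\<close>\<close>
  have ZE: "Z w \<in> E" if "w \<in> cball 0 1" for w
  proof -
    define c where "c = sqrt (1 - (Re w)\<^sup>2)"
    have c: "0 \<le> c" "c\<^sup>2 = 1 - (Re w)\<^sup>2" "\<bar>Im w\<bar> \<le> c" using disc[OF that] by (simp_all add: c_def)
    define y where "y = sqrt (b\<^sup>2 + 2 * r * b * Im w + r\<^sup>2 * c\<^sup>2)"
    have "\<bar>b - r * c\<bar> \<le> y" using rad(1)[OF c(3)] unfolding y_def by (metis real_sqrt_abs real_sqrt_le_mono)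
    moreover have "y \<le> b + r * c"
      using rad(2)[OF c(3)] r b c(1) unfolding y_def by (intro real_le_lsqrt) auto
    ultimately have "\<bar>y - b\<bar> \<le> r * c" by linarith
    then have "(y - b)\<^sup>2 \<le> (r * c)\<^sup>2" by (metis abs_ge_zero power2_abs power_mono)
    then have "(y - b)\<^sup>2 \<le> r\<^sup>2 * (1 - (Re w)\<^sup>2)" by (simp add: power_mult_distrib c)
    then have "Complex (a + r * Re w) y \<in> E" by (intro EI) (simp add: algebra_simps power_mult_distrib)
    then show ?thesis by (simp add: Z_def y_def c)
  qed
  have DE: "Complex a b + of_real r * w \<in> E" if "w \<in> cball 0 1" for w
  proof -
    have "(r * norm w)\<^sup>2 \<le> r\<^sup>2" using that r by (intro power_mono) auto
    then have "Complex (a + r * Re w) (b + r * Im w) \<in> E"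
      by (intro EI) (simp add: power_mult_distrib cmod_power2 algebra_simps)
    also have "Complex (a + r * Re w) (b + r * Im w) = Complex a b + of_real r * w"
      by (simp add: complex_eq_iff)
    finally show ?thesis .
  qed
  have Zc: "continuous_on (cball 0 1) Z"
    unfolding Z_def Complex_eq by (intro continuous_intros)
  have vZ: "continuous_on (cball 0 1) (\<lambda>w. v (Z w))"
    by (rule continuous_on_compose2[OF v Zc]) (use ZE in auto)
  have Gd: "continuous_on (cball 0 1) (\<lambda>w. G (Complex a b + of_real r * w))"
    by (rule continuous_on_compose2[OF holomorphic_on_imp_continuous_on[OF G]])
       (use DE in \<open>auto intro!: continuous_intros\<close>)
  have Gdi: "continuous_on (cball 0 1) (\<lambda>w. Im (G (Complex a b + of_real r * w)))"
    by (intro continuous_intros Gd)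
  let ?k = "\<lambda>w. indicator (cball 0 1) w * v (Z w)"
  have km: "?k \<in> borel_measurable borel"
    using borel_measurable_continuous_on_indicator[OF _ vZ] by simp
  have pm: "(\<lambda>l. Complex (Qre l) (l \<bullet> J)) \<in> borel_measurable quat_sphere"
    unfolding Complex_eq by (intro borel_measurable_continuous_on_quat_sphere continuous_intros)
  have pball: "Complex (Qre l) (l \<bullet> J) \<in> cball 0 1" if "l \<in> sphere 0 1" for l
  proof -
    have JJ: "J \<bullet> J = 1" and ll: "l \<bullet> l = 1" and J1: "1 \<bullet> J = 0" "l \<bullet> 1 = Qre l" "1 \<bullet> (1::quat) = 1"
      using norm_imag_unit[OF J] Re_imag_unit[OF J] that by (simp_all add: norm_eq_1) (simp_all add: inner_quat_def)
    then have J2: "J \<bullet> 1 = 0" "1 \<bullet> l = Qre l" "J \<bullet> l = l \<bullet> J" by (simp_all add: inner_commute)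
    have "0 \<le> (l - Qre l *\<^sub>R 1 - (l \<bullet> J) *\<^sub>R J) \<bullet> (l - Qre l *\<^sub>R 1 - (l \<bullet> J) *\<^sub>R J)" by simp
    also have "\<dots> = 1 - (Qre l)\<^sup>2 - (l \<bullet> J)\<^sup>2"
      by (simp add: inner_diff_left inner_diff_right JJ ll J1 J2 power2_eq_square)
    finally show ?thesis by (simp add: cmod_def)
  qed
  have "(\<integral>l. v (cpoint (of_real a + b *\<^sub>R J + r *\<^sub>R l)) \<partial>quat_sphere) = (\<integral>l. ?k (Complex (Qre l) (l \<bullet> J)) \<partial>quat_sphere)"
  proof (rule Bochner_Integration.integral_cong[OF refl])
    fix l assume "l \<in> space quat_sphere"
    then have l: "l \<in> sphere 0 1" by simp
    show "v (cpoint (of_real a + b *\<^sub>R J + r *\<^sub>R l)) = ?k (Complex (Qre l) (l \<bullet> J))"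
      using pball[OF l] by (simp add: cpoint_sphere_shift[OF J l] Z_def)
  qed
  also have "\<dots> = (\<integral>w. ?k w \<partial>disc_measure)"
    unfolding disc_measure_def distr_quat_sphere_disc[OF J, symmetric]
    by (rule integral_distr[OF pm km, symmetric])
  also have "\<dots> = (1 / pi) * (\<integral>w. indicator (cball 0 1) w * v (Z w) \<partial>lborel)"
  proof -
    have eq: "(\<lambda>w. indicator (cball 0 1) w * ?k w) = ?k" by (auto simp: indicator_def)
    show ?thesis using integral_disc_measure[OF km] by (simp add: eq)
  qed
  also have "(\<integral>w. indicator (cball 0 1) w * v (Z w) \<partial>lborel) =
     (\<integral>w. indicator (cball 0 1) w * Im (G (Complex a b + of_real r * w)) \<partial>lborel) / b"
    unfolding integral_disc_iterated[OF vZ] integral_disc_iterated[OF Gdi] integral_divide_zero[symmetric]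
  proof (rule Bochner_Integration.integral_cong[OF refl])
    fix s :: real
    define c where "c = sqrt (1 - s\<^sup>2)"
    show "indicator {-1..1} s * integral {- sqrt (1 - s\<^sup>2)..sqrt (1 - s\<^sup>2)} (\<lambda>t. v (Z (Complex s t))) =
      indicator {-1..1} s * integral {- sqrt (1 - s\<^sup>2)..sqrt (1 - s\<^sup>2)} (\<lambda>t. Im (G (Complex a b + of_real r * Complex s t))) / b"
    proof (cases "s \<in> {-1..1}")
      case True
      then have "s\<^sup>2 \<le> 1" by (auto simp: abs_square_le_1 abs_le_iff)
      then have c: "0 \<le> c" "c\<^sup>2 = 1 - s\<^sup>2" by (simp_all add: c_def)
      define h where "h y = v (Complex (a + r * s) y)" for y
      have hE: "Complex (a + r * s) y \<in> E" if "y \<in> {b - r * c..b + r * c}" for y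
      proof (rule EI)
        have "\<bar>y - b\<bar> \<le> r * c" using that by auto
        then have "(y - b)\<^sup>2 \<le> (r * c)\<^sup>2" by (metis abs_ge_zero power2_abs power_mono)
        then show "(a + r * s - a)\<^sup>2 + (y - b)\<^sup>2 \<le> r\<^sup>2"
          by (simp add: power_mult_distrib c algebra_simps)
      qed
      have "integral {-c..c} (\<lambda>t. h (sqrt (b\<^sup>2 + 2 * r * b * t + r\<^sup>2 * c\<^sup>2))) =
        integral {-c..c} (\<lambda>y. (b + r * y) * h (b + r * y)) / b"
      proof (rule radial_substitution[OF b r c(1)])
        show "continuous_on {b - r * c..b + r * c} h"
          unfolding h_def
          by (rule continuous_on_compose2[OF v]) (use hE in \<open>auto simp: Complex_eq intro!: continuous_intros\<close>)
        show "h (- y) = h y" if "\<bar>y\<bar> \<le> r * c - b" for y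
        proof -
          have "y \<in> {b - r * c..b + r * c}" using that b by auto
          from inv[OF hE[OF this]] show ?thesis by (simp add: h_def complex_cnj)
        qed
      qed
      also have "integral {-c..c} (\<lambda>y. (b + r * y) * h (b + r * y)) =
        integral {-c..c} (\<lambda>t. Im (G (Complex a b + of_real r * Complex s t)))"
      proof (rule integral_cong)
        fix t assume t: "t \<in> {-c..c}"
        have eq: "Complex a b + of_real r * Complex s t = Complex (a + r * s) (b + r * t)"
          by (simp add: complex_eq_iff)
        have "b + r * t \<in> {b - r * c..b + r * c}"
          using t r mult_left_mono[of "-c" t r] mult_left_mono[of t c r] by auto
        from Im[OF hE[OF this]] show "(b + r * t) * h (b + r * t) = Im (G (Complex a b + of_real r * Complex s t))"
          by (simp add: eq h_def)
      qed
      finally show ?thesis using True c by (simp add: c_def[symmetric] h_def Z_def)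
    qed simp
  qed
  also have "(1 / pi) * ((\<integral>w. indicator (cball 0 1) w * Im (G (Complex a b + of_real r * w)) \<partial>lborel) / b) =
     Im (\<integral>w. indicator (cball 0 1) w *\<^sub>R G (Complex a b + of_real r * w) \<partial>disc_measure) / b"
  proof -
    let ?g = "\<lambda>w. indicator (cball 0 1) w *\<^sub>R G (Complex a b + of_real r * w)"
    have gm: "?g \<in> borel_measurable borel"
      by (rule borel_measurable_continuous_on_indicator[OF _ Gd]) simp
    have gi: "integrable lborel ?g"
      by (rule borel_integrable_compact[OF compact_cball Gd])
    have "(\<lambda>w. indicator (cball 0 1) w *\<^sub>R ?g w) = ?g" by (auto simp: indicator_def)
    then have "(\<integral>w. ?g w \<partial>disc_measure) = (1 / pi) *\<^sub>R (\<integral>w. ?g w \<partial>lborel)"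
      using integral_disc_measure[OF gm] by simp
    then have "Im (\<integral>w. ?g w \<partial>disc_measure) = (1 / pi) * Im (\<integral>w. ?g w \<partial>lborel)"
      by simp
    also have "Im (\<integral>w. ?g w \<partial>lborel) = (\<integral>w. Im (?g w) \<partial>lborel)" by (rule integral_Im[OF gi, symmetric])
    finally show ?thesis by simp
  qed
  also have "(\<integral>w. indicator (cball 0 1) w *\<^sub>R G (Complex a b + of_real r * w) \<partial>disc_measure) = G (Complex a b)"
  proof -
    let ?S = "(\<lambda>w. Complex a b + of_real r * w) -` E"
    have "open ?S" by (intro open_vimage E continuous_intros)
    moreover have "cball 0 1 \<subseteq> ?S" using DE by auto
    ultimately obtain e where e: "e > 0" "(\<Union>x\<in>cball 0 1. cball x e) \<subseteq> ?S"
      using compact_subset_open_imp_cball_epsilon_subset[OF compact_cball] by metis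
    have "ball 0 (1 + e) \<subseteq> ?S"
    proof
      fix w :: complex assume w: "w \<in> ball 0 (1 + e)"
      show "w \<in> ?S"
      proof (cases "norm w \<le> 1")
        case False
        then have "w \<noteq> 0" by auto
        then have "w = norm w *\<^sub>R sgn w" by (simp add: sgn_div_norm)
        then have "dist (sgn w) w = norm ((1 - norm w) *\<^sub>R sgn w)" by (simp add: dist_norm algebra_simps)
        then have "w \<in> cball (sgn w) e" using w False by (auto simp: norm_sgn)
        moreover have "sgn w \<in> cball 0 1" by (simp add: norm_sgn)
        ultimately show ?thesis using e(2) by blast
      qed (use DE in auto)
    qed
    then have "(\<lambda>w. G (Complex a b + of_real r * w)) holomorphic_on ball 0 (1 + e)"
      by (intro holomorphic_on_compose_gen[OF _ G, unfolded o_def]) (auto intro!: holomorphic_intros)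
    from holomorphic_disc_mean[OF this, of "\<lambda>w. indicator (cball 0 1) w *\<^sub>R G (Complex a b + of_real r * w)"]
    show ?thesis
      using e(1) borel_measurable_continuous_on_indicator[OF _ Gd] by auto
  qed
  also have "Im (G (Complex a b)) / b = v (Complex a b)"
    using Im[OF EI, of a b] r b by simp
  finally show ?thesis .
qed


text \<open>
  For a real centre the division by \<open>b\<close> in the preceding argument is impossible; the centre is approximated by
  \<open>a + J b\<^sub>n\<close> with \<open>b\<^sub>n\<close> tending to 0.
\<close>
lemma sphere_mean_real:
  fixes v :: "complex \<Rightarrow> real"
  assumes E: "open E" and v: "continuous_on E v" and inv: "\<And>w. w \<in> E \<Longrightarrow> cnj w \<in> E \<and> v (cnj w) = v w"
    and G: "G holomorphic_on E" and Im: "\<And>w. w \<in> E \<Longrightarrow> Im (G w) = Im w * v w"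
    and J: "J \<in> imag_units" and r: "0 < r"
    and sub: "cpoint ` cball (of_real a) r \<subseteq> E"
  shows "(\<integral>l. v (cpoint (of_real a + r *\<^sub>R l)) \<partial>quat_sphere) = v (of_real a)"
proof -
  let ?W = "cpoint -` E"
  have W: "open ?W" by (intro open_vimage E continuous_intros)
  \<comment> \<open>room for moving the ball off the real axis: all translates by at most \<open>e\<close> lie in the compact set \<open>K\<close>\<close>
  obtain e where e: "e > 0" "(\<Union>x\<in>cball (of_real a) r. cball x e) \<subseteq> ?W"
    using compact_subset_open_imp_cball_epsilon_subset[OF compact_cball W, of "of_real a" r] sub by blast
  define K where "K = {x + y | x y. x \<in> cball (of_real a) r \<and> y \<in> cball (0::quat) e}"
  have K: "compact K" unfolding K_def by (intro compact_sums compact_cball)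
  have KW: "K \<subseteq> ?W"
  proof
    fix z assume "z \<in> K"
    then obtain x y where "x \<in> cball (of_real a) r" "z \<in> cball x e"
      by (auto simp: K_def dist_norm)
    then show "z \<in> ?W" using e(2) by blast
  qed
  have vc: "continuous_on K (\<lambda>x. v (cpoint x))"
    by (rule continuous_on_compose2[OF v]) (use KW in \<open>auto intro!: continuous_intros\<close>)
  obtain B where B: "\<forall>x\<in>K. norm (v (cpoint x)) \<le> B"
    using compact_imp_bounded[OF compact_continuous_image[OF vc K]] unfolding bounded_iff by blast
  define b where "b n = e / real (Suc n)" for n
  have b: "0 < b n" "b n \<le> e" for n
    using e by (auto simp: b_def divide_le_eq)
  have b0: "b \<longlonglongrightarrow> 0" unfolding b_def using LIMSEQ_inverse_real_of_nat[THEN tendsto_mult_right_zero, of e] by (simp add: divide_inverse)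
  have nJ: "norm J = 1" by (rule norm_imag_unit[OF J])
  have inK: "of_real a + b n *\<^sub>R J + r *\<^sub>R l \<in> K" if "norm l = 1" for l n
    unfolding K_def using that r b[of n] nJ
    by (intro CollectI exI[of _ "of_real a + r *\<^sub>R l"] exI[of _ "b n *\<^sub>R J"]) (auto simp: dist_norm)
  have inK0: "of_real a + r *\<^sub>R l \<in> K" if "norm l = 1" for l
    unfolding K_def using that r e
    by (intro CollectI exI[of _ "of_real a + r *\<^sub>R l"] exI[of _ 0]) (auto simp: dist_norm)
  have eq: "(\<integral>l. v (cpoint (of_real a + b n *\<^sub>R J + r *\<^sub>R l)) \<partial>quat_sphere) = v (Complex a (b n))" for n
  proof (rule sphere_mean_nonreal[OF E v inv G Im J r b(1)])
    show "cpoint ` cball (of_real a + b n *\<^sub>R J) r \<subseteq> E"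
    proof safe
      fix x assume x: "x \<in> cball (of_real a + b n *\<^sub>R J) r"
      have "x \<in> K" unfolding K_def using x b[of n] nJ
        by (intro CollectI exI[of _ "x - b n *\<^sub>R J"] exI[of _ "b n *\<^sub>R J"]) (auto simp: dist_norm algebra_simps)
      then show "cpoint x \<in> E" using KW by auto
    qed
  qed auto
  have "(\<lambda>n. \<integral>l. v (cpoint (of_real a + b n *\<^sub>R J + r *\<^sub>R l)) \<partial>quat_sphere) \<longlonglongrightarrow> (\<integral>l. v (cpoint (of_real a + r *\<^sub>R l)) \<partial>quat_sphere)"
  proof (rule integral_dominated_convergence[where w = "\<lambda>_. B"])
    show "(\<lambda>l. v (cpoint (of_real a + r *\<^sub>R l))) \<in> borel_measurable quat_sphere"
      by (intro borel_measurable_continuous_on_quat_sphere continuous_on_compose2[OF vc])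
         (use inK0 in \<open>auto intro!: continuous_intros\<close>)
    show "(\<lambda>l. v (cpoint (of_real a + b n *\<^sub>R J + r *\<^sub>R l))) \<in> borel_measurable quat_sphere" for n
      by (intro borel_measurable_continuous_on_quat_sphere continuous_on_compose2[OF vc])
         (use inK in \<open>auto intro!: continuous_intros\<close>)
    show "integrable quat_sphere (\<lambda>_. B)"
      by (rule integrable_continuous_on_quat_sphere) (rule continuous_on_const)
    show "AE l in quat_sphere. (\<lambda>n. v (cpoint (of_real a + b n *\<^sub>R J + r *\<^sub>R l))) \<longlonglongrightarrow> v (cpoint (of_real a + r *\<^sub>R l))"
      using AE_quat_sphere
    proof eventually_elim
      case (elim l)
      have "(\<lambda>n. of_real a + b n *\<^sub>R J + r *\<^sub>R l) \<longlonglongrightarrow> of_real a + 0 *\<^sub>R J + r *\<^sub>R l"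
        by (intro tendsto_intros b0)
      then show ?case
        by (intro continuous_on_tendsto_compose[OF vc]) (use inK inK0 elim in auto)
    qed
    show "AE l in quat_sphere. norm (v (cpoint (of_real a + b n *\<^sub>R J + r *\<^sub>R l))) \<le> B" for n
      using AE_quat_sphere by eventually_elim (use inK B in auto)
  qed
  moreover have "(\<lambda>n. v (Complex a (b n))) \<longlonglongrightarrow> v (of_real a)"
  proof (rule continuous_on_tendsto_compose[OF v])
    show "(\<lambda>n. Complex a (b n)) \<longlonglongrightarrow> of_real a"
      using tendsto_Complex[OF tendsto_const b0, of a] by (simp add: complex_of_real_def)
    have "of_real a \<in> cball (of_real a) r" using r by simp
    then have "cpoint (of_real a) \<in> E" using sub by blast
    then show "of_real a \<in> E" by (simp add: cpoint_def quat_im_def complex_of_real_def)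
    show "\<forall>\<^sub>F n in sequentially. Complex a (b n) \<in> E"
    proof (rule always_eventually, rule allI)
      fix n
      have "of_real a + b n *\<^sub>R J \<in> K" unfolding K_def using r b[of n] nJ
        by (intro CollectI exI[of _ "of_real a"] exI[of _ "b n *\<^sub>R J"]) (auto simp: dist_norm)
      then have "cpoint (of_real a + b n *\<^sub>R J) \<in> E" using KW by auto
      then show "Complex a (b n) \<in> E" using b(1)[of n] by (simp add: cpoint_plane[OF J])
    qed
  qed
  ultimately show ?thesis unfolding eq by (rule LIMSEQ_unique)
qed

lemma quat_polar:
  obtains J where "J \<in> imag_units" "x = of_real (Qre x) + norm (quat_im x) *\<^sub>R J"
proof (cases "quat_im x = 0")
  case True
  have "Quat 0 1 0 0 \<in> imag_units" by (simp add: imag_units_def quat_eq_iff power2_eq_square)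
  with that True show ?thesis by (metis quat_im_def add.right_neutral norm_zero right_minus_eq scaleR_zero_left)
next
  case False
  have re: "Qre (quat_im x) = 0" by (simp add: quat_im_def)
  have "sgn (quat_im x) \<in> imag_units"
  proof -
    have cn: "quat_cnj (quat_im x) = - quat_im x" using re by (simp add: quat_eq_iff)
    have "quat_im x * quat_im x = - of_real ((norm (quat_im x))\<^sup>2)"
      unfolding quat_mult_cnj(1)[symmetric] cn by simp
    moreover have "inverse (norm (quat_im x)) * (inverse (norm (quat_im x)) * (norm (quat_im x) * norm (quat_im x))) = 1"
      using False by (simp add: field_simps)
    ultimately show ?thesis
      by (simp add: imag_units_def sgn_div_norm power2_eq_square of_real_def)
  qed
  moreover have "x = of_real (Qre x) + norm (quat_im x) *\<^sub>R sgn (quat_im x)"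
    using False by (simp add: sgn_div_norm quat_im_def)
  ultimately show ?thesis by (rule that)
qed

lemma sphere_mean:
  fixes v :: "complex \<Rightarrow> real"
  assumes E: "open E" and v: "continuous_on E v" and inv: "\<And>w. w \<in> E \<Longrightarrow> cnj w \<in> E \<and> v (cnj w) = v w"
    and G: "G holomorphic_on E" and Im: "\<And>w. w \<in> E \<Longrightarrow> Im (G w) = Im w * v w"
    and r: "0 \<le> r" and sub: "cpoint ` cball q r \<subseteq> E"
  shows "(\<integral>l. v (cpoint (q + r *\<^sub>R l)) \<partial>quat_sphere) = v (cpoint q)"
proof (cases "r = 0")
  case False
  then have r: "0 < r" using r by simp
  obtain J where J: "J \<in> imag_units" and q: "q = of_real (Qre q) + norm (quat_im q) *\<^sub>R J"
    by (rule quat_polar)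
  show ?thesis
  proof (cases "quat_im q = 0")
    case True
    then have q0: "q = of_real (Qre q)" using q by simp
    have "(\<integral>l. v (cpoint (of_real (Qre q) + r *\<^sub>R l)) \<partial>quat_sphere) = v (of_real (Qre q))"
      by (rule sphere_mean_real[OF E v inv G Im J r]) (use sub q0 in auto)
    moreover have "cpoint q = of_real (Qre q)" by (simp add: cpoint_def True complex_of_real_def)
    ultimately show ?thesis using q0 by simp
  next
    case False
    have "(\<integral>l. v (cpoint (of_real (Qre q) + norm (quat_im q) *\<^sub>R J + r *\<^sub>R l)) \<partial>quat_sphere) = v (Complex (Qre q) (norm (quat_im q)))"
      by (rule sphere_mean_nonreal[OF E v inv G Im J r]) (use sub q False in auto)
    then show ?thesis using q by (simp add: cpoint_def)
  qed
qed simp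

lemma quat_inner_mult_left: "(p * x) \<bullet> y = x \<bullet> (quat_cnj p * y)"
  by (simp add: inner_quat_def algebra_simps)

text \<open>
  The identity behind the cancellation of the imaginary unit of \<open>x\<close>: with \<open>x = q + r \<lambda>\<close>, the term
  \<open>r \<lambda>\<^sup>* V\<close> completes \<open>quat_im x * V\<close> to an expression in which \<open>x\<close> occurs only through its real part.
\<close>
lemma quat_im_mult_split: "quat_im x + quat_cnj (x - q) = of_real (Qre x - Qre q) + quat_im q"
  by (simp add: quat_im_def quat_eq_iff)

text \<open>
  The one-variable formula.  A slice function with stem function \<open>A + i B\<close> has the value
  \<open>A + quat_im x * V\<close> at \<open>x\<close>, since \<open>J B = J \<beta> V\<close>; in this form no choice of \<open>J\<close> at real points is
  required.  Holomorphy of the pair \<open>A, B\<close> is expressed by means of inner products with arbitrary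
  quaternions, which makes it stable under multiplication by constants from the left.
\<close>
lemma slice_mean_formula:
  fixes A B V :: "complex \<Rightarrow> quat"
  assumes E: "open E" and A: "continuous_on E A" and V: "continuous_on E V"
    and inv: "\<And>w. w \<in> E \<Longrightarrow> cnj w \<in> E \<and> A (cnj w) = A w \<and> V (cnj w) = V w"
    and holo: "\<And>c. (\<lambda>w. Complex (A w \<bullet> c) (B w \<bullet> c)) holomorphic_on E"
    and B: "\<And>w. w \<in> E \<Longrightarrow> B w = Im w *\<^sub>R V w"
    and r: "0 \<le> r" and sub: "cpoint ` cball q r \<subseteq> E"
  shows "A (cpoint q) + quat_im q * V (cpoint q) =
    (\<integral>l. A (cpoint (q + r *\<^sub>R l)) + quat_im (q + r *\<^sub>R l) * V (cpoint (q + r *\<^sub>R l)) \<partial>quat_sphere)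
    + r *\<^sub>R (\<integral>l. quat_cnj l * V (cpoint (q + r *\<^sub>R l)) \<partial>quat_sphere)"
proof -
  \<comment> \<open>the part of the integrand that remains besides \<open>quat_im q * V\<close>; it is \<open>Im G / Im w\<close> for \<open>G = (w - Qre q) * (A + i B)\<close>\<close>
  define W where "W w = A w + (Re w - Qre q) *\<^sub>R V w" for w
  have inE: "cpoint (q + r *\<^sub>R l) \<in> E" if "l \<in> sphere 0 1" for l
    using sub that r by (auto simp: image_subset_iff dist_norm)
  have cont: "continuous_on (sphere 0 1) (\<lambda>l. g (cpoint (q + r *\<^sub>R l)))" if "continuous_on E g" for g :: "complex \<Rightarrow> quat"
    by (rule continuous_on_compose2[OF that]) (use inE in \<open>auto intro!: continuous_intros\<close>)
  have Wc: "continuous_on E W" unfolding W_def by (intro continuous_intros A V)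
  have cnj_cont: "continuous_on UNIV quat_cnj"
    by (intro linear_continuous_on linear_conv_bounded_linear[THEN iffD1] linearI) (auto simp: quat_eq_iff)
  have mean: "(\<integral>l. g (cpoint (q + r *\<^sub>R l)) \<partial>quat_sphere) = g (cpoint q)"
    if g: "continuous_on E g" and ginv: "\<And>w. w \<in> E \<Longrightarrow> g (cnj w) = g w"
      and G: "\<And>c. \<exists>G. G holomorphic_on E \<and> (\<forall>w\<in>E. Im (G w) = Im w * (g w \<bullet> c))" for g :: "complex \<Rightarrow> quat"
  proof (rule euclidean_eqI)
    fix c :: quat assume "c \<in> Basis"
    obtain G where G: "G holomorphic_on E" "\<And>w. w \<in> E \<Longrightarrow> Im (G w) = Im w * (g w \<bullet> c)"
      using G by blast
    have "(\<integral>l. g (cpoint (q + r *\<^sub>R l)) \<partial>quat_sphere) \<bullet> c = (\<integral>l. g (cpoint (q + r *\<^sub>R l)) \<bullet> c \<partial>quat_sphere)"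
      by (intro integral_inner_left[symmetric] integrable_continuous_on_quat_sphere cont g)
    also have "\<dots> = g (cpoint q) \<bullet> c"
      by (rule sphere_mean[OF E _ _ G r sub]) (use inv ginv g in \<open>auto intro!: continuous_intros\<close>)
    finally show "(\<integral>l. g (cpoint (q + r *\<^sub>R l)) \<partial>quat_sphere) \<bullet> c = g (cpoint q) \<bullet> c" .
  qed
  have meanV: "(\<integral>l. V (cpoint (q + r *\<^sub>R l)) \<partial>quat_sphere) = V (cpoint q)"
    by (rule mean[OF V]) (use inv B holo in \<open>auto intro!: exI[of _ "\<lambda>w. Complex (A w \<bullet> c) (B w \<bullet> c)" for c]\<close>)
  have meanW: "(\<integral>l. W (cpoint (q + r *\<^sub>R l)) \<partial>quat_sphere) = W (cpoint q)"
  proof (rule mean[OF Wc])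
    show "W (cnj w) = W w" if "w \<in> E" for w using inv[OF that] by (simp add: W_def)
    show "\<exists>G. G holomorphic_on E \<and> (\<forall>w\<in>E. Im (G w) = Im w * (W w \<bullet> c))" for c
      by (rule exI[of _ "\<lambda>w. (w - of_real (Qre q)) * Complex (A w \<bullet> c) (B w \<bullet> c)"])
        (use B in \<open>auto intro!: holomorphic_intros holo simp: W_def inner_add_left algebra_simps\<close>)
  qed
  have i1: "integrable quat_sphere (\<lambda>l. A (cpoint (q + r *\<^sub>R l)) + quat_im (q + r *\<^sub>R l) * V (cpoint (q + r *\<^sub>R l)))"
    by (intro integrable_continuous_on_quat_sphere continuous_intros cont A V)
  have i2: "integrable quat_sphere (\<lambda>l. quat_cnj l * V (cpoint (q + r *\<^sub>R l)))"
    by (intro integrable_continuous_on_quat_sphere continuous_intros cont V continuous_on_subset[OF cnj_cont]) auto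
  have i3: "integrable quat_sphere (\<lambda>l. W (cpoint (q + r *\<^sub>R l)))" "integrable quat_sphere (\<lambda>l. V (cpoint (q + r *\<^sub>R l)))"
    by (intro integrable_continuous_on_quat_sphere cont Wc V)+
  have pt: "A (cpoint x) + quat_im x * V (cpoint x) + r *\<^sub>R (quat_cnj l * V (cpoint x)) = W (cpoint x) + quat_im q * V (cpoint x)"
    if "x = q + r *\<^sub>R l" for x l
  proof -
    have "r *\<^sub>R quat_cnj l = quat_cnj (x - q)" by (simp add: that quat_eq_iff)
    then have "quat_im x * V (cpoint x) + r *\<^sub>R (quat_cnj l * V (cpoint x)) = (quat_im x + quat_cnj (x - q)) * V (cpoint x)"
      by (simp add: distrib_right flip: mult_scaleR_left)
    also have "\<dots> = (Qre x - Qre q) *\<^sub>R V (cpoint x) + quat_im q * V (cpoint x)"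
      unfolding quat_im_mult_split by (simp add: distrib_right scaleR_conv_of_real)
    finally show ?thesis by (simp add: W_def add.assoc)
  qed
  have "(\<integral>l. A (cpoint (q + r *\<^sub>R l)) + quat_im (q + r *\<^sub>R l) * V (cpoint (q + r *\<^sub>R l)) \<partial>quat_sphere)
    + r *\<^sub>R (\<integral>l. quat_cnj l * V (cpoint (q + r *\<^sub>R l)) \<partial>quat_sphere) =
    (\<integral>l. (A (cpoint (q + r *\<^sub>R l)) + quat_im (q + r *\<^sub>R l) * V (cpoint (q + r *\<^sub>R l))) + r *\<^sub>R (quat_cnj l * V (cpoint (q + r *\<^sub>R l))) \<partial>quat_sphere)"
    using i1 i2 by simp
  also have "\<dots> = (\<integral>l. W (cpoint (q + r *\<^sub>R l)) + quat_im q * V (cpoint (q + r *\<^sub>R l)) \<partial>quat_sphere)"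
    by (simp only: pt[OF refl])
  also have "\<dots> = W (cpoint q) + quat_im q * V (cpoint q)"
    using i3 by (simp add: meanV meanW)
  finally show ?thesis by (simp add: W_def)
qed

section \<open>Slice functions and their stem functions\<close>

text \<open>
  A real quaternion has no distinguished imaginary unit; there the unit \<open>i\<close> is chosen.  Any other unit would serve,
  because odd components of a stem function vanish at real points.
\<close>
definition imag_unit_of :: "quat \<Rightarrow> quat" where
  "imag_unit_of x = (if quat_im x = 0 then Quat 0 1 0 0 else sgn (quat_im x))"

lemma imag_unit_i: "Quat 0 1 0 0 \<in> imag_units"
  by (simp add: imag_units_def quat_eq_iff power2_eq_square)

lemma imag_units_minus: "J \<in> imag_units \<Longrightarrow> - J \<in> imag_units"
  by (simp add: imag_units_def)

lemma imag_unit_of_eqI: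
  assumes "J \<in> imag_units" "b \<noteq> 0"
  shows "imag_unit_of (of_real a + b *\<^sub>R J) = sgn b *\<^sub>R J"
  using assms norm_imag_unit[OF assms(1)] Re_imag_unit[OF assms(1)]
  by (auto simp: imag_unit_of_def quat_im_def sgn_scaleR) (simp add: sgn_div_norm)

lemma imag_unit_of_in: "imag_unit_of x \<in> imag_units"
proof (cases "quat_im x = 0")
  case False
  obtain J where J: "J \<in> imag_units" "x = of_real (Qre x) + norm (quat_im x) *\<^sub>R J"
    by (rule quat_polar)
  have "imag_unit_of x = J"
    using False by (subst J(2), subst imag_unit_of_eqI[OF J(1)]) auto
  then show ?thesis using J by simp
qed (simp add: imag_unit_of_def imag_unit_i)

lemma imag_unit_of_mult_norm: "norm (quat_im x) *\<^sub>R imag_unit_of x = quat_im x"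
  by (simp add: imag_unit_of_def sgn_div_norm)

lemma ordered_prod_empty [simp]: "ordered_prod q {} = 1"
  by (simp add: ordered_prod_def)

lemma ordered_prod_cong:
  "(\<And>h. h \<in> K \<Longrightarrow> p h = q h) \<Longrightarrow> ordered_prod p K = ordered_prod q (K :: 'n::{finite,linorder} set)"
  unfolding ordered_prod_def by (rule arg_cong[where f = prod_list]) (rule map_cong, auto)

lemma ordered_prod_insert_min:
  fixes K :: "'n::{finite,linorder} set"
  assumes "\<And>k. k \<in> K \<Longrightarrow> h < k"
  shows "ordered_prod q (insert h K) = q h * ordered_prod q K"
proof -
  have "sorted_list_of_set (insert h K) = h # sorted_list_of_set K"
  proof (rule sorted_distinct_set_unique)
    show "sorted (h # sorted_list_of_set K)" using assms by (auto simp: less_imp_le)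
    show "distinct (h # sorted_list_of_set K)" using assms by auto
  qed (simp_all del: sorted_list_of_set_insert_remove)
  then show ?thesis by (simp add: ordered_prod_def)
qed

lemma ordered_prod_insert_max:
  fixes K :: "'n::{finite,linorder} set"
  assumes "\<And>k. k \<in> K \<Longrightarrow> k < h"
  shows "ordered_prod q (insert h K) = ordered_prod q K * q h"
proof -
  have "sorted_list_of_set (insert h K) = sorted_list_of_set K @ [h]"
  proof (rule sorted_distinct_set_unique)
    show "sorted (sorted_list_of_set K @ [h])" using assms by (auto simp: sorted_append less_imp_le)
    show "distinct (sorted_list_of_set K @ [h])" using assms by auto
  qed (simp_all del: sorted_list_of_set_insert_remove)
  then show ?thesis by (simp add: ordered_prod_def)
qed

lemma ordered_prod_signs:
  fixes J :: "'n::{finite,linorder} \<Rightarrow> quat"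
  shows "ordered_prod (\<lambda>h. if h \<in> S then - J h else J h) K = (-1) ^ card (K \<inter> S) * ordered_prod J K"
proof -
  have "prod_list (map (\<lambda>h. if h \<in> S then - J h else J h) xs) = (-1) ^ card (set xs \<inter> S) * prod_list (map J xs)"
    if "distinct xs" for xs
    using that
  proof (induction xs)
    case (Cons x xs)
    have comm: "J x * (-1) ^ n = (-1) ^ n * J x" for n
      by (induction n) auto
    show ?case
      using Cons by (auto simp: Int_insert_left mult.assoc[symmetric] comm)
  qed simp
  then show ?thesis by (simp add: ordered_prod_def)
qed

lemma norm_ordered_prod:
  fixes J :: "'n::{finite,linorder} \<Rightarrow> quat"
  assumes "\<And>h. h \<in> K \<Longrightarrow> norm (J h) = 1"
  shows "norm (ordered_prod J K) = 1"
proof -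
  have "norm (prod_list (map J xs)) = 1" if "set xs \<subseteq> K" for xs
    using that assms by (induction xs) (auto simp: norm_mult)
  then show ?thesis by (simp add: ordered_prod_def)
qed

lemma tendsto_ordered_prod:
  fixes J :: "'a \<Rightarrow> 'n::{finite,linorder} \<Rightarrow> quat"
  assumes "\<And>h. h \<in> K \<Longrightarrow> ((\<lambda>x. J x h) \<longlongrightarrow> L h) F"
  shows "((\<lambda>x. ordered_prod (J x) K) \<longlongrightarrow> ordered_prod L K) F"
proof -
  have "((\<lambda>x. prod_list (map (J x) xs)) \<longlongrightarrow> prod_list (map L xs)) F" if "set xs \<subseteq> K" for xs
    using that assms by (induction xs) (auto intro!: tendsto_mult)
  then show ?thesis by (simp add: ordered_prod_def)
qed

definition cvec_of :: "('n::finite) qvec \<Rightarrow> 'n cvec" where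
  "cvec_of x = (\<chi> h. cpoint (x $ h))"

definition stem_parity :: "('n::finite) cvec set \<Rightarrow> ('n cvec \<Rightarrow> 'n set \<Rightarrow> quat) \<Rightarrow> bool" where
  "stem_parity D P \<longleftrightarrow> (\<forall>z\<in>D. \<forall>K h. P (conj_at h z) K = (-1) ^ card (K \<inter> {h}) * P z K)"

text \<open>
  The slice function induced by \<open>P\<close>, with the imaginary parts of the coordinates taken nonnegative.
\<close>
definition slice_of :: "(('n::{finite,linorder}) cvec \<Rightarrow> 'n set \<Rightarrow> quat) \<Rightarrow> 'n qvec \<Rightarrow> quat" where
  "slice_of P x = (\<Sum>K\<in>UNIV. ordered_prod (\<lambda>h. imag_unit_of (x $ h)) K * P (cvec_of x) K)"

definition conj_on :: "'n set \<Rightarrow> ('n::finite) cvec \<Rightarrow> 'n cvec" where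
  "conj_on S z = (\<chi> h. if h \<in> S then cnj (z $ h) else z $ h)"

lemma conj_on_stem:
  assumes inv: "invariant_set D" and par: "stem_parity D P" and z: "z \<in> D"
  shows "conj_on S z \<in> D \<and> P (conj_on S z) K = (-1) ^ card (K \<inter> S) * P z K"
proof -
  have "finite S" by simp
  then show ?thesis
  proof (induction S)
    case empty
    then show ?case using z by (simp add: conj_on_def)
  next
    case (insert h S)
    have eq: "conj_on (insert h S) z = conj_at h (conj_on S z)"
      using insert by (auto simp: conj_on_def conj_at_def vec_eq_iff)
    have "card (K \<inter> insert h S) = card (K \<inter> {h}) + card (K \<inter> S)"
      using insert by (cases "h \<in> K") (auto simp: Int_insert_right)
    then show ?case
      unfolding eq using insert par inv by (simp add: stem_parity_def invariant_set_def power_add mult.assoc)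
  qed
qed

text \<open>
  At a point where the coordinate \<open>z\<^sub>h\<close> is real, conjugation of that coordinate changes nothing, while an odd
  component changes its sign.
\<close>
lemma stem_parity_zero:
  assumes par: "stem_parity D P" and z: "z \<in> D" "h \<in> K" "Im (z $ h) = 0"
  shows "P z K = 0"
proof -
  have "conj_at h z = z" using z by (auto simp: conj_at_def vec_eq_iff complex_eq_iff)
  then have "P z K = - P z K" using par z by (auto simp: stem_parity_def dest!: bspec[of _ _ z] spec[of _ K] spec[of _ h])
  then have "2 *\<^sub>R P z K = 0" by (simp add: scaleR_2 eq_neg_iff_add_eq_0)
  then show ?thesis by simp
qed

lemma slice_point_coord:
  "slice_point J z $ h = of_real (Re (z $ h)) + Im (z $ h) *\<^sub>R J $ h"
  by (simp add: slice_point_def quat_eq_iff)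

lemma cvec_of_slice_point:
  assumes "\<forall>h. J $ h \<in> imag_units"
  shows "cvec_of (slice_point J z) = conj_on {h. Im (z $ h) < 0} z"
  using assms by (auto simp: cvec_of_def conj_on_def vec_eq_iff slice_point_coord cpoint_plane complex_eq_iff)

text \<open>
  A point has several representations \<open>slice_point J z\<close>: a coordinate of \<open>z\<close> may be conjugated together with a
  change of sign of \<open>J\<^sub>h\<close>, and \<open>J\<^sub>h\<close> is arbitrary if \<open>z\<^sub>h\<close> is real.  The first change produces the same sign
  in the ordered product and in the component of the stem function, the second one concerns only vanishing
  terms.
\<close>
lemma slice_of_slice_point:
  assumes inv: "invariant_set D" and par: "stem_parity D P" and z: "z \<in> D" and J: "\<forall>h. J $ h \<in> imag_units"
  shows "slice_of P (slice_point J z) = (\<Sum>K\<in>UNIV. ordered_prod (\<lambda>h. J $ h) K * P z K)"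
  unfolding slice_of_def
proof (rule sum.cong[OF refl])
  fix K :: "'a set"
  \<comment> \<open>the coordinates in which the representation differs from the canonical one by a conjugation\<close>
  define S where "S = {h. Im (z $ h) < 0}"
  have P: "P (conj_on S z) K = (-1) ^ card (K \<inter> S) * P z K"
    using conj_on_stem[OF inv par z] by blast
  show "ordered_prod (\<lambda>h. imag_unit_of (slice_point J z $ h)) K * P (cvec_of (slice_point J z)) K = ordered_prod (\<lambda>h. J $ h) K * P z K"
  proof (cases "\<exists>h\<in>K. Im (z $ h) = 0")
    case True
    then have "P z K = 0" using stem_parity_zero[OF par z] by blast
    then show ?thesis unfolding cvec_of_slice_point[OF J] S_def[symmetric] P by simp
  next
    case False
    have "ordered_prod (\<lambda>h. imag_unit_of (slice_point J z $ h)) K = ordered_prod (\<lambda>h. if h \<in> S then - J $ h else J $ h) K"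
    proof (rule ordered_prod_cong)
      fix h assume "h \<in> K"
      then have "Im (z $ h) \<noteq> 0" using False by auto
      then show "imag_unit_of (slice_point J z $ h) = (if h \<in> S then - J $ h else J $ h)"
        unfolding slice_point_coord using J by (subst imag_unit_of_eqI) (auto simp: S_def sgn_if)
    qed
    also have "\<dots> = (-1) ^ card (K \<inter> S) * ordered_prod (\<lambda>h. J $ h) K" by (rule ordered_prod_signs)
    finally have eq: "ordered_prod (\<lambda>h. imag_unit_of (slice_point J z $ h)) K = (-1) ^ card (K \<inter> S) * ordered_prod (\<lambda>h. J $ h) K" .
    have "(-1) ^ n * x * ((-1) ^ n * y) = x * y" for n and x y :: quat
      by (cases "even n") auto
    then show ?thesis unfolding cvec_of_slice_point[OF J] S_def[symmetric] P eq by simp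
  qed
qed

lemma slice_point_canonical: "slice_point (\<chi> h. imag_unit_of (x $ h)) (cvec_of x) = x"
  by (simp add: vec_eq_iff slice_point_coord cvec_of_def imag_unit_of_mult_norm) (simp add: quat_im_def)

lemma mem_circularization_iff:
  assumes inv: "invariant_set D"
  shows "x \<in> circularization D \<longleftrightarrow> cvec_of x \<in> D"
proof
  assume "x \<in> circularization D"
  then obtain J z where x: "x = slice_point J z" "z \<in> D" "\<forall>h. J $ h \<in> imag_units"
    by (auto simp: circularization_def)
  have "stem_parity D (\<lambda>_ _. 0)" by (simp add: stem_parity_def)
  from conj_on_stem[OF inv this x(2)] show "cvec_of x \<in> D"
    unfolding x(1) cvec_of_slice_point[OF x(3)] by blast
next
  assume "cvec_of x \<in> D"
  then show "x \<in> circularization D"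
    unfolding circularization_def using slice_point_canonical[of x] imag_unit_of_in
    by (intro CollectI exI[of _ "\<chi> h. imag_unit_of (x $ h)"] exI[of _ "cvec_of x"]) auto
qed

lemma continuous_on_cvec_of: "continuous_on UNIV cvec_of"
  unfolding cvec_of_def by (intro continuous_on_vec_lambda continuous_intros)

text \<open>
  The unit \<open>imag_unit_of\<close> is discontinuous at the real axis.  If a coordinate with index in \<open>K\<close> is real at
  the point in question, the term of index \<open>K\<close> nevertheless tends to 0, as the ordered product has norm 1 and the
  component vanishes there.
\<close>
lemma continuous_on_slice_of:
  assumes inv: "invariant_set D" and par: "stem_parity D P" and cont: "\<And>K. continuous_on D (\<lambda>z. P z K)"
  shows "continuous_on (circularization D) (slice_of P)"
  unfolding slice_of_def
proof (rule continuous_on_sum)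
  fix K :: "'a set"
  have Pc: "continuous_on (circularization D) (\<lambda>x. P (cvec_of x) K)"
    by (rule continuous_on_compose2[OF cont continuous_on_subset[OF continuous_on_cvec_of]])
      (auto simp: mem_circularization_iff[OF inv])
  show "continuous_on (circularization D) (\<lambda>x. ordered_prod (\<lambda>h. imag_unit_of (x $ h)) K * P (cvec_of x) K)"
    unfolding continuous_on_def
  proof
    fix x assume x: "x \<in> circularization D"
    have Pt: "((\<lambda>x. P (cvec_of x) K) \<longlongrightarrow> P (cvec_of x) K) (at x within circularization D)"
      using Pc x by (auto simp: continuous_on_def)
    show "((\<lambda>x. ordered_prod (\<lambda>h. imag_unit_of (x $ h)) K * P (cvec_of x) K) \<longlongrightarrow>
        ordered_prod (\<lambda>h. imag_unit_of (x $ h)) K * P (cvec_of x) K) (at x within circularization D)"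
    proof (cases "\<exists>h\<in>K. quat_im (x $ h) = 0")
      case True
      then have P0: "P (cvec_of x) K = 0"
        using stem_parity_zero[OF par, of "cvec_of x"] x by (auto simp: mem_circularization_iff[OF inv] cvec_of_def)
      have eq: "norm (ordered_prod (\<lambda>h. imag_unit_of (x $ h)) K * P (cvec_of x) K) = norm (P (cvec_of x) K)" for x
        using norm_ordered_prod[of K "\<lambda>h. imag_unit_of (x $ h)"] norm_imag_unit[OF imag_unit_of_in]
        by (simp add: norm_mult)
      have "((\<lambda>x. norm (P (cvec_of x) K)) \<longlongrightarrow> 0) (at x within circularization D)"
        using Pt unfolding P0 by (rule tendsto_norm_zero)
      then have "((\<lambda>x. ordered_prod (\<lambda>h. imag_unit_of (x $ h)) K * P (cvec_of x) K) \<longlongrightarrow> 0) (at x within circularization D)"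
        unfolding eq[symmetric] by (rule tendsto_norm_zero_cancel)
      then show ?thesis by (simp add: P0)
    next
      case False
      have "((\<lambda>x. imag_unit_of (x $ h)) \<longlongrightarrow> imag_unit_of (x $ h)) (at x within circularization D)" if "h \<in> K" for h
      proof -
        have ne: "quat_im (x $ h) \<noteq> 0" using False that by auto
        have t: "((\<lambda>x. quat_im (x $ h)) \<longlongrightarrow> quat_im (x $ h)) (at x within circularization D)"
          unfolding quat_im_def
          by (intro tendsto_intros) (use continuous_on_Qre[OF continuous_on_id, of UNIV] in \<open>auto simp: continuous_on_eq_continuous_at isCont_def intro!: isCont_tendsto_compose[of _ Qre] tendsto_intros\<close>)
        have "\<forall>\<^sub>F x in at x within circularization D. quat_im (x $ h) \<noteq> 0"
          by (rule tendsto_imp_eventually_ne[OF t ne])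
        moreover have "((\<lambda>x. sgn (quat_im (x $ h))) \<longlongrightarrow> sgn (quat_im (x $ h))) (at x within circularization D)"
          by (intro tendsto_sgn t ne)
        ultimately show ?thesis
          unfolding imag_unit_of_def using ne by (auto elim!: Lim_transform_eventually eventually_mono)
      qed
      then show ?thesis by (intro tendsto_mult tendsto_ordered_prod Pt)
    qed
  qed
qed

text \<open>
  The sum over all \<open>K\<close> is separated step by step into the sums over those \<open>K\<close> that have a prescribed intersection
  with \<open>A\<close>: adding and subtracting the equations for \<open>J\<close> and for \<open>J\<close> with \<open>J\<^sub>h\<close> replaced by \<open>- J\<^sub>h\<close> isolates the
  \<open>K\<close> without \<open>h\<close> and those with \<open>h\<close>.
\<close>
lemma slice_coefficients_zero:
  fixes G :: "('n::{finite,linorder}) set \<Rightarrow> quat"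
  assumes "\<And>J. (\<And>h. J h \<in> imag_units) \<Longrightarrow> (\<Sum>K\<in>UNIV. ordered_prod J K * G K) = 0"
  shows "G K = 0"
proof -
  have claim: "(\<Sum>K | K \<inter> A = B. ordered_prod J K * G K) = 0"
    if "\<And>h. J h \<in> imag_units" "B \<subseteq> A" for J and A B :: "'n set"
  proof -
    have "finite A" by simp
    then show ?thesis using that
    proof (induction A arbitrary: J B)
      case empty
      then show ?case using assms[of J] by simp
    next
      case (insert h A)
      let ?T = "\<lambda>K. ordered_prod J K * G K"
      define J' where "J' k = (if k \<in> {h} then - J k else J k)" for k
      define B0 where "B0 = B - {h}"
      have B0: "B0 \<subseteq> A" using insert.prems by (auto simp: B0_def)
      define T0 where "T0 = (\<Sum>K | K \<inter> A = B0 \<and> h \<notin> K. ?T K)"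
      define T1 where "T1 = (\<Sum>K | K \<inter> A = B0 \<and> h \<in> K. ?T K)"
      have split: "(\<Sum>K | K \<inter> A = B0. g K) = (\<Sum>K | K \<inter> A = B0 \<and> h \<notin> K. g K) + (\<Sum>K | K \<inter> A = B0 \<and> h \<in> K. g K)" for g :: "'n set \<Rightarrow> quat"
        by (subst sum.union_disjoint[symmetric]) (auto intro!: sum.cong)
      have "T0 + T1 = 0"
        using insert.IH[OF insert.prems(1) B0] unfolding split T0_def T1_def by simp
      moreover have "T0 - T1 = 0"
      proof -
        have "J' k \<in> imag_units" for k using insert.prems(1) imag_units_minus by (auto simp: J'_def)
        from insert.IH[OF this B0]
        have "(\<Sum>K | K \<inter> A = B0 \<and> h \<notin> K. ordered_prod J' K * G K) + (\<Sum>K | K \<inter> A = B0 \<and> h \<in> K. ordered_prod J' K * G K) = 0"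
          unfolding split .
        moreover have "(\<Sum>K | K \<inter> A = B0 \<and> h \<notin> K. ordered_prod J' K * G K) = T0"
          unfolding T0_def J'_def ordered_prod_signs by (rule sum.cong) auto
        moreover have "(\<Sum>K | K \<inter> A = B0 \<and> h \<in> K. ordered_prod J' K * G K) = - T1"
          unfolding T1_def J'_def ordered_prod_signs sum_negf[symmetric] by (rule sum.cong) auto
        ultimately show ?thesis by simp
      qed
      ultimately have "T0 = T1" "2 *\<^sub>R T1 = 0" by (simp_all add: scaleR_2)
      then have T: "T0 = 0" "T1 = 0" by simp_all
      show ?case
      proof (cases "h \<in> B")
        case True
        then have "{K. K \<inter> insert h A = B} = {K. K \<inter> A = B0 \<and> h \<in> K}"
          using insert.hyps insert.prems by (auto simp: B0_def)
        then show ?thesis using T by (simp add: T1_def)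
      next
        case False
        then have "{K. K \<inter> insert h A = B} = {K. K \<inter> A = B0 \<and> h \<notin> K}"
          using insert.hyps insert.prems by (auto simp: B0_def)
        then show ?thesis using T by (simp add: T0_def)
      qed
    qed
  qed
  let ?J = "\<lambda>_::'n. Quat 0 1 0 0"
  have "(\<Sum>L | L \<inter> UNIV = K. ordered_prod ?J L * G L) = 0"
    by (rule claim) (auto simp: imag_unit_i)
  then have "ordered_prod ?J K * G K = 0" by simp
  moreover have "ordered_prod ?J K \<noteq> 0"
    using norm_ordered_prod[of K ?J] norm_imag_unit[OF imag_unit_i] by (metis norm_zero zero_neq_one)
  ultimately show ?thesis by simp
qed

lemma inducesD:
  "induces D F f \<Longrightarrow> z \<in> D \<Longrightarrow> \<forall>h. J $ h \<in> imag_units \<Longrightarrow>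
    f (slice_point J z) = (\<Sum>K\<in>UNIV. ordered_prod (\<lambda>h. J $ h) K * F z $ K)"
  by (simp add: induces_def)

lemma stem_of_eq:
  assumes F: "stem_function D F" "induces D F f" and z: "z \<in> D"
  shows "stem_of D f z = F z"
proof -
  have F': "stem_function D (stem_of D f) \<and> induces D (stem_of D f) f"
    unfolding stem_of_def by (rule someI[of _ F]) (use F in simp)
  have "stem_of D f z $ K - F z $ K = 0" for K
  proof (rule slice_coefficients_zero)
    fix J :: "'a \<Rightarrow> quat" assume J: "\<And>h. J h \<in> imag_units"
    define J' where "J' = (\<chi> h. J h)"
    have J': "\<forall>h. J' $ h \<in> imag_units" "(\<lambda>h. J' $ h) = J" using J by (simp_all add: J'_def)
    have "f (slice_point J' z) = (\<Sum>K\<in>UNIV. ordered_prod J K * F z $ K)"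
      using inducesD[OF F(2) z J'(1)] by (simp only: J'(2))
    moreover have "f (slice_point J' z) = (\<Sum>K\<in>UNIV. ordered_prod J K * stem_of D f z $ K)"
      using inducesD[OF conjunct2[OF F'] z J'(1)] by (simp only: J'(2))
    ultimately show "(\<Sum>K\<in>UNIV. ordered_prod J K * (stem_of D f z $ K - F z $ K)) = 0"
      by (simp add: right_diff_distrib sum_subtractf)
  qed
  then show ?thesis by (simp add: vec_eq_iff)
qed

lemma stem_component_nth:
  "stem_component H F z $ K = inverse (\<Prod>h\<in>H. Im (z $ h)) *\<^sub>R (if K \<inter> H = {} then F z $ (K \<union> H) else 0)"
proof -
  have "(\<Sum>L\<in>Pow (- H). axis L (F z $ (L \<union> H))) $ K = (\<Sum>L\<in>Pow (- H). if L = K then F z $ (L \<union> H) else 0)"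
    by (simp add: axis_def if_distrib cong: if_cong)
  also have "\<dots> = (if K \<inter> H = {} then F z $ (K \<union> H) else 0)"
    by (simp add: disjoint_eq_subset_Compl)
  finally show ?thesis by (simp add: stem_component_def)
qed

section \<open>Division of stem functions by an imaginary part\<close>

definition vec_upd :: "('a::zero, 'n::finite) vec \<Rightarrow> 'n \<Rightarrow> 'a \<Rightarrow> ('a, 'n) vec" where
  "vec_upd z h w = (\<chi> k. if k = h then w else z $ k)"

lemma vec_upd_nth [simp]: "vec_upd z h w $ k = (if k = h then w else z $ k)"
  by (simp add: vec_upd_def)

lemma vec_upd_same [simp]: "vec_upd z h (z $ h) = z"
  by (simp add: vec_eq_iff)

lemma continuous_on_vec_upd [continuous_intros]:
  fixes f :: "'x::topological_space \<Rightarrow> ('a::{zero,topological_space}, 'n::finite) vec"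
  assumes "continuous_on S f" "continuous_on S g"
  shows "continuous_on S (\<lambda>x. vec_upd (f x) h (g x))"
  unfolding vec_upd_def
proof (rule continuous_on_vec_lambda)
  fix k show "continuous_on S (\<lambda>x. if k = h then g x else f x $ k)"
    using assms by (cases "k = h") (auto intro!: continuous_intros)
qed

lemma vec_upd_eq_axis: "vec_upd z h w = z + axis h (w - z $ h)"
  for z :: "('a::ab_group_add, 'n::finite) vec"
  by (simp add: vec_eq_iff axis_def)

lemma dist_vec_upd: "dist (vec_upd z h w) (vec_upd z h w') = dist w w'"
  for z :: "('a::real_normed_vector, 'n::finite) vec"
proof -
  have "(dist (vec_upd z h w $ k) (vec_upd z h w' $ k))\<^sup>2 = (if k = h then (dist w w')\<^sup>2 else 0)" for k
    by simp
  then show ?thesis by (simp only: dist_vec_def L2_set_def) simp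
qed

lemma dist_vec_upd_same: "dist (vec_upd z h w) (vec_upd z' h w) \<le> dist z z'"
  for z :: "('a::real_normed_vector, 'n::finite) vec"
  unfolding dist_vec_def by (rule L2_set_mono) (auto simp: dist_norm)

lemma conj_at_eq_vec_upd: "conj_at h z = vec_upd z h (cnj (z $ h))"
  by (simp add: conj_at_def vec_eq_iff)

lemma continuous_on_conj_at: "continuous_on S (conj_at h)"
  unfolding conj_at_eq_vec_upd by (intro continuous_intros)

lemma open_vec_upd_vimage:
  fixes z :: "('n::finite) cvec"
  shows "open D \<Longrightarrow> open {w. vec_upd z h w \<in> D}"
  by (rule open_vimage[of D "vec_upd z h", unfolded vimage_def]) (assumption, intro continuous_intros)

text \<open>
  The approximating points differ from \<open>z\<close> only in the coordinates in \<open>H\<close>; this is essential for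
  \<open>holomorphic_pair_limit\<close>, where another coordinate runs over a disc.
\<close>
lemma nonreal_sequence:
  fixes z :: "('n::finite) cvec"
  assumes D: "open D" and z: "z \<in> D"
  obtains y where "y \<longlonglongrightarrow> z" "\<And>n. y n \<in> nonreal_part H D" "\<And>n k. k \<notin> H \<Longrightarrow> y n $ k = z $ k" "\<And>n k. Re (y n $ k) = Re (z $ k)"
proof -
  \<comment> \<open>for small \<open>t > 0\<close>, a point of \<open>D\<close> whose coordinates in \<open>H\<close> are not real\<close>
  define x where "x t = (\<chi> k. if k \<in> H \<and> Im (z $ k) = 0 then z $ k + \<i> * of_real t else z $ k)" for t :: real
  have "isCont x 0"
  proof -
    have "continuous_on UNIV x"
      unfolding x_def
    proof (rule continuous_on_vec_lambda)
      fix k show "continuous_on UNIV (\<lambda>t. if k \<in> H \<and> Im (z $ k) = 0 then z $ k + \<i> * of_real t else z $ k)"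
        by (cases "k \<in> H \<and> Im (z $ k) = 0") (auto intro!: continuous_intros)
    qed
    then show ?thesis by (simp add: continuous_on_eq_continuous_at)
  qed
  moreover have x0: "x 0 = z" by (simp add: x_def vec_eq_iff)
  ultimately have lim: "(\<lambda>n. x (inverse (real (Suc n)))) \<longlonglongrightarrow> z"
    using isCont_tendsto_compose[OF _ LIMSEQ_inverse_real_of_nat] by metis
  then have "\<forall>\<^sub>F n in sequentially. x (inverse (real (Suc n))) \<in> D"
    using D z topological_tendstoD by blast
  then obtain N where N: "\<And>n. n \<ge> N \<Longrightarrow> x (inverse (real (Suc n))) \<in> D"
    by (auto simp: eventually_sequentially)
  show ?thesis
  proof (rule that[of "\<lambda>n. x (inverse (real (Suc (n + N))))"])
    show "(\<lambda>n. x (inverse (real (Suc (n + N))))) \<longlonglongrightarrow> z"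
      using LIMSEQ_ignore_initial_segment[OF lim, of N] by simp
    show "x (inverse (real (Suc (n + N)))) \<in> nonreal_part H D" for n
      using N[of "n + N"] by (auto simp: nonreal_part_def x_def simp del: of_nat_Suc)
  qed (auto simp: x_def)
qed

lemma eq_if_eq_on_nonreal_part:
  fixes f g :: "('n::finite) cvec \<Rightarrow> 'a::t2_space"
  assumes D: "open D" and f: "continuous_on D f" and g: "continuous_on D g"
    and eq: "\<And>z. z \<in> nonreal_part H D \<Longrightarrow> f z = g z" and z: "z \<in> D"
  shows "f z = g z"
proof -
  obtain y where y: "y \<longlonglongrightarrow> z" "\<And>n. y n \<in> nonreal_part H D"
    using nonreal_sequence[OF D z] by metis
  have yD: "\<forall>\<^sub>F n in sequentially. y n \<in> D" using y(2) by (auto simp: nonreal_part_def)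
  have "(\<lambda>n. f (y n)) \<longlonglongrightarrow> f z" by (rule continuous_on_tendsto_compose[OF f y(1) z yD])
  moreover have "(\<lambda>n. f (y n)) \<longlonglongrightarrow> g z"
    using continuous_on_tendsto_compose[OF g y(1) z yD] eq y(2) by simp
  ultimately show ?thesis by (rule LIMSEQ_unique)
qed

text \<open>
  Local continuous extensions agree where their domains overlap, because the set on which \<open>\<phi>\<close> is given is dense.
\<close>
lemma continuous_extension_from_nonreal_part:
  fixes \<phi> :: "('n::finite) cvec \<Rightarrow> 'a::t2_space"
  assumes D: "open D"
    and loc: "\<And>z. z \<in> D \<Longrightarrow> \<exists>N c. open N \<and> z \<in> N \<and> N \<subseteq> D \<and> continuous_on N c \<and> (\<forall>y\<in>nonreal_part H N. c y = \<phi> y)"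
  obtains V where "continuous_on D V" "\<And>z. z \<in> nonreal_part H D \<Longrightarrow> V z = \<phi> z"
proof -
  from loc obtain N c where Nc: "\<And>z. z \<in> D \<Longrightarrow> open (N z) \<and> z \<in> N z \<and> N z \<subseteq> D \<and> continuous_on (N z) (c z) \<and> (\<forall>y\<in>nonreal_part H (N z). c z y = \<phi> y)"
    by metis
  define V where "V z = c z z" for z
  have V: "V y = c z y" if "z \<in> D" "y \<in> N z" for y z
  proof -
    have y: "y \<in> D" using Nc[OF that(1)] that(2) by auto
    have "c y y = c z y"
    proof (rule eq_if_eq_on_nonreal_part[where D = "N y \<inter> N z" and H = H and f = "c y" and g = "c z"])
      show "open (N y \<inter> N z)" using Nc y that by (intro open_Int) auto
      show "continuous_on (N y \<inter> N z) (c y)" "continuous_on (N y \<inter> N z) (c z)"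
        using Nc y that by (auto intro: continuous_on_subset)
      show "c y x = c z x" if "x \<in> nonreal_part H (N y \<inter> N z)" for x
        using that Nc[OF y] Nc[OF \<open>z \<in> D\<close>] by (auto simp: nonreal_part_def)
      show "y \<in> N y \<inter> N z" using Nc y that by auto
    qed
    then show ?thesis by (simp add: V_def)
  qed
  show ?thesis
  proof (rule that[of V])
    have "isCont V z" if "z \<in> D" for z
    proof -
      have "continuous_on (N z) V"
        using Nc[OF that] V[OF that] by (metis (no_types, lifting) continuous_on_cong)
      then show ?thesis using Nc[OF that] by (simp add: continuous_on_eq_continuous_at)
    qed
    then show "continuous_on D V" by (simp add: continuous_at_imp_continuous_on)
    show "V z = \<phi> z" if "z \<in> nonreal_part H D" for z
      using that Nc[of z] by (auto simp: V_def nonreal_part_def)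
  qed
qed

text \<open>
  Holomorphy of \<open>A + i B\<close> in the coordinate \<open>z\<^sub>h\<close> alone, the other coordinates being those of \<open>z\<close>.  The
  Cauchy--Riemann equations that express \<open>dbar h F = 0\<close> couple exactly the components of a stem function with
  indices \<open>K\<close> and \<open>K \<union> {h}\<close>.
\<close>
definition holomorphic_pair :: "'n \<Rightarrow> (('n::finite) cvec \<Rightarrow> quat) \<Rightarrow> ('n cvec \<Rightarrow> quat) \<Rightarrow> 'n cvec set \<Rightarrow> 'n cvec \<Rightarrow> bool" where
  "holomorphic_pair h A B D z \<longleftrightarrow>
     (\<forall>c. (\<lambda>w. Complex (A (vec_upd z h w) \<bullet> c) (B (vec_upd z h w) \<bullet> c)) holomorphic_on {w. vec_upd z h w \<in> D})"

text \<open>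
  At a point with some real coordinate in \<open>H\<close>, the function of \<open>z\<^sub>k\<close> is a locally uniform limit of
  the corresponding functions at nearby points without such coordinates, and Weierstrass' theorem applies.  Uniformity
  follows from the joint continuity on a compact ball.
\<close>
lemma holomorphic_pair_limit:
  fixes A B :: "('n::finite) cvec \<Rightarrow> quat"
  assumes D: "open D" and A: "continuous_on D A" and B: "continuous_on D B" and kH: "k \<notin> H"
    and holo: "\<And>z. z \<in> nonreal_part H D \<Longrightarrow> holomorphic_pair k A B D z" and z: "z \<in> D"
  shows "holomorphic_pair k A B D z"
  unfolding holomorphic_pair_def
proof
  fix c
  define \<Phi> where "\<Phi> z = Complex (A z \<bullet> c) (B z \<bullet> c)" for z
  have \<Phi>: "continuous_on D \<Phi>"
    unfolding \<Phi>_def Complex_eq by (intro continuous_intros A B)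
  let ?S = "{w. vec_upd z k w \<in> D}"
  have "(\<lambda>w. \<Phi> (vec_upd z k w)) field_differentiable at w0" if w0: "w0 \<in> ?S" for w0
  proof -
    obtain e where e: "e > 0" "cball (vec_upd z k w0) e \<subseteq> D"
      using D w0 open_contains_cball by blast
    have uc: "uniformly_continuous_on (cball (vec_upd z k w0) e) \<Phi>"
      by (rule compact_uniformly_continuous) (use \<Phi> e continuous_on_subset in auto)
    have "vec_upd z k w0 \<in> D" using w0 by simp
    then obtain y where y: "y \<longlonglongrightarrow> vec_upd z k w0" "\<And>n. y n \<in> nonreal_part H D"
       "\<And>n k'. k' \<notin> H \<Longrightarrow> y n $ k' = vec_upd z k w0 $ k'"
      using nonreal_sequence[OF D] by metis
    have close: "\<forall>\<^sub>F n in sequentially. dist (y n) (vec_upd z k w0) < d" if "0 < d" for d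
      using y(1) that by (auto simp: tendsto_iff)
    have upd_w0: "vec_upd (vec_upd z k w0) k w = vec_upd z k w" for w
      by (simp add: vec_eq_iff)
    have in_cball: "vec_upd x k w \<in> cball (vec_upd z k w0) e"
      if "w \<in> cball w0 (e/2)" "dist x (vec_upd z k w0) < e/2" for x w
    proof -
      have "dist (vec_upd z k w0) (vec_upd x k w) \<le> dist (vec_upd z k w0) (vec_upd z k w) + dist (vec_upd (vec_upd z k w0) k w) (vec_upd x k w)"
        unfolding upd_w0 by (rule dist_triangle)
      also have "\<dots> \<le> e/2 + e/2"
        using that dist_vec_upd_same[of "vec_upd z k w0" k w x]
        by (intro add_mono) (auto simp: dist_vec_upd dist_commute)
      finally show ?thesis by simp
    qed
    have "(\<lambda>w. \<Phi> (vec_upd z k w)) holomorphic_on ball w0 (e/2)"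
    proof (rule holomorphic_uniform_limit[where f = "\<lambda>n w. \<Phi> (vec_upd (y n) k w)" and F = sequentially])
      show "\<forall>\<^sub>F n in sequentially. continuous_on (cball w0 (e/2)) (\<lambda>w. \<Phi> (vec_upd (y n) k w)) \<and> (\<lambda>w. \<Phi> (vec_upd (y n) k w)) holomorphic_on ball w0 (e/2)"
        using close[of "e/2"]
      proof (rule eventually_mono)
        fix n assume n: "dist (y n) (vec_upd z k w0) < e/2"
        have "cball w0 (e/2) \<subseteq> {w. vec_upd (y n) k w \<in> D}"
          using in_cball[OF _ n] e(2) by blast
        moreover have h: "(\<lambda>w. \<Phi> (vec_upd (y n) k w)) holomorphic_on {w. vec_upd (y n) k w \<in> D}"
          using holo[OF y(2)] by (simp add: holomorphic_pair_def \<Phi>_def)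
        ultimately have "(\<lambda>w. \<Phi> (vec_upd (y n) k w)) holomorphic_on cball w0 (e/2)"
          using holomorphic_on_subset by blast
        then show "continuous_on (cball w0 (e/2)) (\<lambda>w. \<Phi> (vec_upd (y n) k w)) \<and> (\<lambda>w. \<Phi> (vec_upd (y n) k w)) holomorphic_on ball w0 (e/2)"
          using holomorphic_on_imp_continuous_on holomorphic_on_subset ball_subset_cball by blast
      qed (use e in simp)
      show "uniform_limit (cball w0 (e/2)) (\<lambda>n w. \<Phi> (vec_upd (y n) k w)) (\<lambda>w. \<Phi> (vec_upd z k w)) sequentially"
      proof (rule uniform_limitI)
        fix \<epsilon> :: real assume "0 < \<epsilon>"
        then obtain d where d: "d > 0" "\<And>x x'. x \<in> cball (vec_upd z k w0) e \<Longrightarrow> x' \<in> cball (vec_upd z k w0) e \<Longrightarrow> dist x' x < d \<Longrightarrow> dist (\<Phi> x') (\<Phi> x) < \<epsilon>"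
          using uc unfolding uniformly_continuous_on_def by metis
        have "\<forall>\<^sub>F n in sequentially. dist (y n) (vec_upd z k w0) < min d (e/2)"
          using close[of "min d (e/2)"] d e by simp
        then show "\<forall>\<^sub>F n in sequentially. \<forall>w\<in>cball w0 (e/2). dist (\<Phi> (vec_upd (y n) k w)) (\<Phi> (vec_upd z k w)) < \<epsilon>"
        proof (rule eventually_mono, intro ballI)
          fix n w assume n: "dist (y n) (vec_upd z k w0) < min d (e/2)" and w: "w \<in> cball w0 (e/2)"
          show "dist (\<Phi> (vec_upd (y n) k w)) (\<Phi> (vec_upd z k w)) < \<epsilon>"
          proof (rule d(2))
            show "vec_upd z k w \<in> cball (vec_upd z k w0) e"
              using in_cball[OF w, of "vec_upd z k w0"] e(1) by (simp add: upd_w0)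
            show "vec_upd (y n) k w \<in> cball (vec_upd z k w0) e"
              using in_cball[OF w, of "y n"] n by simp
            show "dist (vec_upd (y n) k w) (vec_upd z k w) < d"
              using dist_vec_upd_same[of "y n" k w "vec_upd z k w0"] n by (simp add: upd_w0)
          qed
        qed
      qed
    qed auto
    then show ?thesis by (rule holomorphic_on_imp_differentiable_at) (use e(1) in auto)
  qed
  then show "(\<lambda>w. Complex (A (vec_upd z k w) \<bullet> c) (B (vec_upd z k w) \<bullet> c)) holomorphic_on ?S"
    unfolding \<Phi>_def by (simp add: holomorphic_on_def field_differentiable_at_within)
qed

text \<open>
  Near a point whose coordinate of index \<open>h\<close> is a real number \<open>\<alpha>\<close>, both \<open>w = z\<^sub>h\<close> and its conjugate lie inside a
  circle about \<open>\<alpha>\<close>.  Subtracting Cauchy's formulas for \<open>w\<close> and for the conjugate \<open>w\<^sup>*\<close>, and using that \<open>A\<close> is even and \<open>P\<close> is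
  odd, one obtains \<open>P / Im w\<close> as the integral of \<open>G(\<zeta>) / ((\<zeta> - w) (\<zeta> - w\<^sup>*))\<close> divided by \<open>2 pi i\<close>.
  This integral is continuous in \<open>z\<close>, also where \<open>Im w = 0\<close>.
\<close>
lemma division_by_imaginary_part_local:
  fixes A P :: "('n::finite) cvec \<Rightarrow> quat"
  assumes D: "open D" and A: "continuous_on D A" and P: "continuous_on D P"
    and holo: "\<And>z. z \<in> D \<Longrightarrow> holomorphic_pair h A P D z"
    and par: "\<And>z. z \<in> D \<Longrightarrow> A (conj_at h z) = A z \<and> P (conj_at h z) = - P z"
    and z0: "z0 \<in> D"
  shows "\<exists>N c. open N \<and> z0 \<in> N \<and> N \<subseteq> D \<and> continuous_on N c \<and> (\<forall>z\<in>nonreal_part {h} N. c z = P z /\<^sub>R Im (z $ h))"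
proof (cases "Im (z0 $ h) = 0")
  case False
  define N where "N = D \<inter> {z. Im (z $ h) \<noteq> 0}"
  have "open {z::'n cvec. Im (z $ h) \<noteq> 0}"
    by (intro open_Collect_neq continuous_intros)
  then have "open N" using D by (auto simp: N_def)
  moreover have "continuous_on N (\<lambda>z. P z /\<^sub>R Im (z $ h))"
    by (intro continuous_intros continuous_on_subset[OF P]) (auto simp: N_def)
  ultimately show ?thesis using False z0 by (intro exI[of _ N] exI[of _ "\<lambda>z. P z /\<^sub>R Im (z $ h)"]) (auto simp: N_def)
next
  case True
  define \<alpha> where "\<alpha> = z0 $ h"
  have \<alpha>: "cnj \<alpha> = \<alpha>" using True by (simp add: \<alpha>_def complex_eq_iff)
  obtain e where e: "e > 0" "cball z0 e \<subseteq> D" using D z0 open_contains_cball by blast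
  define \<rho> where "\<rho> = e / 2"
  have \<rho>: "0 < \<rho>" using e by (simp add: \<rho>_def)
  define N where "N = ball z0 \<rho>"
  have ND: "vec_upd z h \<zeta> \<in> D" if "z \<in> N" "\<zeta> \<in> cball \<alpha> \<rho>" for z \<zeta>
  proof -
    have "dist z0 (vec_upd z h \<zeta>) \<le> dist (vec_upd z0 h \<alpha>) (vec_upd z0 h \<zeta>) + dist (vec_upd z0 h \<zeta>) (vec_upd z h \<zeta>)"
      using dist_triangle[of "vec_upd z0 h \<alpha>" "vec_upd z h \<zeta>" "vec_upd z0 h \<zeta>"] by (simp add: \<alpha>_def)
    also have "\<dots> \<le> \<rho> + \<rho>"
      using that dist_vec_upd_same[of z0 h \<zeta> z] by (intro add_mono) (auto simp: dist_vec_upd N_def)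
    finally show ?thesis using e(2) by (auto simp: \<rho>_def)
  qed
  have zh: "z $ h \<in> ball \<alpha> \<rho>" "cnj (z $ h) \<in> ball \<alpha> \<rho>" if "z \<in> N" for z
  proof -
    show *: "z $ h \<in> ball \<alpha> \<rho>" using that dist_vec_nth_le[of z0 h z] by (auto simp: N_def \<alpha>_def)
    have "norm (cnj (\<alpha> - z $ h)) = norm (\<alpha> - z $ h)" by (rule complex_mod_cnj)
    then show "cnj (z $ h) \<in> ball \<alpha> \<rho>" using * by (simp add: dist_norm \<alpha>)
  qed
  define G where "G c z \<zeta> = Complex (A (vec_upd z h \<zeta>) \<bullet> c) (P (vec_upd z h \<zeta>) \<bullet> c)" for c z \<zeta>
  define \<gamma> where "\<gamma> x = \<alpha> + of_real \<rho> * exp (2 * of_real pi * \<i> * of_real x)" for x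
  define I where "I c z = contour_integral (circlepath \<alpha> \<rho>) (\<lambda>\<zeta>. G c z \<zeta> / ((\<zeta> - z $ h) * (\<zeta> - cnj (z $ h))))" for c z
  \<comment> \<open>the inner product with \<open>c\<close> of the local extension, by Cauchy's formula\<close>
  define T where "T c z = Re (I c z / (2 * of_real pi * \<i>))" for c z
  have NsD: "N \<subseteq> D" using e by (auto simp: N_def \<rho>_def)
  have T: "T c z = (P z \<bullet> c) / Im (z $ h)" if z: "z \<in> N" "Im (z $ h) \<noteq> 0" for c z
  proof -
    have zD: "z \<in> D" using z NsD by auto
    have "G c z holomorphic_on {w. vec_upd z h w \<in> D}"
      using holo[OF zD] by (simp add: holomorphic_pair_def G_def[abs_def])
    then have Gh: "G c z holomorphic_on cball \<alpha> \<rho>"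
      by (rule holomorphic_on_subset) (use ND[OF z(1)] in auto)
    have n: "norm (z $ h - \<alpha>) < \<rho>" "norm (cnj (z $ h) - \<alpha>) < \<rho>"
      using zh[OF z(1)] by (auto simp: dist_norm norm_minus_commute)
    let ?w = "z $ h"
    have c1: "((\<lambda>u. G c z u / (u - ?w)) has_contour_integral (2 * of_real pi * \<i> * G c z ?w)) (circlepath \<alpha> \<rho>)"
      by (rule Cauchy_integral_circlepath_simple[OF Gh n(1)])
    have c2: "((\<lambda>u. G c z u / (u - cnj ?w)) has_contour_integral (2 * of_real pi * \<i> * G c z (cnj ?w))) (circlepath \<alpha> \<rho>)"
      by (rule Cauchy_integral_circlepath_simple[OF Gh n(2)])
    have "((\<lambda>u. (1 / (?w - cnj ?w)) * (G c z u / (u - ?w) - G c z u / (u - cnj ?w))) has_contour_integral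
        (1 / (?w - cnj ?w)) * (2 * of_real pi * \<i> * G c z ?w - 2 * of_real pi * \<i> * G c z (cnj ?w))) (circlepath \<alpha> \<rho>)"
      by (intro has_contour_integral_lmul has_contour_integral_diff c1 c2)
    then have "((\<lambda>u. G c z u / ((u - ?w) * (u - cnj ?w))) has_contour_integral
        (1 / (?w - cnj ?w)) * (2 * of_real pi * \<i> * G c z ?w - 2 * of_real pi * \<i> * G c z (cnj ?w))) (circlepath \<alpha> \<rho>)"
    proof (rule has_contour_integral_eq)
      fix u assume "u \<in> path_image (circlepath \<alpha> \<rho>)"
      then have u: "dist \<alpha> u = \<rho>" using \<rho> by simp
      have ne: "u - ?w \<noteq> 0" "u - cnj ?w \<noteq> 0" using zh[OF z(1)] u by auto
      have w: "?w - cnj ?w \<noteq> 0" using z(2) by (simp add: complex_eq_iff)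
      show "(1 / (?w - cnj ?w)) * (G c z u / (u - ?w) - G c z u / (u - cnj ?w)) = G c z u / ((u - ?w) * (u - cnj ?w))"
      proof -
        have "G c z u / (u - ?w) - G c z u / (u - cnj ?w) = G c z u * (?w - cnj ?w) / ((u - ?w) * (u - cnj ?w))"
          using ne by (simp add: diff_frac_eq algebra_simps)
        then show ?thesis using w by simp
      qed
    qed
    then have "I c z = (1 / (?w - cnj ?w)) * (2 * of_real pi * \<i> * (G c z ?w - G c z (cnj ?w)))"
      unfolding I_def by (simp add: contour_integral_unique right_diff_distrib)
    moreover have "G c z ?w - G c z (cnj ?w) = 2 * \<i> * of_real (P z \<bullet> c)"
      using par[OF zD] by (simp add: G_def complex_eq_iff flip: conj_at_eq_vec_upd)
    moreover have "?w - cnj ?w = 2 * \<i> * of_real (Im ?w)" by (simp add: complex_eq_iff)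
    ultimately have "I c z / (2 * of_real pi * \<i>) = of_real ((P z \<bullet> c) / Im ?w)"
      using z(2) by (simp only:) (simp add: field_simps)
    then show ?thesis unfolding T_def by (simp only: Re_complex_of_real)
  qed
  have Tc: "continuous_on N (T c)" for c
  proof -
    have Gc: "continuous_on (N \<times> cball \<alpha> \<rho>) (\<lambda>p. G c (fst p) (snd p))"
    proof -
      have "(\<lambda>p. vec_upd (fst p) h (snd p)) ` (N \<times> cball \<alpha> \<rho>) \<subseteq> D" using ND by auto
      then show ?thesis unfolding G_def Complex_eq
        by (intro continuous_intros continuous_on_compose2[OF A] continuous_on_compose2[OF P])
    qed
    have \<gamma>: "\<gamma> x \<in> sphere \<alpha> \<rho>" for x
      using \<rho> by (simp add: \<gamma>_def dist_norm norm_mult norm_exp_eq_Re)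
    have eq: "I c z = integral (cbox 0 1) (\<lambda>x. G c z (\<gamma> x) / ((\<gamma> x - z $ h) * (\<gamma> x - cnj (z $ h))) * (2 * of_real pi * \<i> * of_real \<rho> * exp (2 * of_real pi * \<i> * of_real x)))" for z
      unfolding I_def contour_integral_integral vector_derivative_circlepath
      by (simp add: circlepath \<gamma>_def)
    have "continuous_on N (I c)"
      unfolding eq
    proof (rule integral_continuous_on_param)
      have "continuous_on (N \<times> cbox 0 1) (\<lambda>p. G c (fst p) (\<gamma> (snd p)))"
        by (rule continuous_on_compose2[OF Gc, of _ "\<lambda>p. (fst p, \<gamma> (snd p))", simplified])
          (use \<gamma> in \<open>auto simp: \<gamma>_def intro!: continuous_intros\<close>)
      moreover have "\<gamma> x \<noteq> z $ h" "\<gamma> x \<noteq> cnj (z $ h)" if "z \<in> N" for x z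
        using zh[OF that] \<gamma>[of x] by auto
      ultimately show "continuous_on (N \<times> cbox 0 1) (\<lambda>(z, x). G c z (\<gamma> x) / ((\<gamma> x - z $ h) * (\<gamma> x - cnj (z $ h))) * (2 * of_real pi * \<i> * of_real \<rho> * exp (2 * of_real pi * \<i> * of_real x)))"
        unfolding case_prod_beta
        by (intro continuous_on_mult continuous_on_divide) (auto simp: \<gamma>_def intro!: continuous_intros)
    qed
    then show ?thesis unfolding T_def by (intro continuous_intros) auto
  qed
  show ?thesis
  proof (intro exI conjI)
    show "open N" "z0 \<in> N" "N \<subseteq> D" using \<rho> NsD by (auto simp: N_def)
    show "continuous_on N (\<lambda>z. \<Sum>b\<in>Basis. T b z *\<^sub>R b)"
      by (intro continuous_intros Tc)
    show "\<forall>z\<in>nonreal_part {h} N. (\<Sum>b\<in>Basis. T b z *\<^sub>R b) = P z /\<^sub>R Im (z $ h)"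
    proof
      fix z assume "z \<in> nonreal_part {h} N"
      then have z: "z \<in> N" "Im (z $ h) \<noteq> 0" by (auto simp: nonreal_part_def)
      have "(\<Sum>b\<in>Basis. T b z *\<^sub>R b) = (\<Sum>b\<in>Basis. ((P z /\<^sub>R Im (z $ h)) \<bullet> b) *\<^sub>R b)"
        by (intro sum.cong refl) (simp add: T[OF z] divide_inverse mult.commute)
      also have "\<dots> = P z /\<^sub>R Im (z $ h)" by (rule euclidean_representation)
      finally show "(\<Sum>b\<in>Basis. T b z *\<^sub>R b) = P z /\<^sub>R Im (z $ h)" .
    qed
  qed
qed

lemma division_by_imaginary_part:
  fixes A P :: "('n::finite) cvec \<Rightarrow> quat"
  assumes D: "open D" and A: "continuous_on D A" and P: "continuous_on D P"
    and holo: "\<And>z. z \<in> D \<Longrightarrow> holomorphic_pair h A P D z"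
    and par: "\<And>z. z \<in> D \<Longrightarrow> A (conj_at h z) = A z \<and> P (conj_at h z) = - P z"
  obtains V where "continuous_on D V" "\<And>z. z \<in> D \<Longrightarrow> Im (z $ h) *\<^sub>R V z = P z"
proof -
  obtain V where V: "continuous_on D V" "\<And>z. z \<in> nonreal_part {h} D \<Longrightarrow> V z = P z /\<^sub>R Im (z $ h)"
    using continuous_extension_from_nonreal_part[OF D division_by_imaginary_part_local[OF D A P holo par]] by blast
  have "Im (z $ h) *\<^sub>R V z = P z" if "z \<in> D" for z
    by (rule eq_if_eq_on_nonreal_part[OF D _ P, of _ "{h}"])
      (use V that in \<open>auto intro!: continuous_intros simp: nonreal_part_def\<close>)
  with V(1) show ?thesis by (rule that)
qed

section \<open>Continuous extension of the spherical components\<close>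

lemma stem_J_nth: "stem_J h v $ K = (if h \<in> K then v $ (K - {h}) else - v $ insert h K)"
proof -
  have eq: "K = sym_diff L {h} \<longleftrightarrow> L = sym_diff K {h}" for L by auto
  have "stem_J h v $ K = (\<Sum>L\<in>UNIV. if L = sym_diff K {h} then (-1) ^ card (L \<inter> {h}) * v $ L else 0)"
    unfolding stem_J_def by (simp add: axis_def eq cong: if_cong)
  also have "\<dots> = (-1) ^ card (sym_diff K {h} \<inter> {h}) * v $ sym_diff K {h}" by simp
  also have "\<dots> = (if h \<in> K then v $ (K - {h}) else - v $ insert h K)"
    by (auto simp: Un_commute insert_def[symmetric] intro!: arg_cong[where f = "\<lambda>K. v $ K"])
  finally show ?thesis .
qed

text \<open>
  The components of \<open>dbar h F = 0\<close> with indices \<open>K\<close> and \<open>K \<union> {h}\<close> are the Cauchy--Riemann equations for this pair.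
\<close>
lemma holomorphic_stem_pair:
  fixes F :: "('n::finite) cvec \<Rightarrow> 'n stem"
  assumes D: "open D" and F: "holomorphic_stem D F" and h: "h \<notin> K"
  shows "holomorphic_pair h (\<lambda>z. F z $ K) (\<lambda>z. F z $ insert h K) D z"
  unfolding holomorphic_pair_def
proof
  fix c
  let ?S = "{w. vec_upd z h w \<in> D}"
  obtain F' :: "'n cvec \<Rightarrow> 'n cvec \<Rightarrow>\<^sub>L 'n stem"
    where F': "\<And>z. z \<in> D \<Longrightarrow> (F has_derivative blinfun_apply (F' z)) (at z)"
    using F by (auto simp: holomorphic_stem_def C1_on_def)
  have "(\<lambda>w. Complex (F (vec_upd z h w) $ K \<bullet> c) (F (vec_upd z h w) $ insert h K \<bullet> c)) field_differentiable at w"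
    if w: "w \<in> ?S" for w
  proof -
    define y where "y = vec_upd z h w"
    have y: "y \<in> D" using w by (simp add: y_def)
    have pd: "partial_deriv F v y = F' y v" for v
    proof -
      have "((\<lambda>t. y + t *\<^sub>R v) has_derivative (\<lambda>t. t *\<^sub>R v)) (at 0)"
        by (auto intro!: derivative_eq_intros)
      from has_derivative_compose[OF this, of F "F' y"] F'[OF y]
      have "((\<lambda>t. F (y + t *\<^sub>R v)) has_derivative (\<lambda>t. F' y (t *\<^sub>R v))) (at 0)" by simp
      then show ?thesis
        unfolding partial_deriv_def
        by (intro vector_derivative_at) (simp add: has_vector_derivative_def blinfun.scaleR_right)
    qed
    define d1 where "d1 = F' y (axis h 1)"
    define d2 where "d2 = F' y (axis h \<i>)"
    have "d1 + stem_J h d2 = 0"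
    proof -
      have "dbar h F y = 0" using F y by (simp add: holomorphic_stem_def)
      then show ?thesis by (simp add: dbar_def pd d1_def d2_def)
    qed
    then have "(d1 + stem_J h d2) $ L = 0" for L by simp
    from this[of K] this[of "insert h K"] have CR: "d1 $ K = d2 $ insert h K" "d1 $ insert h K = - (d2 $ K)"
      using h by (simp_all add: stem_J_nth add_eq_0_iff)
    have upd: "((\<lambda>w. vec_upd z h w) has_derivative (\<lambda>u. axis h u)) (at w)"
    proof -
      have lin: "bounded_linear (\<lambda>u::complex. axis h u :: 'n cvec)"
        by (intro linear_conv_bounded_linear[THEN iffD1] linearI) (auto simp: vec_eq_iff axis_def)
      have "((\<lambda>w. z + axis h (w - z $ h)) has_derivative (\<lambda>u. axis h u)) (at w)"
        by (auto intro!: derivative_eq_intros bounded_linear.has_derivative[OF lin])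
      then show ?thesis by (simp add: vec_upd_eq_axis[abs_def])
    qed
    have "((\<lambda>w. F (vec_upd z h w)) has_derivative (\<lambda>u. F' y (axis h u))) (at w)"
      using has_derivative_compose[OF upd, of F "F' y"] F'[OF y] by (simp add: y_def)
    moreover have "F' y (axis h u) = Re u *\<^sub>R d1 + Im u *\<^sub>R d2" for u
    proof -
      have "(axis h u :: 'n cvec) = Re u *\<^sub>R axis h 1 + Im u *\<^sub>R axis h \<i>"
        by (simp add: vec_eq_iff axis_def complex_eq_iff)
      then show ?thesis by (simp add: blinfun.add_right blinfun.scaleR_right d1_def d2_def)
    qed
    ultimately have "((\<lambda>w. F (vec_upd z h w)) has_derivative (\<lambda>u. Re u *\<^sub>R d1 + Im u *\<^sub>R d2)) (at w)" by simp
    then have comp: "((\<lambda>w. F (vec_upd z h w) $ L \<bullet> c) has_derivative (\<lambda>u. Re u * (d1 $ L \<bullet> c) + Im u * (d2 $ L \<bullet> c))) (at w)" for L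
      by (auto intro!: derivative_eq_intros bounded_linear.has_derivative[OF bounded_linear_vec_nth] simp: inner_add_left)
    have "((\<lambda>w. of_real (F (vec_upd z h w) $ K \<bullet> c) + \<i> * of_real (F (vec_upd z h w) $ insert h K \<bullet> c)) has_derivative
       (\<lambda>u. of_real (Re u * (d1 $ K \<bullet> c) + Im u * (d2 $ K \<bullet> c)) + \<i> * of_real (Re u * (d1 $ insert h K \<bullet> c) + Im u * (d2 $ insert h K \<bullet> c)))) (at w)"
      by (intro has_derivative_add has_derivative_mult_right has_derivative_of_real comp)
    moreover have "(\<lambda>u. of_real (Re u * (d1 $ K \<bullet> c) + Im u * (d2 $ K \<bullet> c)) + \<i> * of_real (Re u * (d1 $ insert h K \<bullet> c) + Im u * (d2 $ insert h K \<bullet> c)))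
      = (*) (Complex (d1 $ K \<bullet> c) (d1 $ insert h K \<bullet> c))"
      by (auto simp: fun_eq_iff complex_eq_iff CR algebra_simps)
    ultimately show ?thesis
      unfolding field_differentiable_def has_field_derivative_def Complex_eq by auto
  qed
  then show "(\<lambda>w. Complex (F (vec_upd z h w) $ K \<bullet> c) (F (vec_upd z h w) $ insert h K \<bullet> c)) holomorphic_on ?S"
    by (simp add: holomorphic_on_def field_differentiable_at_within)
qed

text \<open>
  \<open>Q\<close> consists of the components of the stem function of the spherical component with index \<open>H\<close>, extended
  continuously to all of \<open>D\<close>; the last condition determines it on the dense set where no coordinate in \<open>H\<close> is
  real.  Continuity, parity and holomorphy are recorded because they are what the extension to a larger \<open>H\<close>
  requires.
\<close>
definition extends_component :: "('n::finite) cvec set \<Rightarrow> ('n cvec \<Rightarrow> 'n stem) \<Rightarrow> 'n set \<Rightarrow> ('n cvec \<Rightarrow> 'n set \<Rightarrow> quat) \<Rightarrow> bool" where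
  "extends_component D F H Q \<longleftrightarrow>
     (\<forall>K. continuous_on D (\<lambda>z. Q z K)) \<and> stem_parity D Q \<and>
     (\<forall>z\<in>D. \<forall>h K. h \<notin> H \<longrightarrow> h \<notin> K \<longrightarrow> K \<inter> H = {} \<longrightarrow> holomorphic_pair h (\<lambda>z. Q z K) (\<lambda>z. Q z (insert h K)) D z) \<and>
     (\<forall>z K. K \<inter> H \<noteq> {} \<longrightarrow> Q z K = 0) \<and>
     (\<forall>z\<in>D. \<forall>K. K \<inter> H = {} \<longrightarrow> (\<Prod>h\<in>H. Im (z $ h)) *\<^sub>R Q z K = F z $ (K \<union> H))"

lemma holomorphic_pair_divide:
  assumes D: "\<And>y. y \<in> D \<Longrightarrow> Im (y $ h) *\<^sub>R V y = A y \<and> Im (y $ h) *\<^sub>R W y = B y"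
    and hp: "holomorphic_pair k A B D z" and hk: "h \<noteq> k" and ne: "Im (z $ h) \<noteq> 0"
  shows "holomorphic_pair k V W D z"
  unfolding holomorphic_pair_def
proof
  fix c
  let ?S = "{w. vec_upd z k w \<in> D}"
  have "(\<lambda>w. Complex (A (vec_upd z k w) \<bullet> c) (B (vec_upd z k w) \<bullet> c) / of_real (Im (z $ h))) holomorphic_on ?S"
    using hp ne unfolding holomorphic_pair_def by (intro holomorphic_intros) auto
  then show "(\<lambda>w. Complex (V (vec_upd z k w) \<bullet> c) (W (vec_upd z k w) \<bullet> c)) holomorphic_on ?S"
  proof (rule holomorphic_transform)
    fix w assume "w \<in> ?S"
    then have "Im (z $ h) *\<^sub>R V (vec_upd z k w) = A (vec_upd z k w)" "Im (z $ h) *\<^sub>R W (vec_upd z k w) = B (vec_upd z k w)"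
      using D[of "vec_upd z k w"] hk by simp_all
    then show "Complex (A (vec_upd z k w) \<bullet> c) (B (vec_upd z k w) \<bullet> c) / of_real (Im (z $ h)) = Complex (V (vec_upd z k w) \<bullet> c) (W (vec_upd z k w) \<bullet> c)"
      using ne by (simp add: complex_eq_iff flip: \<open>_ = A _\<close> \<open>_ = B _\<close>)
  qed
qed

text \<open>
  To pass from \<open>H\<close> to \<open>H \<union> {h}\<close>, the components with index \<open>K \<union> {h}\<close> are divided by \<open>Im z\<^sub>h\<close>.  Parity and
  holomorphy of the quotients are clear where \<open>z\<^sub>h\<close> is not real, and extend to \<open>D\<close> by continuity.
\<close>
lemma extends_component_exists:
  fixes F :: "('n::finite) cvec \<Rightarrow> 'n stem"
  assumes D: "open D" and inv: "invariant_set D" and F: "holomorphic_stem D F"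
  shows "\<exists>Q. extends_component D F H Q"
proof -
  have "finite H" by simp
  then show ?thesis
  proof (induction H)
    case empty
    have "extends_component D F {} (\<lambda>z K. F z $ K)"
      using F holomorphic_stem_pair[OF D F]
      by (auto simp: extends_component_def stem_parity_def holomorphic_stem_def stem_function_def intro!: continuous_intros)
    then show ?case by blast
  next
    case (insert h H)
    then obtain Q where Q: "extends_component D F H Q" by blast
    have Qc: "\<And>K. continuous_on D (\<lambda>z. Q z K)" and Qp: "stem_parity D Q"
      and Qh: "\<And>z k K. z \<in> D \<Longrightarrow> k \<notin> H \<Longrightarrow> k \<notin> K \<Longrightarrow> K \<inter> H = {} \<Longrightarrow> holomorphic_pair k (\<lambda>z. Q z K) (\<lambda>z. Q z (insert k K)) D z"
      and QF: "\<And>z K. z \<in> D \<Longrightarrow> K \<inter> H = {} \<Longrightarrow> (\<Prod>h\<in>H. Im (z $ h)) *\<^sub>R Q z K = F z $ (K \<union> H)"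
      using Q by (auto simp: extends_component_def)
    have cD: "conj_at k z \<in> D" if "z \<in> D" for k z using inv that by (auto simp: invariant_set_def)
    have Qpar: "Q (conj_at k z) K = (-1) ^ card (K \<inter> {k}) * Q z K" if "z \<in> D" for k z K
      using Qp that by (simp add: stem_parity_def)
    have "\<exists>V. continuous_on D V \<and> (\<forall>z\<in>D. Im (z $ h) *\<^sub>R V z = Q z (insert h K))" if K: "K \<inter> insert h H = {}" for K
    proof -
      have par: "Q (conj_at h z) K = Q z K \<and> Q (conj_at h z) (insert h K) = - Q z (insert h K)" if "z \<in> D" for z
        using K that by (simp add: Qpar)
      have hp: "holomorphic_pair h (\<lambda>z. Q z K) (\<lambda>z. Q z (insert h K)) D z" if "z \<in> D" for z
        using Qh[OF that, of h K] K insert.hyps by auto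
      obtain V where "continuous_on D V" "\<And>z. z \<in> D \<Longrightarrow> Im (z $ h) *\<^sub>R V z = Q z (insert h K)"
        by (rule division_by_imaginary_part[OF D Qc[of K] Qc[of "insert h K"] hp par]) auto
      then show ?thesis by blast
    qed
    then obtain V where V: "\<And>K. K \<inter> insert h H = {} \<Longrightarrow> continuous_on D (V K)"
      "\<And>K z. K \<inter> insert h H = {} \<Longrightarrow> z \<in> D \<Longrightarrow> Im (z $ h) *\<^sub>R V K z = Q z (insert h K)"
      by metis
    define R where "R z K = (if K \<inter> insert h H = {} then V K z else 0)" for z K
    have Rc: "continuous_on D (\<lambda>z. R z K)" for K
    proof (cases "K \<inter> insert h H = {}")
      case True
      have "continuous_on D (\<lambda>z. V K z)" by (rule V(1)[OF True])
      then show ?thesis using True by (simp add: R_def)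
    next
      case False
      then show ?thesis by (simp only: R_def if_False continuous_on_const)
    qed
    have "extends_component D F (insert h H) R"
      unfolding extends_component_def
    proof (intro conjI allI ballI impI)
      show "continuous_on D (\<lambda>z. R z K)" for K by (rule Rc)
      show "R z K = 0" if "K \<inter> insert h H \<noteq> {}" for z K using that by (auto simp: R_def)
      show "(\<Prod>h\<in>insert h H. Im (z $ h)) *\<^sub>R R z K = F z $ (K \<union> insert h H)" if z: "z \<in> D" and K: "K \<inter> insert h H = {}" for z K
      proof -
        have "(\<Prod>h\<in>insert h H. Im (z $ h)) *\<^sub>R R z K = (\<Prod>h\<in>H. Im (z $ h)) *\<^sub>R (Im (z $ h) *\<^sub>R V K z)"
          using insert.hyps K by (simp add: R_def mult.commute)
        also have "\<dots> = F z $ (insert h K \<union> H)"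
          unfolding V(2)[OF K z] by (rule QF[OF z]) (use K insert.hyps in auto)
        finally show ?thesis by simp
      qed
      show "stem_parity D R"
        unfolding stem_parity_def
      proof (intro ballI allI)
        fix z K k assume z: "z \<in> D"
        show "R (conj_at k z) K = (-1) ^ card (K \<inter> {k}) * R z K"
        proof (cases "K \<inter> insert h H = {}")
          case False then show ?thesis by (auto simp: R_def)
        next
          case K: True
          show ?thesis
          proof (rule eq_if_eq_on_nonreal_part[OF D _ _ _ z, where H = "{h}" and f = "\<lambda>z. R (conj_at k z) K" and g = "\<lambda>z. (-1) ^ card (K \<inter> {k}) * R z K"])
            show "continuous_on D (\<lambda>z. R (conj_at k z) K)"
              by (rule continuous_on_compose2[OF Rc continuous_on_conj_at]) (use cD in auto)
            show "continuous_on D (\<lambda>z. (-1) ^ card (K \<inter> {k}) * R z K)" by (intro continuous_intros Rc)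
            fix y assume "y \<in> nonreal_part {h} D"
            then have y: "y \<in> D" "Im (y $ h) \<noteq> 0" by (auto simp: nonreal_part_def)
            have "Im (conj_at k y $ h) *\<^sub>R V K (conj_at k y) = (-1) ^ card (insert h K \<inter> {k}) * (Im (y $ h) *\<^sub>R V K y)"
              using V(2)[OF K] y cD Qpar by simp
            then have "Im (y $ h) *\<^sub>R V K (conj_at k y) = Im (y $ h) *\<^sub>R ((-1) ^ card (K \<inter> {k}) * V K y)"
              using K by (cases "k = h") (auto simp: conj_at_def)
            then show "R (conj_at k y) K = (-1) ^ card (K \<inter> {k}) * R y K" using y(2) K by (simp add: R_def)
          qed
        qed
      qed
      fix z k K assume z: "z \<in> D" and k: "k \<notin> insert h H" "k \<notin> K" and K: "K \<inter> insert h H = {}"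
      then have K': "insert k K \<inter> insert h H = {}" by auto
      have "holomorphic_pair k (V K) (V (insert k K)) D z"
      proof (rule holomorphic_pair_limit[OF D V(1)[OF K] V(1)[OF K'] _ _ z, of k "{h}"])
        show "k \<notin> {h}" using k by simp
        fix y assume "y \<in> nonreal_part {h} D"
        then have y: "y \<in> D" "Im (y $ h) \<noteq> 0" by (auto simp: nonreal_part_def)
        show "holomorphic_pair k (V K) (V (insert k K)) D y"
        proof (rule holomorphic_pair_divide[OF _ _ _ y(2)])
          show "holomorphic_pair k (\<lambda>z. Q z (insert h K)) (\<lambda>z. Q z (insert k (insert h K))) D y"
            by (rule Qh[OF y(1)]) (use k K insert.hyps in auto)
          show "h \<noteq> k" using k by auto
          show "Im (x $ h) *\<^sub>R V K x = Q x (insert h K) \<and> Im (x $ h) *\<^sub>R V (insert k K) x = Q x (insert k (insert h K))" if "x \<in> D" for x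
            using V(2)[OF K that] V(2)[OF K' that] by (simp add: insert_commute)
        qed
      qed
      then show "holomorphic_pair k (\<lambda>z. R z K) (\<lambda>z. R z (insert k K)) D z"
        using K K' by (simp add: R_def)
    qed
    then show ?case by blast
  qed
qed

lemma invariant_nonreal_part: "invariant_set D \<Longrightarrow> invariant_set (nonreal_part H D)"
  unfolding invariant_set_def nonreal_part_def by (auto simp: conj_at_def)

lemma nonreal_part_subset: "nonreal_part H D \<subseteq> D"
  by (auto simp: nonreal_part_def)

lemma spherical_component_eq_slice_of:
  assumes inv: "invariant_set D" and F: "stem_function D F" "induces D F f"
    and Q: "extends_component D F H Q" and x: "x \<in> circularization (nonreal_part H D)"
  shows "spherical_component D H f x = slice_of Q x"
proof -
  let ?D = "nonreal_part H D"
  have Qp: "stem_parity ?D Q"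
    using Q by (auto simp: extends_component_def stem_parity_def nonreal_part_def)
  have comp: "stem_component H (stem_of D f) z $ K = Q z K" if z: "z \<in> ?D" for z K
  proof -
    have zD: "z \<in> D" and ne: "(\<Prod>h\<in>H. Im (z $ h)) \<noteq> 0" using z by (auto simp: nonreal_part_def)
    show ?thesis
    proof (cases "K \<inter> H = {}")
      case True
      then have "F z $ (K \<union> H) = (\<Prod>h\<in>H. Im (z $ h)) *\<^sub>R Q z K" using Q zD by (simp add: extends_component_def)
      then show ?thesis using ne True by (simp add: stem_component_nth stem_of_eq[OF F zD])
    next
      case False
      then show ?thesis using Q by (simp add: stem_component_nth extends_component_def)
    qed
  qed
  have "induces ?D (stem_component H (stem_of D f)) (slice_of Q)"
    unfolding induces_def using slice_of_slice_point[OF invariant_nonreal_part[OF inv] Qp] by (simp add: comp)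
  then have ind: "induces ?D (stem_component H (stem_of D f)) (spherical_component D H f)"
    unfolding spherical_component_def
    by (rule someI[where P = "induces ?D (stem_component H (stem_of D f))"])
  obtain J z where J: "x = slice_point J z" "z \<in> ?D" "\<forall>h. J $ h \<in> imag_units"
    using x by (auto simp: circularization_def)
  show ?thesis
    unfolding J(1) inducesD[OF ind J(2,3)] slice_of_slice_point[OF invariant_nonreal_part[OF inv] Qp J(2,3)]
    by (simp add: comp[OF J(2)])
qed

text \<open>
  Both sides are continuous and agree with the spherical component on a dense set.
\<close>
lemma S_empty_eq_slice_of:
  assumes D: "open D" and inv: "invariant_set D" and F: "stem_function D F" "induces D F f"
    and Q: "extends_component D F (seg j) Q" and x: "x \<in> circularization D"
  shows "S_empty D j f x = slice_of Q x"
proof -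
  let ?P = "\<lambda>g. continuous_on (circularization D) g \<and>
     (\<forall>x\<in>circularization (nonreal_part (seg j) D). g x = spherical_component D (seg j) f x)"
  have cont: "continuous_on (circularization D) (slice_of Q)"
    by (rule continuous_on_slice_of[OF inv]) (use Q in \<open>auto simp: extends_component_def\<close>)
  have "?P (slice_of Q)"
    using cont spherical_component_eq_slice_of[OF inv F Q] by simp
  then have P: "?P (S_empty D j f)"
    unfolding S_empty_def by (rule someI[where P = ?P])
  obtain J z where J: "x = slice_point J z" "z \<in> D" "\<forall>h. J $ h \<in> imag_units"
    using x by (auto simp: circularization_def)
  obtain y where y: "y \<longlonglongrightarrow> z" "\<And>n. y n \<in> nonreal_part (seg j) D"
    using nonreal_sequence[OF D J(2)] by metis
  have lim: "(\<lambda>n. slice_point J (y n)) \<longlonglongrightarrow> x"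
    unfolding J(1) slice_point_def by (intro tendsto_vec_lambda tendsto_intros y(1))
  have inN: "slice_point J (y n) \<in> circularization (nonreal_part (seg j) D)" for n
    using y(2) J(3) by (auto simp: circularization_def)
  then have inD: "\<forall>\<^sub>F n in sequentially. slice_point J (y n) \<in> circularization D"
    using nonreal_part_subset[of "seg j" D] by (intro always_eventually) (fastforce simp: circularization_def)
  have "(\<lambda>n. S_empty D j f (slice_point J (y n))) \<longlonglongrightarrow> S_empty D j f x"
    using P by (intro continuous_on_tendsto_compose[OF _ lim x inD]) auto
  moreover have "(\<lambda>n. slice_of Q (slice_point J (y n))) \<longlonglongrightarrow> slice_of Q x"
    by (intro continuous_on_tendsto_compose[OF cont lim x inD])
  moreover have "S_empty D j f (slice_point J (y n)) = slice_of Q (slice_point J (y n))" for n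
    using P inN spherical_component_eq_slice_of[OF inv F Q inN] by simp
  ultimately show ?thesis using LIMSEQ_unique by simp
qed

section \<open>Iteration over the variables\<close>

text \<open>
  The one-variable formula in the variable with index \<open>h\<close>, for fixed values of the other ones.  Since \<open>h\<close> precedes all
  indices outside of \<open>H \<union> {h}\<close>, every ordered product over a set \<open>K \<union> {h}\<close> starts with the unit of the
  variable \<open>x\<^sub>h\<close>.  Collecting the terms without and with this unit, one writes the slice function as \<open>A + J B\<close>, and
  the slice function of \<open>R\<close> is the corresponding quotient \<open>V\<close> of \<open>B\<close> by the imaginary part.
\<close>
lemma slice_of_mean_in_variable:
  fixes F :: "('n::{finite,linorder}) cvec \<Rightarrow> 'n stem"
  assumes D: "open D" and inv: "invariant_set D"
    and Q: "extends_component D F H Q" and R: "extends_component D F (insert h H) R"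
    and hH: "h \<notin> H" and min: "\<And>k. k \<notin> insert h H \<Longrightarrow> h < k"
    and r: "0 \<le> r" and sub: "\<And>q. q \<in> cball (b $ h) r \<Longrightarrow> vec_upd b h q \<in> circularization D"
  shows "slice_of Q b =
    (\<integral>l. slice_of Q (vec_upd b h (b $ h + r *\<^sub>R l)) \<partial>quat_sphere)
    + r *\<^sub>R (\<integral>l. quat_cnj l * slice_of R (vec_upd b h (b $ h + r *\<^sub>R l)) \<partial>quat_sphere)"
proof -
  define z where "z = cvec_of b"
  define J where "J k = imag_unit_of (b $ k)" for k
  \<comment> \<open>the index sets that avoid \<open>H\<close> and \<open>h\<close>; the terms of the slice function of \<open>Q\<close> that can be nonzero belong to \<open>K\<close> and \<open>insert h K\<close> with \<open>K\<close> in \<open>\<C>\<close>\<close>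
  define \<C> where "\<C> = {K. K \<inter> insert h H = {}}"
  define E where "E = {w. vec_upd z h w \<in> D}"
  define A where "A w = (\<Sum>K\<in>\<C>. ordered_prod J K * Q (vec_upd z h w) K)" for w
  define B where "B w = (\<Sum>K\<in>\<C>. ordered_prod J K * Q (vec_upd z h w) (insert h K))" for w
  define V where "V w = (\<Sum>K\<in>\<C>. ordered_prod J K * R (vec_upd z h w) K)" for w
  have Qc: "\<And>K. continuous_on D (\<lambda>z. Q z K)" and Rc: "\<And>K. continuous_on D (\<lambda>z. R z K)"
    and Qp: "stem_parity D Q" and Rp: "stem_parity D R"
    and Qh: "\<And>z K. z \<in> D \<Longrightarrow> K \<in> \<C> \<Longrightarrow> holomorphic_pair h (\<lambda>z. Q z K) (\<lambda>z. Q z (insert h K)) D z"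
    and Q0: "\<And>z K. K \<inter> H \<noteq> {} \<Longrightarrow> Q z K = 0"
    and QF: "\<And>z K. z \<in> D \<Longrightarrow> K \<inter> H = {} \<Longrightarrow> (\<Prod>h\<in>H. Im (z $ h)) *\<^sub>R Q z K = F z $ (K \<union> H)"
    using Q R hH unfolding extends_component_def \<C>_def by auto
  have R0: "\<And>z K. K \<notin> \<C> \<Longrightarrow> R z K = 0"
    and RF: "\<And>z K. z \<in> D \<Longrightarrow> K \<in> \<C> \<Longrightarrow> (\<Prod>h\<in>insert h H. Im (z $ h)) *\<^sub>R R z K = F z $ (K \<union> insert h H)"
    using R unfolding extends_component_def \<C>_def by blast+
  \<comment> \<open>from the defining relations where the imaginary parts do not vanish, and by density elsewhere\<close>
  have RQ: "Im (y $ h) *\<^sub>R R y K = Q y (insert h K)" if "y \<in> D" and K: "K \<in> \<C>" for y K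
  proof (rule eq_if_eq_on_nonreal_part[OF D _ Qc _ that(1), where H = H])
    show "continuous_on D (\<lambda>y. Im (y $ h) *\<^sub>R R y K)" by (intro continuous_intros Rc)
    fix x assume "x \<in> nonreal_part H D"
    then have x: "x \<in> D" "(\<Prod>h\<in>H. Im (x $ h)) \<noteq> 0" by (auto simp: nonreal_part_def)
    have "(\<Prod>h\<in>H. Im (x $ h)) *\<^sub>R (Im (x $ h) *\<^sub>R R x K) = (\<Prod>h\<in>insert h H. Im (x $ h)) *\<^sub>R R x K"
      using hH by (simp add: mult.commute)
    also have "\<dots> = (\<Prod>h\<in>H. Im (x $ h)) *\<^sub>R Q x (insert h K)"
      using RF[OF x(1) K] QF[OF x(1), of "insert h K"] K hH by (simp add: \<C>_def)
    finally show "Im (x $ h) *\<^sub>R R x K = Q x (insert h K)"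
      by (rule scaleR_left_imp_eq[OF x(2)])
  qed
  have upd: "cvec_of (vec_upd b h q) = vec_upd z h (cpoint q)" for q
    by (simp add: z_def cvec_of_def vec_eq_iff)
  have JK: "ordered_prod (\<lambda>k. imag_unit_of (vec_upd b h q $ k)) K = ordered_prod J K" if "K \<in> \<C>" for q K
    using that by (intro ordered_prod_cong) (auto simp: J_def \<C>_def)
  have JhK: "ordered_prod (\<lambda>k. imag_unit_of (vec_upd b h q $ k)) (insert h K) = imag_unit_of q * ordered_prod J K"
    if K: "K \<in> \<C>" for q K
  proof -
    have "ordered_prod (\<lambda>k. imag_unit_of (vec_upd b h q $ k)) (insert h K) =
        imag_unit_of (vec_upd b h q $ h) * ordered_prod (\<lambda>k. imag_unit_of (vec_upd b h q $ k)) K"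
      by (rule ordered_prod_insert_min, rule min) (use K in \<open>auto simp: \<C>_def\<close>)
    then show ?thesis unfolding JK[OF K] by simp
  qed
  have BV: "B w = Im w *\<^sub>R V w" if "w \<in> E" for w
    unfolding B_def V_def scaleR_right.sum
  proof (rule sum.cong[OF refl])
    fix K assume "K \<in> \<C>"
    then show "ordered_prod J K * Q (vec_upd z h w) (insert h K) = Im w *\<^sub>R (ordered_prod J K * R (vec_upd z h w) K)"
      using RQ[of "vec_upd z h w" K] that by (simp add: E_def flip: RQ)
  qed
  have sQ: "slice_of Q (vec_upd b h q) = A (cpoint q) + quat_im q * V (cpoint q)" if "cpoint q \<in> E" for q
  proof -
    let ?t = "\<lambda>K. ordered_prod (\<lambda>k. imag_unit_of (vec_upd b h q $ k)) K * Q (vec_upd z h (cpoint q)) K"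
    have inj: "inj_on (insert h) \<C>" by (auto simp: inj_on_def \<C>_def)
    have "slice_of Q (vec_upd b h q) = (\<Sum>K\<in>UNIV. ?t K)" by (simp add: slice_of_def upd)
    also have "\<dots> = (\<Sum>K\<in>\<C> \<union> insert h ` \<C>. ?t K)"
    proof (rule sum.mono_neutral_right)
      show "\<forall>K\<in>UNIV - (\<C> \<union> insert h ` \<C>). ?t K = 0"
      proof
        fix K assume K: "K \<in> UNIV - (\<C> \<union> insert h ` \<C>)"
        have "K \<inter> H \<noteq> {}"
        proof
          assume KH: "K \<inter> H = {}"
          show False
          proof (cases "h \<in> K")
            case True
            then have "K = insert h (K - {h})" "K - {h} \<in> \<C>" using KH by (auto simp: \<C>_def)
            then show False using K by blast
          next
            case False then show False using K KH by (auto simp: \<C>_def)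
          qed
        qed
        then show "?t K = 0" by (simp add: Q0)
      qed
    qed auto
    also have "\<dots> = (\<Sum>K\<in>\<C>. ?t K) + (\<Sum>K\<in>insert h ` \<C>. ?t K)"
      by (rule sum.union_disjoint) (auto simp: \<C>_def)
    also have "(\<Sum>K\<in>\<C>. ?t K) = A (cpoint q)" unfolding A_def by (intro sum.cong refl) (simp only: JK)
    also have "(\<Sum>K\<in>insert h ` \<C>. ?t K) = (\<Sum>K\<in>\<C>. ?t (insert h K))"
      by (simp add: sum.reindex[OF inj])
    also have "\<dots> = imag_unit_of q * B (cpoint q)"
      unfolding B_def sum_distrib_left by (intro sum.cong refl) (simp only: JhK mult.assoc)
    also have "\<dots> = quat_im q * V (cpoint q)"
      using BV[OF that] imag_unit_of_mult_norm[of q] by (metis Im_cpoint mult_scaleR_left mult_scaleR_right)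
    finally show ?thesis .
  qed
  have sR: "slice_of R (vec_upd b h q) = V (cpoint q)" for q
  proof -
    have "slice_of R (vec_upd b h q) = (\<Sum>K\<in>\<C>. ordered_prod (\<lambda>k. imag_unit_of (vec_upd b h q $ k)) K * R (vec_upd z h (cpoint q)) K)"
      unfolding slice_of_def upd by (rule sum.mono_neutral_right) (auto simp: R0)
    also have "\<dots> = V (cpoint q)" unfolding V_def by (intro sum.cong refl) (simp only: JK)
    finally show ?thesis .
  qed
  have Ec: "continuous_on E (\<lambda>w. g (vec_upd z h w))" if "continuous_on D g" for g :: "'n cvec \<Rightarrow> quat"
    by (rule continuous_on_compose2[OF that]) (auto simp: E_def intro!: continuous_intros)
  have subE: "cpoint ` cball (b $ h) r \<subseteq> E"
  proof safe
    fix q assume "q \<in> cball (b $ h) r"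
    from sub[OF this] show "cpoint q \<in> E" by (simp add: mem_circularization_iff[OF inv] upd E_def)
  qed
  have "A (cpoint (b $ h)) + quat_im (b $ h) * V (cpoint (b $ h)) =
    (\<integral>l. A (cpoint (b $ h + r *\<^sub>R l)) + quat_im (b $ h + r *\<^sub>R l) * V (cpoint (b $ h + r *\<^sub>R l)) \<partial>quat_sphere)
    + r *\<^sub>R (\<integral>l. quat_cnj l * V (cpoint (b $ h + r *\<^sub>R l)) \<partial>quat_sphere)"
  proof (rule slice_mean_formula[OF _ _ _ _ _ BV r subE])
    show "open E" unfolding E_def by (rule open_vec_upd_vimage[OF D])
    show "continuous_on E A" "continuous_on E V"
      unfolding A_def V_def by (intro continuous_intros Ec Qc Rc)+
    show "cnj w \<in> E \<and> A (cnj w) = A w \<and> V (cnj w) = V w" if "w \<in> E" for w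
    proof -
      have w: "vec_upd z h w \<in> D" using that by (simp add: E_def)
      have eq: "vec_upd z h (cnj w) = conj_at h (vec_upd z h w)"
        by (simp add: conj_at_def vec_eq_iff)
      have "Q (vec_upd z h (cnj w)) K = Q (vec_upd z h w) K" "R (vec_upd z h (cnj w)) K = R (vec_upd z h w) K" if "K \<in> \<C>" for K
      proof -
        have "K \<inter> {h} = {}" using that by (auto simp: \<C>_def)
        then show "Q (vec_upd z h (cnj w)) K = Q (vec_upd z h w) K" "R (vec_upd z h (cnj w)) K = R (vec_upd z h w) K"
          unfolding eq using Qp Rp w by (simp_all add: stem_parity_def)
      qed
      moreover have "cnj w \<in> E" using inv w by (auto simp: E_def eq invariant_set_def)
      ultimately show ?thesis by (simp add: A_def V_def)
    qed
    show "(\<lambda>w. Complex (A w \<bullet> c) (B w \<bullet> c)) holomorphic_on E" for c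
    proof (cases "E = {}")
      case False
      then obtain w0 where "vec_upd z h w0 \<in> D" by (auto simp: E_def)
      from Qh[OF this] have Qh': "holomorphic_pair h (\<lambda>z. Q z K) (\<lambda>z. Q z (insert h K)) D (vec_upd z h w0)" if "K \<in> \<C>" for K
        using that by blast
      have upd2: "vec_upd (vec_upd z h w0) h w = vec_upd z h w" for w by (simp add: vec_eq_iff)
      have "(\<lambda>w. \<Sum>K\<in>\<C>. Complex (Q (vec_upd z h w) K \<bullet> (quat_cnj (ordered_prod J K) * c)) (Q (vec_upd z h w) (insert h K) \<bullet> (quat_cnj (ordered_prod J K) * c))) holomorphic_on E"
        using Qh' unfolding holomorphic_pair_def upd2 E_def by (intro holomorphic_on_sum) blast
      also have "(\<lambda>w. \<Sum>K\<in>\<C>. Complex (Q (vec_upd z h w) K \<bullet> (quat_cnj (ordered_prod J K) * c)) (Q (vec_upd z h w) (insert h K) \<bullet> (quat_cnj (ordered_prod J K) * c))) = (\<lambda>w. Complex (A w \<bullet> c) (B w \<bullet> c))"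
        by (simp add: fun_eq_iff complex_eq_iff A_def B_def inner_sum_left quat_inner_mult_left)
      finally show ?thesis .
    qed (simp add: holomorphic_on_def)
  qed
  also have "A (cpoint (b $ h)) + quat_im (b $ h) * V (cpoint (b $ h)) = slice_of Q b"
  proof -
    have "cpoint (b $ h) \<in> E" using subE r by (auto simp: image_subset_iff)
    then show ?thesis using sQ[of "b $ h"] by simp
  qed
  also have "(\<integral>l. A (cpoint (b $ h + r *\<^sub>R l)) + quat_im (b $ h + r *\<^sub>R l) * V (cpoint (b $ h + r *\<^sub>R l)) \<partial>quat_sphere) =
    (\<integral>l. slice_of Q (vec_upd b h (b $ h + r *\<^sub>R l)) \<partial>quat_sphere)"
  proof (rule Bochner_Integration.integral_cong[OF refl])
    fix l assume "l \<in> space quat_sphere"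
    then have "b $ h + r *\<^sub>R l \<in> cball (b $ h) r" using r by (simp add: dist_norm)
    then have "cpoint (b $ h + r *\<^sub>R l) \<in> E" using subE by blast
    then show "A (cpoint (b $ h + r *\<^sub>R l)) + quat_im (b $ h + r *\<^sub>R l) * V (cpoint (b $ h + r *\<^sub>R l)) = slice_of Q (vec_upd b h (b $ h + r *\<^sub>R l))"
      by (simp add: sQ)
  qed
  finally show ?thesis by (simp only: sR)
qed

interpretation sphere_product: product_sigma_finite "\<lambda>_. quat_sphere"
  by (simp add: product_sigma_finite_def finite_measure_quat_sphere finite_measure.axioms)

lemma compact_polyball:
  fixes a :: "('n::finite) qvec"
  shows "compact {x. \<forall>i. x $ i \<in> cball (a $ i) (r i)}"
  unfolding compact_eq_bounded_closed
proof
  show "bounded {x. \<forall>i. x $ i \<in> cball (a $ i) (r i)}"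
  proof (rule boundedI)
    fix x assume "x \<in> {x. \<forall>i. x $ i \<in> cball (a $ i) (r i)}"
    then have "norm (x $ i) \<le> norm (a $ i) + r i" for i
      using norm_triangle_ineq2[of "x $ i" "a $ i"] by (auto simp: dist_norm norm_minus_commute) (smt (verit))
    then have "(\<Sum>i\<in>UNIV. norm (x $ i)) \<le> (\<Sum>i\<in>UNIV. norm (a $ i) + r i)" by (intro sum_mono) auto
    moreover have "norm x \<le> (\<Sum>i\<in>UNIV. norm (x $ i))" unfolding norm_vec_def by (rule L2_set_le_sum) auto
    ultimately show "norm x \<le> (\<Sum>i\<in>UNIV. norm (a $ i) + r i)" by linarith
  qed
  show "closed {x. \<forall>i. x $ i \<in> cball (a $ i) (r i)}"
    unfolding mem_cball by (intro closed_Collect_all closed_Collect_le continuous_intros)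
qed

text \<open>
  The integrand is bounded, since the point \<open>shift a I _\<close> stays in a compact product of balls on which \<open>g\<close> is
  continuous, and the product measure is finite.
\<close>
lemma integrable_sphere_product:
  fixes g :: "('n::{finite,linorder}) qvec \<Rightarrow> quat"
  assumes g: "continuous_on X g" and X: "X = {x. \<forall>i. x $ i \<in> cball (a $ i) (r i)}"
    and r: "\<And>i. 0 \<le> r i" and K: "K \<subseteq> I"
  shows "integrable (PiM I (\<lambda>_. quat_sphere)) (\<lambda>l. ordered_prod (\<lambda>i. quat_cnj (l i)) K * g (shift a I (\<lambda>i. r i *\<^sub>R l i)))"
proof -
  let ?M = "PiM I (\<lambda>_. quat_sphere)"
  have cX: "compact X" unfolding X by (rule compact_polyball)
  have sp: "l i \<in> sphere 0 1" if "l \<in> space ?M" "i \<in> I" for l i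
    using that by (auto simp: space_PiM PiE_def Pi_def)
  have finM: "finite_measure ?M"
  proof (rule finite_measureI)
    have "emeasure ?M (PiE I (\<lambda>_. sphere 0 1)) = (\<Prod>i\<in>I. emeasure quat_sphere (sphere 0 1))"
      by (rule sphere_product.emeasure_PiM) (use sets.top[of quat_sphere] in simp_all)
    then show "emeasure ?M (space ?M) \<noteq> \<infinity>"
      by (simp add: space_PiM emeasure_space_quat_sphere)
  qed
  interpret finite_measure ?M by (rule finM)
  have comp: "(\<lambda>l. h (l i)) \<in> borel_measurable ?M" if "i \<in> I" "h \<in> borel_measurable borel" for i and h :: "quat \<Rightarrow> quat"
    using measurable_comp[OF measurable_component_singleton[OF that(1)] measurable_quat_sphere[OF that(2)]]
    by (simp add: o_def)
  have cnjm: "quat_cnj \<in> borel_measurable borel"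
    by (intro borel_measurable_continuous_onI linear_continuous_on linear_conv_bounded_linear[THEN iffD1] linearI) (auto simp: quat_eq_iff)
  have m1: "(\<lambda>l. ordered_prod (\<lambda>i. quat_cnj (l i)) K) \<in> borel_measurable ?M"
  proof -
    have "(\<lambda>l. prod_list (map (\<lambda>i. quat_cnj (l i)) xs)) \<in> borel_measurable ?M" if "set xs \<subseteq> I" for xs
      using that by (induction xs) (auto intro!: borel_measurable_times comp cnjm)
    then show ?thesis using K by (simp add: ordered_prod_def)
  qed
  have shX: "shift a I (\<lambda>i. r i *\<^sub>R l i) \<in> X" if "l \<in> space ?M" for l
    using sp[OF that] r by (auto simp: X shift_def dist_norm)
  have m2: "(\<lambda>l. shift a I (\<lambda>i. r i *\<^sub>R l i)) \<in> borel_measurable ?M"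
    unfolding borel_measurable_euclidean_space[where 'c = "'n qvec"]
  proof
    fix b :: "'n qvec" assume "b \<in> Basis"
    then obtain i c where b: "b = axis i c" by (auto simp: Basis_vec_def)
    show "(\<lambda>l. shift a I (\<lambda>i. r i *\<^sub>R l i) \<bullet> b) \<in> borel_measurable ?M"
      unfolding b inner_axis shift_def
      by (cases "i \<in> I") (auto intro!: borel_measurable_inner borel_measurable_add borel_measurable_scaleR comp[of _ "\<lambda>x. x"])
  qed
  have "(\<lambda>x. indicator X x *\<^sub>R g x) \<in> borel_measurable borel"
    by (rule borel_measurable_continuous_on_indicator[OF _ g]) (use compact_imp_closed[OF cX] in simp)
  from measurable_compose[OF m2 this]
  have m3: "(\<lambda>l. g (shift a I (\<lambda>i. r i *\<^sub>R l i))) \<in> borel_measurable ?M"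
    by (rule measurable_cong[THEN iffD1, rotated]) (use shX in simp)
  obtain B where B: "\<forall>x\<in>X. norm (g x) \<le> B"
    using compact_imp_bounded[OF compact_continuous_image[OF g cX]] unfolding bounded_iff by blast
  show ?thesis
  proof (rule integrable_const_bound[where B = B])
    show "AE l in ?M. norm (ordered_prod (\<lambda>i. quat_cnj (l i)) K * g (shift a I (\<lambda>i. r i *\<^sub>R l i))) \<le> B"
    proof (rule AE_I2)
      fix l assume l: "l \<in> space ?M"
      have "norm (quat_cnj (l i)) = 1" if "i \<in> K" for i
        using sp[OF l, of i] that K by (auto simp: norm_quat_def)
      then show "norm (ordered_prod (\<lambda>i. quat_cnj (l i)) K * g (shift a I (\<lambda>i. r i *\<^sub>R l i))) \<le> B"
        using B shX[OF l] norm_ordered_prod[of K "\<lambda>i. quat_cnj (l i)"] by (simp add: norm_mult)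
    qed
  qed (intro borel_measurable_times m1 m3)
qed

text \<open>
  The index \<open>h\<close> of the variable treated in step \<open>j + 1\<close>: it follows all indices that have been treated and
  precedes all remaining ones.
\<close>
lemma seg_Suc:
  assumes "Suc j \<le> CARD('n::{finite,linorder})"
  obtains h :: "'n::{finite,linorder}" where "seg (Suc j) = insert h (seg j)" "h \<notin> seg j" "\<And>k. k \<in> seg j \<Longrightarrow> k < h" "\<And>k. k \<notin> seg (Suc j) \<Longrightarrow> h < k"
proof -
  define c where "c h = card {k. k < h}" for h :: 'n
  have mono: "c h < c h'" if "h < h'" for h h'
    unfolding c_def using that by (intro psubset_card_mono) auto
  have less: "h < h'" if "c h < c h'" for h h'
    using mono[of h' h] that by (cases h h' rule: linorder_cases) auto
  have sub: "seg j \<subseteq> (seg (Suc j) :: 'n set)" by (auto simp: seg_def)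
  have "card (seg (Suc j) - seg j :: 'n set) = 1"
    using assms card_seg[of "Suc j", where 'n = 'n] card_seg[of j, where 'n = 'n] by (subst card_Diff_subset[OF _ sub]) auto
  then obtain h where h: "seg (Suc j) - seg j = {h :: 'n}" by (auto simp: card_1_singleton_iff)
  then have "h \<in> seg (Suc j)" "h \<notin> seg j" by auto
  then have ch: "c h = j" by (simp add: seg_def c_def)
  show ?thesis
  proof (rule that[of h])
    show "seg (Suc j) = insert h (seg j)" "h \<notin> seg j" using h sub by auto
    show "k < h" if "k \<in> seg j" for k using that ch by (intro less) (simp add: seg_def c_def)
    show "h < k" if "k \<notin> seg (Suc j)" for k using that ch by (intro less) (simp add: seg_def c_def)
  qed
qed

theorem proposition4p11:
  fixes D :: "('n::{finite,linorder}) cvec set"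
    and f :: "'n qvec \<Rightarrow> quat"
    and a :: "'n qvec"
    and r :: "'n \<Rightarrow> real"
    and m :: nat
  assumes "open D" and "invariant_set D"
    and "slice_regular D f"
    and "a \<in> circularization D"
    and "\<And>i. 0 \<le> r i"
    and "{x. \<forall>i. x $ i \<in> cball (a $ i) (r i)} \<subseteq> circularization D"
    and "1 \<le> m" and "m \<le> CARD('n)"
  shows "f a =
    (\<Sum>j = 0..m - 1. ordered_prod r (seg j) *\<^sub>R
       (\<integral>l. ordered_prod (\<lambda>i. quat_cnj (l i)) (seg j) *
             S_empty D j f (shift a (seg (j + 1)) (\<lambda>i. r i *\<^sub>R l i))
          \<partial>PiM (seg (j + 1)) (\<lambda>_. quat_sphere)))
    + ordered_prod r (seg m) *\<^sub>R
       (\<integral>l. ordered_prod (\<lambda>i. quat_cnj (l i)) (seg m) *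
             S_empty D m f (shift a (seg m) (\<lambda>i. r i *\<^sub>R l i))
          \<partial>PiM (seg m) (\<lambda>_. quat_sphere))"
proof -
  note D = assms(1) and inv = assms(2) and r = assms(5)
  obtain F where F: "holomorphic_stem D F" "induces D F f"
    using assms(3) by (auto simp: slice_regular_def)
  have sF: "stem_function D F" using F by (simp add: holomorphic_stem_def)
  obtain Q where Q: "\<And>H. extends_component D F H (Q H)"
    using extends_component_exists[OF D inv F(1)] by metis
  define X where "X = {x. \<forall>i. x $ i \<in> cball (a $ i) (r i)}"
  have XD: "X \<subseteq> circularization D" using assms(6) by (simp add: X_def)
  define g where "g j = slice_of (Q (seg j))" for j
  have gS: "S_empty D j f x = g j x" if "x \<in> X" for j x
    using S_empty_eq_slice_of[OF D inv sF F(2) Q] XD that by (auto simp: g_def)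
  have gc: "continuous_on X (g j)" for j
    unfolding g_def
    by (rule continuous_on_subset[OF continuous_on_slice_of[OF inv] XD]) (use Q[of "seg j"] in \<open>auto simp: extends_component_def\<close>)
  have shX: "shift a I (\<lambda>i. r i *\<^sub>R l i) \<in> X" if "l \<in> space (PiM I (\<lambda>_. quat_sphere))" for l I
    using that r by (auto simp: X_def shift_def dist_norm space_PiM PiE_def Pi_def)
  \<comment> \<open>the integral of \<open>g j\<close> over the product of the first \<open>i\<close> spheres\<close>
  define G where "G j i = (\<integral>l. ordered_prod (\<lambda>i. quat_cnj (l i)) (seg j) * g j (shift a (seg i) (\<lambda>i. r i *\<^sub>R l i)) \<partial>PiM (seg i) (\<lambda>_. quat_sphere))" for i j :: nat
  have GS: "(\<integral>l. ordered_prod (\<lambda>i. quat_cnj (l i)) (seg j) * S_empty D j f (shift a (seg i) (\<lambda>i. r i *\<^sub>R l i)) \<partial>PiM (seg i) (\<lambda>_. quat_sphere)) = G j i" for i j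
    unfolding G_def by (intro Bochner_Integration.integral_cong refl) (simp add: gS shX)
  \<comment> \<open>the two integrals on the right are joined into one integral over \<open>j + 1\<close> spheres, in which the innermost integration is \<open>slice_of_mean_in_variable\<close>\<close>
  have step: "ordered_prod r (seg j) *\<^sub>R G j j = ordered_prod r (seg j) *\<^sub>R G j (Suc j) + ordered_prod r (seg (Suc j)) *\<^sub>R G (Suc j) (Suc j)"
    if j: "Suc j \<le> CARD('n)" for j
  proof -
    obtain h :: 'n where h: "seg (Suc j) = insert h (seg j)" "h \<notin> seg j" "\<And>k. k \<in> seg j \<Longrightarrow> k < h" "\<And>k. k \<notin> seg (Suc j) \<Longrightarrow> h < k"
      using seg_Suc[OF j] by metis
    let ?I = "seg j :: 'n set"
    let ?M = "PiM ?I (\<lambda>_. quat_sphere)" and ?M' = "PiM (insert h ?I) (\<lambda>_. quat_sphere)"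
    let ?c = "\<lambda>l K. ordered_prod (\<lambda>i. quat_cnj (l i)) K"
    let ?s = "\<lambda>l I. shift a I (\<lambda>i. r i *\<^sub>R l i)"
    have i1: "integrable ?M' (\<lambda>l. ?c l ?I * g j (?s l (insert h ?I)))"
      by (rule integrable_sphere_product[OF gc X_def r]) auto
    have i2: "integrable ?M' (\<lambda>l. ?c l (insert h ?I) * g (Suc j) (?s l (insert h ?I)))"
      by (rule integrable_sphere_product[OF gc X_def r]) auto
    have "G j (Suc j) + r h *\<^sub>R G (Suc j) (Suc j) =
      (\<integral>l. ?c l ?I * g j (?s l (insert h ?I)) + r h *\<^sub>R (?c l (insert h ?I) * g (Suc j) (?s l (insert h ?I))) \<partial>?M')"
      unfolding G_def h(1) using i1 i2 by simp
    also have "\<dots> = (\<integral>l. (\<integral>y. ?c (l(h := y)) ?I * g j (?s (l(h := y)) (insert h ?I)) +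
       r h *\<^sub>R (?c (l(h := y)) (insert h ?I) * g (Suc j) (?s (l(h := y)) (insert h ?I))) \<partial>quat_sphere) \<partial>?M)"
      by (rule sphere_product.product_integral_insert) (use h(2) i1 i2 in auto)
    also have "\<dots> = G j j"
      unfolding G_def
    proof (rule Bochner_Integration.integral_cong[OF refl])
      fix l assume l: "l \<in> space ?M"
      define b where "b = ?s l ?I"
      have bX: "b \<in> X" unfolding b_def by (rule shX[OF l])
      have bh: "b $ h = a $ h" using h(2) by (simp add: b_def shift_def)
      have upX: "vec_upd b h q \<in> X" if "q \<in> cball (b $ h) (r h)" for q
        using that bX bh by (auto simp: X_def)
      let ?u = "\<lambda>y. vec_upd b h (b $ h + r h *\<^sub>R y)"
      have ucont: "continuous_on (sphere 0 1) (\<lambda>y. g i (?u y))" for i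
      proof (rule continuous_on_compose2[OF gc])
        show "continuous_on (sphere 0 1) ?u" by (intro continuous_intros)
        show "?u ` sphere 0 1 \<subseteq> X" using upX r by (auto simp: dist_norm)
      qed
      have cnjc: "continuous_on (sphere 0 1) quat_cnj"
        by (intro linear_continuous_on linear_conv_bounded_linear[THEN iffD1] linearI) (auto simp: quat_eq_iff)
      have j1: "integrable quat_sphere (\<lambda>y. g j (?u y))" "integrable quat_sphere (\<lambda>y. quat_cnj y * g (Suc j) (?u y))"
        by (intro integrable_continuous_on_quat_sphere continuous_intros ucont cnjc)+
      have s: "?s (l(h := y)) (insert h ?I) = ?u y" for y
        using h(2) bh by (auto simp: b_def shift_def vec_eq_iff)
      have c1: "?c (l(h := y)) ?I = ?c l ?I" for y
        using h(2) by (intro ordered_prod_cong) auto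
      have c2: "?c (l(h := y)) (insert h ?I) = ?c l ?I * quat_cnj y" for y
      proof -
        have "?c (l(h := y)) (insert h ?I) = ?c (l(h := y)) ?I * quat_cnj ((l(h := y)) h)"
          by (rule ordered_prod_insert_max) (rule h(3))
        then show ?thesis by (simp only: c1 fun_upd_same)
      qed
      have "(\<integral>y. ?c (l(h := y)) ?I * g j (?s (l(h := y)) (insert h ?I)) +
         r h *\<^sub>R (?c (l(h := y)) (insert h ?I) * g (Suc j) (?s (l(h := y)) (insert h ?I))) \<partial>quat_sphere) =
        (\<integral>y. ?c l ?I * (g j (?u y) + r h *\<^sub>R (quat_cnj y * g (Suc j) (?u y))) \<partial>quat_sphere)"
        by (simp only: s c1 c2 distrib_left mult.assoc mult_scaleR_right)
      also have "\<dots> = ?c l ?I * ((\<integral>y. g j (?u y) \<partial>quat_sphere) + r h *\<^sub>R (\<integral>y. quat_cnj y * g (Suc j) (?u y) \<partial>quat_sphere))"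
        using j1 by simp
      also have "\<dots> = ?c l ?I * g j b"
      proof -
        have "g j b = (\<integral>y. g j (?u y) \<partial>quat_sphere) + r h *\<^sub>R (\<integral>y. quat_cnj y * g (Suc j) (?u y) \<partial>quat_sphere)"
          unfolding g_def h(1)
          by (rule slice_of_mean_in_variable[OF D inv Q Q h(2) _ r]) (use h(1,4) upX XD in auto)
        then show ?thesis by simp
      qed
      finally show "(\<integral>y. ?c (l(h := y)) ?I * g j (?s (l(h := y)) (insert h ?I)) +
         r h *\<^sub>R (?c (l(h := y)) (insert h ?I) * g (Suc j) (?s (l(h := y)) (insert h ?I))) \<partial>quat_sphere) = ?c l ?I * g j (?s l ?I)"
        by (simp only: b_def)
    qed
    finally have "G j j = G j (Suc j) + r h *\<^sub>R G (Suc j) (Suc j)" by simp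
    moreover have "ordered_prod r (seg (Suc j)) = ordered_prod r ?I * r h"
      unfolding h(1) by (rule ordered_prod_insert_max) (rule h(3))
    ultimately show ?thesis by (simp add: scaleR_right_distrib)
  qed
  have "g 0 a = f a"
  proof -
    obtain J z where J: "a = slice_point J z" "z \<in> D" "\<forall>h. J $ h \<in> imag_units"
      using assms(4) by (auto simp: circularization_def)
    have "Q {} z K = F z $ K" for K using Q[of "{}"] J(2) by (simp add: extends_component_def)
    moreover have "stem_parity D (Q {})" using Q[of "{}"] by (simp add: extends_component_def)
    ultimately show ?thesis
      unfolding J(1) g_def inducesD[OF F(2) J(2,3)] by (simp add: slice_of_slice_point[OF inv _ J(2,3)])
  qed
  \<comment> \<open>the integral over the product of no spheres is the value of the integrand\<close>
  then have start: "f a = ordered_prod r (seg 0) *\<^sub>R G 0 0"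
    by (simp add: G_def PiM_empty lebesgue_integral_count_space_finite shift_def)
  have "f a = (\<Sum>j<n. ordered_prod r (seg j) *\<^sub>R G j (Suc j)) + ordered_prod r (seg n) *\<^sub>R G n n" if "n \<le> CARD('n)" for n
    using that
  proof (induction n)
    case 0 then show ?case using start by simp
  next
    case (Suc n)
    then show ?case using step[of n] by (simp add: add.assoc)
  qed
  from this[OF assms(8)] have "f a = (\<Sum>j<m. ordered_prod r (seg j) *\<^sub>R G j (Suc j)) + ordered_prod r (seg m) *\<^sub>R G m m" .
  moreover have "{..<m} = {0..m - 1}" using assms(7) by auto
  ultimately show ?thesis unfolding GS by simp
qed

end
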